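(* Let $X$ and $Y$ be Hausdorff compact spaces and let $\pi: X \to Y$ be a fully closed continuous map of $X$ onto $Y$. Suppose that $C(Y)$ admits an equivalent norm that is LUR and lower semicontinuous with respect to the pointwise topology $\tau_p$, and that for every $y \in Y$ the space $C\left(\pi^{-1}(y)\right)$ admits an equivalent norm that is LUR and $\tau_p$-lower semicontinuous. Then $C(X)$ admits an equivalent norm that is LUR and $\tau_p$-lower semicontinuous.
   Context: For a compact space $K$, $C(K)$ denotes the Banach space of real-valued continuous functions on $K$ with the supremum norm. A continuous surjection $\pi: X \to Y$ between Hausdorff compact spaces is called fully closed if for any two closed disjoint subsets $F_1, F_2 \subset X$ the set $\pi(F_1) \cap \pi(F_2)$ is finite. A norm $\|\cdot\|$ on a Banach space $E$ is locally uniformly rotund (LUR) if for every $x$ in the unit sphere $S_E$ and every sequence $(x_n) \subset S_E$, $\lim_n \|(x+x_n)/2\| = 1$ implies $\lim_n \|x - x_n\| = 0$. An equivalent norm is one equivalent to the original norm. A norm on $C(K)$ is $\tau_p$-lower semicontinuous if it is lower semicontinuous with respect to the topology of pointwise convergence on $K$. *)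

theory Defs
  imports "HOL-Analysis.Analysis"
begin

text \<open>The Banach space C(K) of real continuous functions on a compact space K
 (given as a topology on some type). Elements are represented canonically:
 functions vanishing outside the topspace.\<close>
definition Cspace :: "'a topology \<Rightarrow> ('a \<Rightarrow> real) set" where
  "Cspace K = {f. continuous_map K euclideanreal f \<and> (\<forall>x. x \<notin> topspace K \<longrightarrow> f x = 0)}"

definition supnorm :: "'a topology \<Rightarrow> ('a \<Rightarrow> real) \<Rightarrow> real" where
  "supnorm K f = (if topspace K = {} then 0 else (SUP x\<in>topspace K. \<bar>f x\<bar>))"

definition is_norm_on_C :: "'a topology \<Rightarrow> (('a \<Rightarrow> real) \<Rightarrow> real) \<Rightarrow> bool" where
  "is_norm_on_C K N \<longleftrightarrow>
     (\<forall>f\<in>Cspace K. N f \<ge> 0 \<and> (N f = 0 \<longleftrightarrow> f = (\<lambda>x. 0))) \<and>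
     (\<forall>f\<in>Cspace K. \<forall>c::real. N (\<lambda>x. c * f x) = \<bar>c\<bar> * N f) \<and>
     (\<forall>f\<in>Cspace K. \<forall>g\<in>Cspace K. N (\<lambda>x. f x + g x) \<le> N f + N g)"

definition equivalent_norm_on_C :: "'a topology \<Rightarrow> (('a \<Rightarrow> real) \<Rightarrow> real) \<Rightarrow> bool" where
  "equivalent_norm_on_C K N \<longleftrightarrow> is_norm_on_C K N \<and>
     (\<exists>a b. 0 < a \<and> 0 < b \<and> (\<forall>f\<in>Cspace K. a * supnorm K f \<le> N f \<and> N f \<le> b * supnorm K f))"

definition LUR_on_C :: "'a topology \<Rightarrow> (('a \<Rightarrow> real) \<Rightarrow> real) \<Rightarrow> bool" where
  "LUR_on_C K N \<longleftrightarrow>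
     (\<forall>f\<in>Cspace K. \<forall>fs :: nat \<Rightarrow> 'a \<Rightarrow> real.
        N f = 1 \<and> (\<forall>n. fs n \<in> Cspace K \<and> N (fs n) = 1) \<and>
        (\<lambda>n. N (\<lambda>x. (f x + fs n x) / 2)) \<longlonglongrightarrow> 1
        \<longrightarrow> (\<lambda>n. N (\<lambda>x. f x - fs n x)) \<longlonglongrightarrow> 0)"

definition pointwise_lsc_on_C :: "'a topology \<Rightarrow> (('a \<Rightarrow> real) \<Rightarrow> real) \<Rightarrow> bool" where
  "pointwise_lsc_on_C K N \<longleftrightarrow>
     (\<forall>f\<in>Cspace K. \<forall>e>0. \<exists>F \<delta>. finite F \<and> F \<subseteq> topspace K \<and> \<delta> > 0 \<and>
        (\<forall>g\<in>Cspace K. (\<forall>x\<in>F. \<bar>g x - f x\<bar> < \<delta>) \<longrightarrow> N f - e < N g))"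

definition has_LUR_lsc_norm :: "'a topology \<Rightarrow> bool" where
  "has_LUR_lsc_norm K \<longleftrightarrow>
     (\<exists>N. equivalent_norm_on_C K N \<and> LUR_on_C K N \<and> pointwise_lsc_on_C K N)"

definition fully_closed :: "'a topology \<Rightarrow> 'b topology \<Rightarrow> ('a \<Rightarrow> 'b) \<Rightarrow> bool" where
  "fully_closed X Y p \<longleftrightarrow> continuous_map X Y p \<and> p ` topspace X = topspace Y \<and>
     (\<forall>F1 F2. closedin X F1 \<and> closedin X F2 \<and> F1 \<inter> F2 = {} \<longrightarrow> finite (p ` F1 \<inter> p ` F2))"

end

theory Submission
  imports Defs
begin

text \<open>For \<open>f\<close> in \<open>C(X)\<close> only finitely many fibres carry oscillation of \<open>f\<close> above a given
  level, so \<open>C(X)/C(Y)\<close> behaves like a \<open>c\<^sub>0\<close>-sum of the spaces \<open>C(\<pi>\<^sup>-\<^sup>1(y))\<close> modulo constants, and a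
  Day-type supremum over finite sets of fibres yields a convex \<open>\<tau>\<^sub>p\<close>-lower semicontinuous functional
  \<open>W\<close> that is rotund with respect to the oscillation seminorm. The passage to \<open>C(X)\<close> is a three-space
  argument: with a continuous lifting \<open>B\<close> such that \<open>f - B f\<close> lies in \<open>C(Y)\<close>, take for each \<open>k\<close> the
  supremum over \<open>h\<close> of \<open>2 W((f + h)/2) - W(h) + (1/k) N((f - B h) \<circ> s)\<^sup>2\<close>, where \<open>s\<close> is any section of
  \<open>\<pi>\<close> and \<open>N\<close> is the largest \<open>\<tau>\<^sub>p\<close>-lower semicontinuous extension of the norm of \<open>C(Y)\<close> to bounded
  functions. The first two terms are maximal at \<open>h = f\<close> and force near-maximizers to be close to \<open>f\<close>
  modulo \<open>C(Y)\<close>; then \<open>(f - B h) \<circ> s\<close> is close to a point of \<open>C(Y)\<close>, at which \<open>N\<close> is still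
  locally uniformly rotund. All functionals are kept convex and \<open>\<tau>\<^sub>p\<close>-lower semicontinuous, and the norm
  is the gauge of a sublevel set of a weighted sum of them.\<close>

section \<open>Functionals on spaces of continuous functions\<close>

text \<open>The obstacle is that \<open>B\<close> is a continuous selection and need not be linear,
  so a functional built from \<open>f - B f\<close> need not be convex or lower semicontinuous in
  \<open>f\<close>. Freezing \<open>h\<close> makes \<open>f - B h\<close> affine in
  \<open>f\<close>, and the supremum over \<open>h\<close> keeps both properties. The price is that
  \<open>f - B h\<close> need not be constant on fibres, which is why \<open>N\<close> has to accept
  functions that are merely bounded. Both suprema, over finite sets of fibres and over
  \<open>h\<close>, work in the same way: a dominant term decides where near-maximizers lie, and a
  rotund term with the small factor 1/k is carried along without disturbing that choice. How small
  the factor must be depends on \<open>f\<close>, so every \<open>k\<close> enters a weighted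
  series. Rotundity is expressed by the defect \<Phi>(f) + \<Phi>(g) - 2 \<Phi>((f+g)/2), which is
  additive in \<Phi> and nonnegative for convex \<Phi>; hence its smallness passes from a sum to
  each summand, and from a supremum to a well-chosen member.\<close>

lemma Cspace_zero [simp]: "(\<lambda>x. 0) \<in> Cspace K"
  by (simp add: Cspace_def)

lemma Cspace_add: "f \<in> Cspace K \<Longrightarrow> g \<in> Cspace K \<Longrightarrow> (\<lambda>x. f x + g x) \<in> Cspace K"
  by (auto simp: Cspace_def intro: continuous_intros)

lemma Cspace_diff: "f \<in> Cspace K \<Longrightarrow> g \<in> Cspace K \<Longrightarrow> (\<lambda>x. f x - g x) \<in> Cspace K"
  by (auto simp: Cspace_def intro: continuous_intros)

lemma Cspace_scale: "f \<in> Cspace K \<Longrightarrow> (\<lambda>x. c * f x) \<in> Cspace K"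
  by (auto simp: Cspace_def intro: continuous_map_real_mult_left)

lemma Cspace_minus: "f \<in> Cspace K \<Longrightarrow> (\<lambda>x. - f x) \<in> Cspace K"
  using Cspace_scale[of f K "-1"] by simp

lemma Cspace_divide: "f \<in> Cspace K \<Longrightarrow> (\<lambda>x. f x / c) \<in> Cspace K"
  using Cspace_scale[of f K "1/c"] by simp

lemma Cspace_comb: "f \<in> Cspace K \<Longrightarrow> g \<in> Cspace K \<Longrightarrow> (\<lambda>x. (1-t) * f x + t * g x) \<in> Cspace K"
  by (simp add: Cspace_add Cspace_scale)

lemma Cspace_mid: "f \<in> Cspace K \<Longrightarrow> g \<in> Cspace K \<Longrightarrow> (\<lambda>x. (f x + g x) / 2) \<in> Cspace K"
  using Cspace_comb[of f K g "1/2"] by (simp add: add_divide_distrib)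

lemmas Cspace_intros = Cspace_add Cspace_diff Cspace_scale Cspace_minus Cspace_divide Cspace_comb
  Cspace_mid Cspace_zero

lemma Cspace_sum:
  "(\<And>i. i \<in> I \<Longrightarrow> f i \<in> Cspace K) \<Longrightarrow> (\<lambda>x. \<Sum>i\<in>I. f i x) \<in> Cspace K"
  by (induction I rule: infinite_finite_induct) (auto intro: Cspace_add)

lemma Cspace_uniform_limit:
  assumes approx: "\<And>e. 0 < e \<Longrightarrow> \<exists>g\<in>Cspace K. \<forall>x\<in>topspace K. \<bar>f x - g x\<bar> < e"
    and off: "\<And>x. x \<notin> topspace K \<Longrightarrow> f x = 0"
  shows "f \<in> Cspace K"
proof -
  have "\<exists>g. \<forall>n::nat. g n \<in> Cspace K \<and> (\<forall>x\<in>topspace K. \<bar>f x - g n x\<bar> < inverse (real (Suc n)))"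
    by (rule choice) (metis approx inverse_positive_iff_positive of_nat_0_less_iff zero_less_Suc)
  then obtain g where g: "\<And>n. g n \<in> Cspace K"
    "\<And>n x. x \<in> topspace K \<Longrightarrow> \<bar>f x - g n x\<bar> < inverse (real (Suc n))"
    by metis
  have "continuous_map K Met_TC.mtopology f"
  proof (rule Met_TC.continuous_map_uniform_limit[where F = sequentially and f = g])
    show "\<forall>\<^sub>F n in sequentially. continuous_map K Met_TC.mtopology (g n)"
      using g(1) by (simp add: Cspace_def)
    fix e :: real assume e: "0 < e"
    then obtain N where N: "inverse (real (Suc N)) < e"
      using reals_Archimedean by blast
    show "\<forall>\<^sub>F n in sequentially. \<forall>x\<in>topspace K. f x \<in> UNIV \<and> dist (g n x) (f x) < e"
    proof (rule eventually_sequentiallyI[of N], safe)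
      fix n x assume n: "N \<le> n" and x: "x \<in> topspace K"
      have "inverse (real (Suc n)) \<le> inverse (real (Suc N))"
        using n by (simp add: le_imp_inverse_le)
      then show "dist (g n x) (f x) < e"
        using g(2)[OF x, of n] N unfolding dist_real_def by linarith
    qed auto
  qed auto
  then show ?thesis
    using off by (simp add: Cspace_def)
qed

lemma Cspace_bdd:
  assumes "compact_space K" "f \<in> Cspace K"
  shows "bdd_above ((\<lambda>x. \<bar>f x\<bar>) ` topspace K)"
proof -
  have "compactin euclideanreal (f ` topspace K)"
    using assms image_compactin unfolding compact_space_def Cspace_def by blast
  then have "bounded (f ` topspace K)"
    by (simp add: compact_imp_bounded)
  then show ?thesis
    by (auto simp: bounded_iff bdd_above_def)
qed

lemma supnorm_upper:
  assumes "compact_space K" "f \<in> Cspace K"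
  shows "\<bar>f x\<bar> \<le> supnorm K f"
proof (cases "x \<in> topspace K")
  case True
  then show ?thesis
    using cSUP_upper[OF True Cspace_bdd[OF assms]] by (auto simp: supnorm_def)
next
  case False
  then have "f x = 0" using assms by (simp add: Cspace_def)
  moreover have "0 \<le> supnorm K f"
  proof (cases "topspace K = {}")
    case False
    then obtain z where "z \<in> topspace K" by blast
    then show ?thesis
      using cSUP_upper2[OF Cspace_bdd[OF assms], of z 0] False by (simp add: supnorm_def)
  qed (simp add: supnorm_def)
  ultimately show ?thesis by simp
qed

lemma supnorm_nonneg: "compact_space K \<Longrightarrow> f \<in> Cspace K \<Longrightarrow> 0 \<le> supnorm K f"
  using supnorm_upper[of K f undefined] by linarith

lemma supnorm_least:
  assumes "0 \<le> c" "\<And>x. x \<in> topspace K \<Longrightarrow> \<bar>f x\<bar> \<le> c"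
  shows "supnorm K f \<le> c"
  using assms by (auto simp: supnorm_def intro: cSUP_least)

lemma supnorm_zero [simp]: "supnorm K (\<lambda>x. 0) = 0"
  by (simp add: supnorm_def)

lemma supnorm_add:
  assumes "compact_space K" "f \<in> Cspace K" "g \<in> Cspace K"
  shows "supnorm K (\<lambda>x. f x + g x) \<le> supnorm K f + supnorm K g"
  using supnorm_upper[OF assms(1,2)] supnorm_upper[OF assms(1,3)]
    supnorm_nonneg[OF assms(1,2)] supnorm_nonneg[OF assms(1,3)]
  by (intro supnorm_least) (auto intro: order_trans[OF abs_triangle_ineq] add_mono)

lemma supnorm_scale_le:
  assumes "compact_space K" "f \<in> Cspace K"
  shows "supnorm K (\<lambda>x. c * f x) \<le> \<bar>c\<bar> * supnorm K f"
  using supnorm_upper[OF assms] supnorm_nonneg[OF assms]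
  by (intro supnorm_least) (auto simp: abs_mult mult_left_mono)

lemma supnorm_minus [simp]: "supnorm K (\<lambda>x. - f x) = supnorm K f"
  by (simp add: supnorm_def)

lemma supnorm_scale:
  assumes "compact_space K" "f \<in> Cspace K"
  shows "supnorm K (\<lambda>x. c * f x) = \<bar>c\<bar> * supnorm K f"
proof (cases "c = 0")
  case False
  have "supnorm K f \<le> \<bar>1/c\<bar> * supnorm K (\<lambda>x. c * f x)"
    using supnorm_scale_le[OF assms(1) Cspace_scale[OF assms(2), of c], of "1/c"] False by simp
  then show ?thesis
    using supnorm_scale_le[OF assms, of c] False by (simp add: field_simps abs_mult)
qed simp

section \<open>Convexity, midpoint defects and pointwise lower semicontinuity\<close>

definition convex_on_C :: "'a topology \<Rightarrow> (('a \<Rightarrow> real) \<Rightarrow> real) \<Rightarrow> bool" where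
  "convex_on_C K \<Phi> \<longleftrightarrow> (\<forall>f\<in>Cspace K. \<forall>g\<in>Cspace K. \<forall>t. 0 \<le> t \<and> t \<le> 1 \<longrightarrow>
     \<Phi> (\<lambda>x. (1-t) * f x + t * g x) \<le> (1-t) * \<Phi> f + t * \<Phi> g)"

text \<open>Squares of equivalent norms grow quadratically; such a bound gives one scalar weight per
  functional that makes a series converge at every \<open>f\<close> at once.\<close>

definition quad_bounded_on_C :: "'a topology \<Rightarrow> (('a \<Rightarrow> real) \<Rightarrow> real) \<Rightarrow> bool" where
  "quad_bounded_on_C K \<Phi> \<longleftrightarrow> (\<exists>c\<ge>0. \<forall>f\<in>Cspace K. \<Phi> f \<le> c * (1 + (supnorm K f)\<^sup>2))"

definition admissible :: "'a topology \<Rightarrow> (('a \<Rightarrow> real) \<Rightarrow> real) \<Rightarrow> bool" where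
  "admissible K \<Phi> \<longleftrightarrow> (\<forall>f\<in>Cspace K. 0 \<le> \<Phi> f) \<and> convex_on_C K \<Phi> \<and> pointwise_lsc_on_C K \<Phi> \<and>
     quad_bounded_on_C K \<Phi>"

definition mid_defect :: "(('a \<Rightarrow> real) \<Rightarrow> real) \<Rightarrow> ('a \<Rightarrow> real) \<Rightarrow> ('a \<Rightarrow> real) \<Rightarrow> real" where
  "mid_defect \<Phi> f g = \<Phi> f + \<Phi> g - 2 * \<Phi> (\<lambda>x. (f x + g x) / 2)"

lemma convex_on_CD:
  "convex_on_C K \<Phi> \<Longrightarrow> f \<in> Cspace K \<Longrightarrow> g \<in> Cspace K \<Longrightarrow> 0 \<le> t \<Longrightarrow> t \<le> 1 \<Longrightarrow>
    \<Phi> (\<lambda>x. (1-t) * f x + t * g x) \<le> (1-t) * \<Phi> f + t * \<Phi> g"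
  by (simp add: convex_on_C_def)

lemma convex_on_C_mid:
  assumes "convex_on_C K \<Phi>" "f \<in> Cspace K" "g \<in> Cspace K"
  shows "2 * \<Phi> (\<lambda>x. (f x + g x) / 2) \<le> \<Phi> f + \<Phi> g"
  using convex_on_CD[OF assms, of "1/2"] by (simp add: add_divide_distrib)

lemma mid_defect_nonneg:
  "convex_on_C K \<Phi> \<Longrightarrow> f \<in> Cspace K \<Longrightarrow> g \<in> Cspace K \<Longrightarrow> 0 \<le> mid_defect \<Phi> f g"
  using convex_on_C_mid[of K \<Phi> f g] by (simp add: mid_defect_def)

lemma convex_on_C_add:
  assumes "convex_on_C K \<Phi>" "convex_on_C K \<Psi>"
  shows "convex_on_C K (\<lambda>f. \<Phi> f + \<Psi> f)"
  unfolding convex_on_C_def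
proof (intro ballI allI impI)
  fix f g and t :: real assume "f \<in> Cspace K" "g \<in> Cspace K" "0 \<le> t \<and> t \<le> 1"
  then show "\<Phi> (\<lambda>x. (1-t) * f x + t * g x) + \<Psi> (\<lambda>x. (1-t) * f x + t * g x)
      \<le> (1-t) * (\<Phi> f + \<Psi> f) + t * (\<Phi> g + \<Psi> g)"
    using convex_on_CD[OF assms(1), of f g t] convex_on_CD[OF assms(2), of f g t]
    by (simp add: algebra_simps)
qed

lemma convex_on_C_cmult:
  assumes "convex_on_C K \<Phi>" "0 \<le> c"
  shows "convex_on_C K (\<lambda>f. c * \<Phi> f)"
  unfolding convex_on_C_def
proof (intro ballI allI impI)
  fix f g and t :: real assume "f \<in> Cspace K" "g \<in> Cspace K" "0 \<le> t \<and> t \<le> 1"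
  then have "c * \<Phi> (\<lambda>x. (1-t) * f x + t * g x) \<le> c * ((1-t) * \<Phi> f + t * \<Phi> g)"
    using convex_on_CD[OF assms(1), of f g t] assms(2) by (simp add: mult_left_mono)
  then show "c * \<Phi> (\<lambda>x. (1-t) * f x + t * g x) \<le> (1-t) * (c * \<Phi> f) + t * (c * \<Phi> g)"
    by (simp add: algebra_simps)
qed

lemma convex_on_C_const: "convex_on_C K (\<lambda>f. c)"
  by (simp add: convex_on_C_def algebra_simps)

lemma convex_on_C_sum:
  "(\<And>i. i \<in> I \<Longrightarrow> convex_on_C K (G i)) \<Longrightarrow> convex_on_C K (\<lambda>f. \<Sum>i\<in>I. G i f)"
  by (induction I rule: infinite_finite_induct) (auto intro: convex_on_C_add convex_on_C_const)

lemma convex_square: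
  fixes a b c t :: real
  assumes "0 \<le> c" "c \<le> (1-t) * a + t * b" "0 \<le> t" "t \<le> 1"
  shows "c\<^sup>2 \<le> (1-t) * a\<^sup>2 + t * b\<^sup>2"
proof -
  have "c\<^sup>2 \<le> ((1-t) * a + t * b)\<^sup>2"
    using assms by (simp add: power_mono)
  also have "\<dots> = (1-t) * a\<^sup>2 + t * b\<^sup>2 - t * (1-t) * (a-b)\<^sup>2"
    by (simp add: power2_eq_square algebra_simps)
  also have "\<dots> \<le> (1-t) * a\<^sup>2 + t * b\<^sup>2"
    using assms by simp
  finally show ?thesis .
qed

lemma convex_on_C_square:
  assumes "convex_on_C K \<Phi>" "\<And>f. f \<in> Cspace K \<Longrightarrow> 0 \<le> \<Phi> f"
  shows "convex_on_C K (\<lambda>f. (\<Phi> f)\<^sup>2)"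
  unfolding convex_on_C_def
  by (auto intro!: convex_square convex_on_CD[OF assms(1)] assms(2) Cspace_comb)

text \<open>With \<open>a\<close>, \<open>b\<close> the values at the ends and \<open>m\<close> the
  value at the midpoint, twice the defect is \<open>2a^2 + 2b^2 - (2m)^2\<close>, and
  \<open>2m \<le> a + b\<close> leaves at least \<open>(a - b)^2\<close>.\<close>

lemma mid_defect_square:
  assumes "convex_on_C K \<Phi>" "\<And>f. f \<in> Cspace K \<Longrightarrow> 0 \<le> \<Phi> f" "f \<in> Cspace K" "g \<in> Cspace K"
  shows "(\<Phi> f - \<Phi> g)\<^sup>2 \<le> 2 * mid_defect (\<lambda>f. (\<Phi> f)\<^sup>2) f g"
proof -
  define m where "m = \<Phi> (\<lambda>x. (f x + g x) / 2)"
  have "0 \<le> m" "2 * m \<le> \<Phi> f + \<Phi> g"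
    using convex_on_C_mid[OF assms(1,3,4)] assms(2)[OF Cspace_mid[OF assms(3,4)]] by (auto simp: m_def)
  then have "(2 * m)\<^sup>2 \<le> (\<Phi> f + \<Phi> g)\<^sup>2"
    by (intro power_mono) auto
  then show ?thesis
    by (simp add: mid_defect_def m_def[symmetric] power2_eq_square algebra_simps)
qed

lemma lscD:
  assumes "pointwise_lsc_on_C K \<Phi>" "f \<in> Cspace K" "a < \<Phi> f"
  obtains F d where "finite F" "F \<subseteq> topspace K" "0 < d"
    "\<forall>g\<in>Cspace K. (\<forall>x\<in>F. \<bar>g x - f x\<bar> < d) \<longrightarrow> a < \<Phi> g"
proof -
  have "\<exists>F d. finite F \<and> F \<subseteq> topspace K \<and> 0 < d \<and>
    (\<forall>g\<in>Cspace K. (\<forall>x\<in>F. \<bar>g x - f x\<bar> < d) \<longrightarrow> \<Phi> f - (\<Phi> f - a) < \<Phi> g)"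
    using assms(1)[unfolded pointwise_lsc_on_C_def, rule_format, OF assms(2), of "\<Phi> f - a"] assms(3)
    by simp
  then show thesis by (elim exE conjE, intro that) auto
qed

lemma lscI:
  assumes "\<And>f a. f \<in> Cspace K \<Longrightarrow> a < \<Phi> f \<Longrightarrow> \<exists>F d. finite F \<and> F \<subseteq> topspace K \<and> 0 < d \<and>
    (\<forall>g\<in>Cspace K. (\<forall>x\<in>F. \<bar>g x - f x\<bar> < d) \<longrightarrow> a < \<Phi> g)"
  shows "pointwise_lsc_on_C K \<Phi>"
  unfolding pointwise_lsc_on_C_def using assms by simp

lemma lsc_const: "pointwise_lsc_on_C K (\<lambda>f. c)"
  by (rule lscI) (auto intro!: exI[of _ "{}"] exI[of _ 1])

lemma lsc_add:
  assumes "pointwise_lsc_on_C K \<Phi>" "pointwise_lsc_on_C K \<Psi>"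
  shows "pointwise_lsc_on_C K (\<lambda>f. \<Phi> f + \<Psi> f)"
proof (rule lscI)
  fix f a assume f: "f \<in> Cspace K" and a: "a < \<Phi> f + \<Psi> f"
  define e where "e = (\<Phi> f + \<Psi> f - a) / 2"
  have e: "\<Phi> f - e < \<Phi> f" "\<Psi> f - e < \<Psi> f" using a by (auto simp: e_def)
  obtain F d where F: "finite F" "F \<subseteq> topspace K" "0 < d"
    "\<forall>g\<in>Cspace K. (\<forall>x\<in>F. \<bar>g x - f x\<bar> < d) \<longrightarrow> \<Phi> f - e < \<Phi> g"
    by (rule lscD[OF assms(1) f, OF e(1)])
  obtain F' d' where F': "finite F'" "F' \<subseteq> topspace K" "0 < d'"
    "\<forall>g\<in>Cspace K. (\<forall>x\<in>F'. \<bar>g x - f x\<bar> < d') \<longrightarrow> \<Psi> f - e < \<Psi> g"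
    by (rule lscD[OF assms(2) f, OF e(2)])
  have "a < \<Phi> g + \<Psi> g" if g: "g \<in> Cspace K" "\<forall>x\<in>F \<union> F'. \<bar>g x - f x\<bar> < min d d'" for g
  proof -
    have "\<Phi> f - e < \<Phi> g" "\<Psi> f - e < \<Psi> g" using F(4) F'(4) g by auto
    then show ?thesis by (simp add: e_def field_simps)
  qed
  then show "\<exists>F d. finite F \<and> F \<subseteq> topspace K \<and> 0 < d \<and>
      (\<forall>g\<in>Cspace K. (\<forall>x\<in>F. \<bar>g x - f x\<bar> < d) \<longrightarrow> a < \<Phi> g + \<Psi> g)"
    using F F' by (intro exI[of _ "F \<union> F'"] exI[of _ "min d d'"]) auto
qed

text \<open>Serves compositions with an increasing left-continuous function. The condition on
  superlevel sets asks for monotonicity only on the values that \<open>\<Phi>\<close> takes, so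
  squaring is covered for nonnegative \<open>\<Phi>\<close>.\<close>

lemma lsc_mono_comp:
  assumes "pointwise_lsc_on_C K \<Phi>"
    and "\<And>f a. f \<in> Cspace K \<Longrightarrow> a < \<Psi> f \<Longrightarrow>
      \<exists>b<\<Phi> f. \<forall>g\<in>Cspace K. b < \<Phi> g \<longrightarrow> a < \<Psi> g"
  shows "pointwise_lsc_on_C K \<Psi>"
proof (rule lscI)
  fix f a assume f: "f \<in> Cspace K" and a: "a < \<Psi> f"
  obtain b where b: "b < \<Phi> f" "\<And>g. g \<in> Cspace K \<Longrightarrow> b < \<Phi> g \<Longrightarrow> a < \<Psi> g"
    using assms(2)[OF f a] by auto
  obtain F d where "finite F" "F \<subseteq> topspace K" "0 < d"
    "\<forall>g\<in>Cspace K. (\<forall>x\<in>F. \<bar>g x - f x\<bar> < d) \<longrightarrow> b < \<Phi> g"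
    by (rule lscD[OF assms(1) f, OF b(1)])
  then show "\<exists>F d. finite F \<and> F \<subseteq> topspace K \<and> 0 < d \<and>
      (\<forall>g\<in>Cspace K. (\<forall>x\<in>F. \<bar>g x - f x\<bar> < d) \<longrightarrow> a < \<Psi> g)"
    using b(2) by (intro exI[of _ F] exI[of _ d]) auto
qed

lemma lsc_cmult:
  assumes "pointwise_lsc_on_C K \<Phi>" "0 \<le> c"
  shows "pointwise_lsc_on_C K (\<lambda>f. c * \<Phi> f)"
proof (cases "c = 0")
  case False
  then have "0 < c" using assms by simp
  show ?thesis
  proof (rule lsc_mono_comp[OF assms(1)])
    fix f a assume "f \<in> Cspace K" "a < c * \<Phi> f"
    then show "\<exists>b<\<Phi> f. \<forall>g\<in>Cspace K. b < \<Phi> g \<longrightarrow> a < c * \<Phi> g"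
      using \<open>0 < c\<close> by (intro exI[of _ "a/c"]) (auto simp: field_simps)
  qed
qed (simp add: lsc_const)

lemma lsc_square:
  assumes "pointwise_lsc_on_C K \<Phi>" "\<And>f. f \<in> Cspace K \<Longrightarrow> 0 \<le> \<Phi> f"
  shows "pointwise_lsc_on_C K (\<lambda>f. (\<Phi> f)\<^sup>2)"
proof (rule lsc_mono_comp[OF assms(1)])
  fix f a assume f: "f \<in> Cspace K" and a: "a < (\<Phi> f)\<^sup>2"
  show "\<exists>b<\<Phi> f. \<forall>g\<in>Cspace K. b < \<Phi> g \<longrightarrow> a < (\<Phi> g)\<^sup>2"
  proof (cases "a < 0")
    case True
    then show ?thesis
      by (intro exI[of _ "\<Phi> f - 1"]) (auto intro: less_le_trans)
  next
    case False
    then have "sqrt a < \<Phi> f"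
      using a assms(2)[OF f] real_less_lsqrt by simp
    moreover have "a < (\<Phi> g)\<^sup>2" if "sqrt a < \<Phi> g" for g
      using False that by (meson not_le real_le_rsqrt sqrt_le_D not_less real_sqrt_le_iff le_less_trans)
    ultimately show ?thesis by blast
  qed
qed

lemma lsc_sum:
  "(\<And>i. i \<in> I \<Longrightarrow> pointwise_lsc_on_C K (G i)) \<Longrightarrow> pointwise_lsc_on_C K (\<lambda>f. \<Sum>i\<in>I. G i f)"
  by (induction I rule: infinite_finite_induct) (auto intro: lsc_add lsc_const)

lemma lsc_SUP:
  assumes "I \<noteq> {}" "\<And>i. i \<in> I \<Longrightarrow> pointwise_lsc_on_C K (G i)"
    "\<And>f. f \<in> Cspace K \<Longrightarrow> bdd_above ((\<lambda>i. G i f) ` I)"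
  shows "pointwise_lsc_on_C K (\<lambda>f. SUP i\<in>I. G i f)"
proof (rule lscI)
  fix f a assume f: "f \<in> Cspace K" and a: "a < (SUP i\<in>I. G i f)"
  then obtain i where i: "i \<in> I" "a < G i f"
    using less_cSUP_iff[OF assms(1) assms(3)[OF f]] by auto
  obtain F d where
    F: "finite F" "F \<subseteq> topspace K" "0 < d"
    "\<forall>g\<in>Cspace K. (\<forall>x\<in>F. \<bar>g x - f x\<bar> < d) \<longrightarrow> a < G i g"
    by (rule lscD[OF assms(2)[OF i(1)] f, OF i(2)])
  then show "\<exists>F d. finite F \<and> F \<subseteq> topspace K \<and> 0 < d \<and>
      (\<forall>g\<in>Cspace K. (\<forall>x\<in>F. \<bar>g x - f x\<bar> < d) \<longrightarrow> a < (SUP i\<in>I. G i g))"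
    by (intro exI[of _ F] exI[of _ d]) (auto intro!: less_le_trans[OF _ cSUP_upper[OF i(1) assms(3)]])
qed

lemma convex_on_C_SUP:
  assumes "I \<noteq> {}" "\<And>i. i \<in> I \<Longrightarrow> convex_on_C K (G i)"
    "\<And>f. f \<in> Cspace K \<Longrightarrow> bdd_above ((\<lambda>i. G i f) ` I)"
  shows "convex_on_C K (\<lambda>f. SUP i\<in>I. G i f)"
  unfolding convex_on_C_def
proof (intro ballI allI impI cSUP_least[OF assms(1)])
  fix f g i and t :: real assume *: "f \<in> Cspace K" "g \<in> Cspace K" "0 \<le> t \<and> t \<le> 1" "i \<in> I"
  then have "G i (\<lambda>x. (1-t) * f x + t * g x) \<le> (1-t) * G i f + t * G i g"
    using convex_on_CD[OF assms(2)] by blast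
  also have "\<dots> \<le> (1-t) * (SUP i\<in>I. G i f) + t * (SUP i\<in>I. G i g)"
    using * by (intro add_mono mult_left_mono cSUP_upper assms(3)) auto
  finally show "G i (\<lambda>x. (1-t) * f x + t * g x) \<le> (1-t) * (SUP i\<in>I. G i f) + t * (SUP i\<in>I. G i g)" .
qed

text \<open>Take \<open>i\<close> almost maximal at the midpoint. The losses of \<open>G i\<close>
  against the supremum at \<open>f\<close> and at \<open>g\<close>, plus the defect of
  \<open>G i\<close>, add up to the defect of the supremum plus twice the loss at the midpoint,
  which is below \<open>2 * \<eta>\<close>. The three summands are nonnegative, so each is
  small.\<close>

lemma SUP_near_max:
  assumes "I \<noteq> {}" and bdd: "\<And>f. f \<in> Cspace K \<Longrightarrow> bdd_above ((\<lambda>i. G i f) ` I)"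
    and conv: "\<And>i. i \<in> I \<Longrightarrow> convex_on_C K (G i)"
    and f: "f \<in> Cspace K" and g: "g \<in> Cspace K"
    and "mid_defect (\<lambda>f. SUP i\<in>I. G i f) f g < \<eta>" "0 < \<eta>"
  obtains i where "i \<in> I" "(SUP i\<in>I. G i f) - 2 * \<eta> < G i f" "mid_defect (G i) f g < 2 * \<eta>"
proof -
  define m where "m = (\<lambda>x. (f x + g x) / 2)"
  have m: "m \<in> Cspace K" using f g by (simp add: m_def Cspace_mid)
  have "(SUP i\<in>I. G i m) - \<eta>/2 < (SUP i\<in>I. G i m)" using \<open>0 < \<eta>\<close> by simp
  then obtain i where i: "i \<in> I" "(SUP i\<in>I. G i m) - \<eta>/2 < G i m"
    using less_cSUP_iff[OF assms(1) bdd[OF m]] by auto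
  have "0 \<le> mid_defect (G i) f g"
    using mid_defect_nonneg[OF conv[OF i(1)] f g] .
  moreover have "G i f \<le> (SUP i\<in>I. G i f)" "G i g \<le> (SUP i\<in>I. G i g)"
    using cSUP_upper[OF i(1) bdd[OF f]] cSUP_upper[OF i(1) bdd[OF g]] by auto
  ultimately show thesis
    using i(2) assms(6,7) by (intro that[OF i(1)]) (auto simp: mid_defect_def m_def)
qed

section \<open>Renorming from an admissible functional\<close>

text \<open>The weights make the series converge and keep its growth quadratic. Its defect is the
  weighted sum of the nonnegative defects of the terms, so it controls each of them, with the
  inverse weight as constant.\<close>

lemma admissible_series:
  assumes K: "compact_space K" and adm: "\<And>j::nat. admissible K (\<Phi> j)"
  obtains \<Psi> where "admissible K \<Psi>"
    "\<forall>j. \<exists>c>0. \<forall>f\<in>Cspace K. \<forall>g\<in>Cspace K. mid_defect (\<Phi> j) f g \<le> c * mid_defect \<Psi> f g"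
proof -
  have "\<forall>j. \<exists>c\<ge>0. \<forall>f\<in>Cspace K. \<Phi> j f \<le> c * (1 + (supnorm K f)\<^sup>2)"
    using adm by (auto simp: admissible_def quad_bounded_on_C_def)
  then obtain c where c: "\<And>j. 0 \<le> c j"
    "\<And>j f. f \<in> Cspace K \<Longrightarrow> \<Phi> j f \<le> c j * (1 + (supnorm K f)\<^sup>2)"
    by metis
  define a where "a j = (1/2)^j / (1 + c j)" for j
  have a: "0 < a j" for j using c(1)[of j] by (simp add: a_def add_pos_nonneg)
  define \<Psi> where "\<Psi> f = (\<Sum>j. a j * \<Phi> j f)" for f
  have nonneg: "0 \<le> \<Phi> j f" if "f \<in> Cspace K" for j f
    using adm that by (simp add: admissible_def)
  have conv: "convex_on_C K (\<Phi> j)" for j using adm by (simp add: admissible_def)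
  have bd: "a j * \<Phi> j f \<le> (1/2)^j * (1 + (supnorm K f)\<^sup>2)" if "f \<in> Cspace K" for j f
  proof -
    have "\<Phi> j f \<le> (1 + c j) * (1 + (supnorm K f)\<^sup>2)"
      using c(2)[OF that, of j] by (rule order_trans) (intro mult_right_mono, auto)
    then have "a j * \<Phi> j f \<le> a j * ((1 + c j) * (1 + (supnorm K f)\<^sup>2))"
      using a[of j] by simp
    then show ?thesis using c(1)[of j] by (simp add: a_def add_nonneg_eq_0_iff)
  qed
  have sumb: "summable (\<lambda>j. (1/2::real)^j * B)" for B
    by (intro summable_mult2 summable_geometric) simp
  have summ: "summable (\<lambda>j. a j * \<Phi> j f)" if "f \<in> Cspace K" for f
    using bd[OF that] nonneg[OF that] a by (intro summable_comparison_test'[OF sumb]) (simp add: less_imp_le)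
  have has_sum: "(\<lambda>j. a j * \<Phi> j f) sums \<Psi> f" if "f \<in> Cspace K" for f
    unfolding \<Psi>_def by (rule summable_sums[OF summ[OF that]])
  have \<Psi>_nonneg: "0 \<le> \<Psi> f" if "f \<in> Cspace K" for f
    unfolding \<Psi>_def using nonneg[OF that] a by (intro suminf_nonneg summ that) (simp add: less_imp_le)
  have "convex_on_C K \<Psi>"
    unfolding convex_on_C_def
  proof (intro ballI allI impI)
    fix f g and t :: real assume *: "f \<in> Cspace K" "g \<in> Cspace K" "0 \<le> t \<and> t \<le> 1"
    have "\<Psi> (\<lambda>x. (1-t) * f x + t * g x) \<le> (\<Sum>j. (1-t) * (a j * \<Phi> j f) + t * (a j * \<Phi> j g))"
      unfolding \<Psi>_def
    proof (intro suminf_le summ Cspace_comb summable_add summable_mult)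
      fix j
      show "a j * \<Phi> j (\<lambda>x. (1-t) * f x + t * g x) \<le> (1-t) * (a j * \<Phi> j f) + t * (a j * \<Phi> j g)"
        using convex_on_CD[OF convex_on_C_cmult[OF conv, of "a j"], of f g t] * a[of j] by simp
    qed (use * in auto)
    also have "\<dots> = (1-t) * \<Psi> f + t * \<Psi> g"
      by (rule sums_unique[symmetric]) (intro sums_add sums_mult has_sum *)
    finally show "\<Psi> (\<lambda>x. (1-t) * f x + t * g x) \<le> (1-t) * \<Psi> f + t * \<Psi> g" .
  qed
  moreover have "pointwise_lsc_on_C K \<Psi>"
  proof (rule lscI)
    fix f b assume f: "f \<in> Cspace K" and b: "b < \<Psi> f"
    have "(\<lambda>n. \<Sum>j<n. a j * \<Phi> j f) \<longlonglongrightarrow> \<Psi> f"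
      using has_sum[OF f] by (simp add: sums_def)
    \<comment> \<open>The terms are nonnegative, so a partial sum that stays above \<open>b\<close>
      near \<open>f\<close> keeps the whole series above \<open>b\<close> there.\<close>
    from order_tendstoD(1)[OF this b] obtain n where n: "b < (\<Sum>j<n. a j * \<Phi> j f)"
      by (auto simp: eventually_sequentially)
    have l: "pointwise_lsc_on_C K (\<lambda>f. \<Sum>j<n. a j * \<Phi> j f)"
      using adm a by (intro lsc_sum lsc_cmult) (auto simp: admissible_def less_imp_le)
    obtain F d where F: "finite F" "F \<subseteq> topspace K" "0 < d"
      "\<forall>g\<in>Cspace K. (\<forall>x\<in>F. \<bar>g x - f x\<bar> < d) \<longrightarrow> b < (\<Sum>j<n. a j * \<Phi> j g)"
      by (rule lscD[OF l f, OF n])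
    have "(\<Sum>j<n. a j * \<Phi> j g) \<le> \<Psi> g" if "g \<in> Cspace K" for g
      unfolding \<Psi>_def using nonneg[OF that] a by (intro sum_le_suminf summ that) (auto simp: less_imp_le)
    with F show "\<exists>F d. finite F \<and> F \<subseteq> topspace K \<and> 0 < d \<and>
        (\<forall>g\<in>Cspace K. (\<forall>x\<in>F. \<bar>g x - f x\<bar> < d) \<longrightarrow> b < \<Psi> g)"
      by (intro exI[of _ F] exI[of _ d]) (auto intro: less_le_trans[OF F(4)[rule_format]])
  qed
  moreover have "quad_bounded_on_C K \<Psi>"
    unfolding quad_bounded_on_C_def
  proof (intro exI[of _ 2] conjI ballI)
    fix f assume f: "f \<in> Cspace K"
    have "\<Psi> f \<le> (\<Sum>j. (1/2)^j * (1 + (supnorm K f)\<^sup>2))"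
      unfolding \<Psi>_def by (intro suminf_le bd f summ sumb)
    also have "\<dots> = 2 * (1 + (supnorm K f)\<^sup>2)"
      using sums_unique[OF sums_mult2[OF geometric_sums[of "1/2::real"]], of "1 + (supnorm K f)\<^sup>2"] by simp
    finally show "\<Psi> f \<le> 2 * (1 + (supnorm K f)\<^sup>2)" .
  qed simp
  moreover have "\<exists>c>0. \<forall>f\<in>Cspace K. \<forall>g\<in>Cspace K. mid_defect (\<Phi> j) f g \<le> c * mid_defect \<Psi> f g" for j
  proof (intro exI[of _ "1 / a j"] conjI ballI)
    fix f g assume *: "f \<in> Cspace K" "g \<in> Cspace K"
    define m where "m = (\<lambda>x. (f x + g x) / 2)"
    have m: "m \<in> Cspace K" using * by (simp add: m_def Cspace_mid)
    have eq: "(\<lambda>j. a j * mid_defect (\<Phi> j) f g) = (\<lambda>j. a j * \<Phi> j f + a j * \<Phi> j g - 2 * (a j * \<Phi> j m))"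
      by (simp add: mid_defect_def m_def algebra_simps)
    have s: "(\<lambda>j. a j * mid_defect (\<Phi> j) f g) sums mid_defect \<Psi> f g"
      unfolding eq unfolding mid_defect_def m_def[symmetric] by (intro sums_add sums_diff sums_mult has_sum * m)
    have "a j * mid_defect (\<Phi> j) f g = (\<Sum>i\<in>{j}. a i * mid_defect (\<Phi> i) f g)" by simp
    also have "\<dots> \<le> (\<Sum>j. a j * mid_defect (\<Phi> j) f g)"
      using a mid_defect_nonneg[OF conv *] by (intro sum_le_suminf sums_summable[OF s]) (auto simp: less_imp_le)
    also have "\<dots> = mid_defect \<Psi> f g" by (rule sums_unique[OF s, symmetric])
    finally show "mid_defect (\<Phi> j) f g \<le> 1 / a j * mid_defect \<Psi> f g"
      using a[of j] by (simp add: field_simps)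
  qed (use a in simp)
  ultimately show thesis
    by (intro that[of \<Psi>]) (auto simp: admissible_def \<Psi>_nonneg)
qed

lemma lsc_coordinate: "x \<in> topspace K \<Longrightarrow> pointwise_lsc_on_C K (\<lambda>f. f x)"
  by (rule lscI, rule_tac x = "{x}" in exI, rule_tac x = "f x - a" in exI) auto

lemma lsc_minus_coordinate: "x \<in> topspace K \<Longrightarrow> pointwise_lsc_on_C K (\<lambda>f. - f x)"
  by (rule lscI, rule_tac x = "{x}" in exI, rule_tac x = "- f x - a" in exI) auto

lemma lsc_abs_coordinate: "x \<in> topspace K \<Longrightarrow> pointwise_lsc_on_C K (\<lambda>f. \<bar>f x\<bar>)"
  by (rule lscI, rule_tac x = "{x}" in exI, rule_tac x = "\<bar>f x\<bar> - a" in exI) auto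

lemma lsc_supnorm:
  assumes "compact_space K"
  shows "pointwise_lsc_on_C K (supnorm K)"
proof (cases "topspace K = {}")
  case True
  then have "supnorm K = (\<lambda>f. 0)" by (auto simp: supnorm_def)
  then show ?thesis by (simp add: lsc_const)
next
  case False
  then have "supnorm K = (\<lambda>f. SUP x\<in>topspace K. \<bar>f x\<bar>)" by (simp add: supnorm_def fun_eq_iff)
  then show ?thesis
    using lsc_SUP[OF False lsc_abs_coordinate Cspace_bdd[OF assms]] by simp
qed

lemma lsc_reflect:
  assumes "pointwise_lsc_on_C K \<Phi>"
  shows "pointwise_lsc_on_C K (\<lambda>f. \<Phi> (\<lambda>x. - f x))"
proof (rule lscI)
  fix f a assume f: "f \<in> Cspace K" and a: "a < \<Phi> (\<lambda>x. - f x)"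
  obtain F d where
    F: "finite F" "F \<subseteq> topspace K" "0 < d"
    "\<forall>g\<in>Cspace K. (\<forall>x\<in>F. \<bar>g x - - f x\<bar> < d) \<longrightarrow> a < \<Phi> g"
    by (rule lscD[OF assms Cspace_minus[OF f], OF a])
  have "a < \<Phi> (\<lambda>x. - g x)" if "g \<in> Cspace K" "\<forall>x\<in>F. \<bar>g x - f x\<bar> < d" for g
    using that by (intro F(4)[rule_format] Cspace_minus) (auto simp: abs_minus_commute)
  with F show "\<exists>F d. finite F \<and> F \<subseteq> topspace K \<and> 0 < d \<and>
      (\<forall>g\<in>Cspace K. (\<forall>x\<in>F. \<bar>g x - f x\<bar> < d) \<longrightarrow> a < \<Phi> (\<lambda>x. - g x))"
    by blast
qed

lemma convex_on_C_reflect: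
  assumes "convex_on_C K \<Phi>"
  shows "convex_on_C K (\<lambda>f. \<Phi> (\<lambda>x. - f x))"
  unfolding convex_on_C_def
proof (intro ballI allI impI)
  fix f g and t :: real assume *: "f \<in> Cspace K" "g \<in> Cspace K" "0 \<le> t \<and> t \<le> 1"
  have "(\<lambda>x. - ((1-t) * f x + t * g x)) = (\<lambda>x. (1-t) * - f x + t * - g x)"
    by (simp add: fun_eq_iff)
  then show "\<Phi> (\<lambda>x. - ((1-t) * f x + t * g x)) \<le> (1-t) * \<Phi> (\<lambda>x. - f x) + t * \<Phi> (\<lambda>x. - g x)"
    using convex_on_CD[OF assms Cspace_minus[OF *(1)] Cspace_minus[OF *(2)], of t] * by simp
qed

lemma convex_on_C_supnorm:
  assumes "compact_space K"
  shows "convex_on_C K (supnorm K)"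
  unfolding convex_on_C_def
proof (intro ballI allI impI)
  fix f g and t :: real assume *: "f \<in> Cspace K" "g \<in> Cspace K" "0 \<le> t \<and> t \<le> 1"
  show "supnorm K (\<lambda>x. (1-t) * f x + t * g x) \<le> (1-t) * supnorm K f + t * supnorm K g"
    using supnorm_add[OF assms Cspace_scale[OF *(1)] Cspace_scale[OF *(2)], of "1-t" t] *
    by (simp add: supnorm_scale[OF assms])
qed


text \<open>The norm is the gauge of a sublevel set of the even function
  \<open>\<Phi> f + \<Phi> (-f) + \<parallel>f\<parallel>\<^sup>2\<close>.\<close>

lemma has_LUR_lsc_norm_if_admissible:
  assumes K: "compact_space K" and adm: "admissible K \<Phi>"
    and rotund: "\<And>f e. f \<in> Cspace K \<Longrightarrow> supnorm K f \<le> 1 \<Longrightarrow> 0 < e \<Longrightarrow>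
      \<exists>d>0. \<forall>g\<in>Cspace K. supnorm K g \<le> 1 \<longrightarrow> mid_defect \<Phi> f g < d \<longrightarrow> supnorm K (\<lambda>x. f x - g x) \<le> e"
  shows "has_LUR_lsc_norm K"
proof -
  define \<Psi> where "\<Psi> f = \<Phi> f + \<Phi> (\<lambda>x. - f x) + (supnorm K f)\<^sup>2" for f
  have conv\<Phi>: "convex_on_C K \<Phi>" and lsc\<Phi>: "pointwise_lsc_on_C K \<Phi>"
    and nonneg\<Phi>: "\<And>f. f \<in> Cspace K \<Longrightarrow> 0 \<le> \<Phi> f"
    using adm by (auto simp: admissible_def)
  note sn0 = supnorm_nonneg[OF K]
  have conv: "convex_on_C K \<Psi>"
    unfolding \<Psi>_def
    by (intro convex_on_C_add convex_on_C_reflect conv\<Phi> convex_on_C_square convex_on_C_supnorm K sn0)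
  have lsc: "pointwise_lsc_on_C K \<Psi>"
    unfolding \<Psi>_def by (intro lsc_add lsc_reflect lsc\<Phi> lsc_square lsc_supnorm K sn0)
  have even: "\<Psi> (\<lambda>x. - f x) = \<Psi> f" for f
    by (simp add: \<Psi>_def)
  have nonneg: "0 \<le> \<Psi> f" if "f \<in> Cspace K" for f
    using nonneg\<Phi>[OF that] nonneg\<Phi>[OF Cspace_minus[OF that]] by (simp add: \<Psi>_def)
  \<comment> \<open>The excess 1 over the minimum \<open>\<Psi> 0\<close> serves twice: by
    \<open>lower\<close> below, the sublevel set lies in the unit ball of the sup-norm, and it still
    contains a small ball around 0.\<close>
  define L where "L = \<Psi> (\<lambda>x. 0) + 1"
  have lower: "\<Psi> (\<lambda>x. 0) + (supnorm K f)\<^sup>2 \<le> \<Psi> f" if "f \<in> Cspace K" for f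
    using convex_on_C_mid[OF conv\<Phi> that Cspace_minus[OF that]] by (simp add: \<Psi>_def)
  obtain c where c: "0 \<le> c" "\<And>f. f \<in> Cspace K \<Longrightarrow> \<Phi> f \<le> c * (1 + (supnorm K f)\<^sup>2)"
    using adm by (auto simp: admissible_def quad_bounded_on_C_def)
  \<comment> \<open>Growth bound on the ball of radius 2, which contains the sum of two vectors of
    the sublevel set: \<open>5 * c\<close> for each of the two values of \<open>\<Phi>\<close> and 4
    for the square of the norm.\<close>
  define M where "M = 10 * c + 4"
  have M: "\<Psi> f \<le> M" if "f \<in> Cspace K" "supnorm K f \<le> 2" for f
  proof -
    have s: "(supnorm K f)\<^sup>2 \<le> 4"
      using power_mono[OF that(2) sn0[OF that(1)], of 2] by simp
    then have "c * (1 + (supnorm K f)\<^sup>2) \<le> c * 5"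
      using c(1) by (intro mult_left_mono) auto
    then show ?thesis
      using s c(2)[OF that(1)] c(2)[OF Cspace_minus[OF that(1)]] by (simp add: \<Psi>_def M_def)
  qed
  have M0: "0 \<le> M" using c(1) by (simp add: M_def)
  define S where "S f = {s. 0 < s \<and> \<Psi> (\<lambda>x. f x / s) \<le> L}" for f
  define N where "N f = Inf (S f)" for f
  have bdd: "bdd_below (S f)" for f
    by (rule bdd_belowI[of _ 0]) (auto simp: S_def)
  have star: "s' \<in> S f" if "f \<in> Cspace K" "s \<in> S f" "s \<le> s'" for f s s'
  proof -
    have s: "0 < s" "\<Psi> (\<lambda>x. f x / s) \<le> L" using that by (auto simp: S_def)
    define t where "t = s / s'"
    have t: "0 \<le> t" "t \<le> 1" using s that by (auto simp: t_def)
    have "\<Psi> (\<lambda>x. f x / s') = \<Psi> (\<lambda>x. (1-t) * 0 + t * (f x / s))"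
      using s by (simp add: t_def)
    also have "\<dots> \<le> (1-t) * \<Psi> (\<lambda>x. 0) + t * \<Psi> (\<lambda>x. f x / s)"
      using t that by (intro convex_on_CD[OF conv] Cspace_intros) auto
    also have "\<dots> \<le> (1-t) * L + t * L"
      using t s by (intro add_mono mult_left_mono) (auto simp: L_def)
    finally show ?thesis using s that by (simp add: S_def algebra_simps)
  qed
  \<comment> \<open>Convexity between 0 and \<open>(b/s) * f\<close> gives
    \<open>\<Psi> (f/s) \<le> \<Psi> 0 + M/b\<close>, and \<open>b = M + 1\<close> keeps this at
    most \<open>L\<close>.\<close>
  define b where "b = M + 1"
  have b: "1 \<le> b" using M0 by (simp add: b_def)
  have inS: "s \<in> S f" if f: "f \<in> Cspace K" and s: "0 < s" "b * supnorm K f \<le> s" for f s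
  proof -
    define t where "t = 1 / b"
    have t: "0 \<le> t" "t \<le> 1" using b by (auto simp: t_def)
    have "supnorm K (\<lambda>x. (b/s) * f x) \<le> 2"
      using s b unfolding supnorm_scale[OF K f] by (simp add: field_simps)
    then have m: "\<Psi> (\<lambda>x. (b/s) * f x) \<le> M"
      by (intro M Cspace_scale f)
    have "\<Psi> (\<lambda>x. f x / s) = \<Psi> (\<lambda>x. (1-t) * 0 + t * ((b/s) * f x))"
      using b by (simp add: t_def)
    also have "\<dots> \<le> (1-t) * \<Psi> (\<lambda>x. 0) + t * \<Psi> (\<lambda>x. (b/s) * f x)"
      using t f by (intro convex_on_CD[OF conv] Cspace_intros) auto
    also have "\<dots> \<le> 1 * \<Psi> (\<lambda>x. 0) + t * M"
      using t m nonneg[OF Cspace_zero] by (intro add_mono mult_right_mono mult_left_mono) auto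
    also have "t * M \<le> 1" using b M0 by (simp add: t_def b_def)
    finally show ?thesis using s by (simp add: S_def L_def)
  qed
  have ne: "S f \<noteq> {}" if "f \<in> Cspace K" for f
    using inS[OF that, of "max 1 (b * supnorm K f)"] by (auto simp: less_max_iff_disj)
  have upper: "N f \<le> s" if "s \<in> S f" for f s
    unfolding N_def by (rule cInf_lower[OF that bdd])
  have above: "s \<in> S f" if "f \<in> Cspace K" "N f < s" for f s
    using that ne[OF that(1)] star[OF that(1)] unfolding N_def
    by (metis cInf_less_iff bdd less_imp_le)
  have Nb: "N f \<le> b * supnorm K f" if "f \<in> Cspace K" for f
  proof (rule field_le_epsilon)
    fix e :: real assume "0 < e"
    then show "N f \<le> b * supnorm K f + e"
      using b sn0[OF that] by (intro upper inS[OF that]) (auto intro: add_nonneg_pos)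
  qed
  have sN: "supnorm K f \<le> N f" if f: "f \<in> Cspace K" for f
    unfolding N_def
  proof (rule cInf_greatest[OF ne[OF f]])
    fix s assume "s \<in> S f"
    then have s: "0 < s" "\<Psi> (\<lambda>x. f x / s) \<le> L" by (auto simp: S_def)
    then have "(supnorm K (\<lambda>x. (1/s) * f x))\<^sup>2 \<le> 1\<^sup>2"
      using lower[OF Cspace_divide[OF f, of s]] by (simp add: L_def)
    then have "supnorm K (\<lambda>x. (1/s) * f x) \<le> 1"
      by (rule power2_le_imp_le) simp
    then show "supnorm K f \<le> s"
      using s unfolding supnorm_scale[OF K f] by (simp add: field_simps)
  qed
  have N_nonneg: "0 \<le> N f" if "f \<in> Cspace K" for f
    using sN[OF that] sn0[OF that] by linarith
  have zero: "N (\<lambda>x. 0) = 0"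
    using Nb[OF Cspace_zero] N_nonneg[OF Cspace_zero] by simp
  have scale_le: "N (\<lambda>x. a * f x) \<le> \<bar>a\<bar> * N f" if f: "f \<in> Cspace K" for f a
  proof (cases "a = 0")
    case False
    have "N (\<lambda>x. a * f x) / \<bar>a\<bar> \<le> N f"
    proof (rule dense_ge)
      fix s assume "N f < s"
      then have s: "s \<in> S f" by (rule above[OF f])
      have "(\<lambda>x. a * f x / (\<bar>a\<bar> * s)) = (if 0 < a then (\<lambda>x. f x / s) else (\<lambda>x. - (f x / s)))"
        using False by (auto simp: fun_eq_iff abs_if)
      then have "\<bar>a\<bar> * s \<in> S (\<lambda>x. a * f x)"
        using s False even[of "\<lambda>x. f x / s"] by (simp add: S_def)
      then show "N (\<lambda>x. a * f x) / \<bar>a\<bar> \<le> s"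
        using upper False by (simp add: field_simps)
    qed
    then show ?thesis using False by (simp add: field_simps)
  qed (simp add: zero)
  have scale: "N (\<lambda>x. a * f x) = \<bar>a\<bar> * N f" if f: "f \<in> Cspace K" for f a
  proof (cases "a = 0")
    case False
    have "N f \<le> \<bar>1/a\<bar> * N (\<lambda>x. a * f x)"
      using scale_le[OF Cspace_scale[OF f, of a], of "1/a"] False by simp
    then show ?thesis
      using scale_le[OF f, of a] False by (simp add: field_simps)
  qed (simp add: zero)
  have triangle: "N (\<lambda>x. f x + g x) \<le> N f + N g" if f: "f \<in> Cspace K" and g: "g \<in> Cspace K" for f g
  proof (rule field_le_epsilon)
    fix e :: real assume e: "0 < e"
    define s t where "s = N f + e/2" and "t = N g + e/2"
    have st: "s \<in> S f" "t \<in> S g" using e by (auto simp: s_def t_def intro!: above f g)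
    then have pos: "0 < s" "0 < t" by (auto simp: S_def)
    define u where "u = t / (s + t)"
    have u: "0 \<le> u" "u \<le> 1" "1 - u = s / (s + t)" using pos by (auto simp: u_def field_simps)
    have "(\<lambda>x. (f x + g x) / (s + t)) = (\<lambda>x. (1-u) * (f x / s) + u * (g x / t))"
      unfolding u(3) using pos by (simp add: u_def add_divide_distrib)
    then have "\<Psi> (\<lambda>x. (f x + g x) / (s + t)) \<le> (1-u) * \<Psi> (\<lambda>x. f x / s) + u * \<Psi> (\<lambda>x. g x / t)"
      using convex_on_CD[OF conv Cspace_divide[OF f] Cspace_divide[OF g] u(1,2)] by simp
    also have "\<dots> \<le> (1-u) * L + u * L"
      using st u by (intro add_mono mult_left_mono) (auto simp: S_def)
    finally have "s + t \<in> S (\<lambda>x. f x + g x)" using pos by (simp add: S_def algebra_simps)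
    then show "N (\<lambda>x. f x + g x) \<le> N f + N g + e"
      using upper by (force simp: s_def t_def)
  qed
  have "is_norm_on_C K N"
    unfolding is_norm_on_C_def
  proof (intro conjI ballI allI)
    fix f assume f: "f \<in> Cspace K"
    show "N f = 0 \<longleftrightarrow> f = (\<lambda>x. 0)"
    proof
      assume "N f = 0"
      then have "\<bar>f x\<bar> \<le> 0" for x using sN[OF f] supnorm_upper[OF K f, of x] by linarith
      then show "f = (\<lambda>x. 0)" by auto
    qed (simp add: zero)
  qed (auto simp: scale N_nonneg intro: triangle)
  moreover have "\<exists>a b. 0 < a \<and> 0 < b \<and> (\<forall>f\<in>Cspace K. a * supnorm K f \<le> N f \<and> N f \<le> b * supnorm K f)"
    using sN Nb b by (intro exI[of _ 1] exI[of _ b]) auto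
  moreover have "pointwise_lsc_on_C K N"
  proof (rule lscI)
    fix f a assume f: "f \<in> Cspace K" and a: "a < N f"
    show "\<exists>F d. finite F \<and> F \<subseteq> topspace K \<and> 0 < d \<and>
        (\<forall>g\<in>Cspace K. (\<forall>x\<in>F. \<bar>g x - f x\<bar> < d) \<longrightarrow> a < N g)"
    proof (cases "a < 0")
      case True
      then show ?thesis
        using N_nonneg by (intro exI[of _ "{}"] exI[of _ 1]) (auto intro: less_le_trans)
    next
      case False
      obtain s where s: "a < s" "s < N f" using a dense by blast
      with False have "0 < s" by simp
      moreover have "s \<notin> S f" using s upper by force
      ultimately have *: "L < \<Psi> (\<lambda>x. f x / s)" by (simp add: S_def)
      obtain F d where
        F: "finite F" "F \<subseteq> topspace K" "0 < d"
        "\<forall>g\<in>Cspace K. (\<forall>x\<in>F. \<bar>g x - f x / s\<bar> < d) \<longrightarrow> L < \<Psi> g"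
        by (rule lscD[OF lsc Cspace_divide[OF f], OF *])
      have "a < N g" if g: "g \<in> Cspace K" and near: "\<forall>x\<in>F. \<bar>g x - f x\<bar> < d * s" for g
      proof -
        have "\<bar>g x / s - f x / s\<bar> < d" if "x \<in> F" for x
        proof -
          have "g x / s - f x / s = (g x - f x) / s" by (simp add: diff_divide_distrib)
          then show ?thesis using near that \<open>0 < s\<close> by (simp add: field_simps)
        qed
        then have "L < \<Psi> (\<lambda>x. g x / s)" by (intro F(4)[rule_format] Cspace_divide g)
        then have "s \<notin> S g" by (simp add: S_def)
        then have "s \<le> N g" using above[OF g] by force
        then show ?thesis using s by simp
      qed
      then show ?thesis
        using F \<open>0 < s\<close> by (intro exI[of _ F] exI[of _ "d * s"]) auto
    qed
  qed
  moreover have "LUR_on_C K N"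
    unfolding LUR_on_C_def
  proof (intro ballI allI impI, elim conjE)
    fix f and fs :: "nat \<Rightarrow> 'a \<Rightarrow> real"
    assume f: "f \<in> Cspace K" and Nf: "N f = 1" and fs: "\<forall>n. fs n \<in> Cspace K \<and> N (fs n) = 1"
      and lim: "(\<lambda>n. N (\<lambda>x. (f x + fs n x) / 2)) \<longlonglongrightarrow> 1"
    \<comment> \<open>The gauge controls \<open>\<Psi>\<close> only at \<open>h / (1 + d)\<close>;
      these functions converge uniformly to \<open>h\<close>, so lower semicontinuity carries the
      bound \<open>L\<close> to the unit sphere itself.\<close>
    have ball: "supnorm K h \<le> 1 \<and> \<Psi> h \<le> L" if h: "h \<in> Cspace K" and Nh: "N h = 1" for h
    proof
      show 1: "supnorm K h \<le> 1" using sN[OF h] Nh by simp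
      show "\<Psi> h \<le> L"
      proof (rule ccontr)
        assume "\<not> \<Psi> h \<le> L"
        then have *: "L < \<Psi> h" by simp
        obtain F d where "finite F" "F \<subseteq> topspace K" and F: "0 < d"
          "\<forall>g\<in>Cspace K. (\<forall>x\<in>F. \<bar>g x - h x\<bar> < d) \<longrightarrow> L < \<Psi> g"
          by (rule lscD[OF lsc h, OF *])
        have "\<bar>h x / (1 + d) - h x\<bar> < d" for x
        proof -
          have "h x / (1 + d) - h x = - (h x * d / (1 + d))" using F(1) by (simp add: field_simps)
          then have "\<bar>h x / (1 + d) - h x\<bar> = \<bar>h x\<bar> * (d / (1 + d))"
            using F(1) by (simp add: abs_mult)
          also have "\<dots> \<le> 1 * (d / (1 + d))"
            using supnorm_upper[OF K h, of x] 1 F(1) by (intro mult_right_mono) auto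
          also have "\<dots> < d" using F(1) by (simp add: field_simps)
          finally show ?thesis .
        qed
        then have "L < \<Psi> (\<lambda>x. h x / (1 + d))" by (intro F(2)[rule_format] Cspace_divide h)
        moreover have "1 + d \<in> S h" using F(1) Nh by (intro above h) simp
        ultimately show False by (simp add: S_def)
      qed
    qed
    \<comment> \<open>A midpoint of gauge close to 1 has \<open>\<Psi> m\<close> not much below
      \<open>L\<close>: the slightly enlarged \<open>m / s = (1 + \<kappa>) m\<close> lies outside
      the sublevel set and is a convex combination of \<open>m\<close> and
      \<open>2m = f + fs n\<close>, so \<open>L < \<Psi> m + \<kappa> * M\<close>.\<close>
    have key: "\<exists>n0. \<forall>n\<ge>n0. mid_defect \<Psi> f (fs n) < d" if d: "0 < d" for d
    proof -
      define \<kappa> where "\<kappa> = min 1 (d / (4 * (M + 1)))"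
      have \<kappa>: "0 < \<kappa>" "\<kappa> \<le> 1" "2 * \<kappa> * M < d"
      proof -
        show "0 < \<kappa>" "\<kappa> \<le> 1" using d M0 by (auto simp: \<kappa>_def)
        have "\<kappa> \<le> d / (4 * (M + 1))" by (simp add: \<kappa>_def)
        then have "\<kappa> * (4 * (M + 1)) \<le> d" using M0 by (simp add: pos_le_divide_eq)
        moreover have "0 \<le> \<kappa> * M" using \<open>0 < \<kappa>\<close> M0 by simp
        ultimately show "2 * \<kappa> * M < d" using \<open>0 < \<kappa>\<close> d by (simp add: algebra_simps)
      qed
      define s where "s = 1 / (1 + \<kappa>)"
      have s: "0 < s" "s < 1" "1 / s = 1 + \<kappa>" using \<kappa> by (auto simp: s_def)
      obtain n0 where n0: "\<And>n. n \<ge> n0 \<Longrightarrow> s < N (\<lambda>x. (f x + fs n x) / 2)"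
        using order_tendstoD(1)[OF lim s(2)] by (auto simp: eventually_sequentially)
      have "mid_defect \<Psi> f (fs n) < d" if n: "n \<ge> n0" for n
      proof -
        define m where "m = (\<lambda>x. (f x + fs n x) / 2)"
        have m: "m \<in> Cspace K" using f fs by (auto simp: m_def intro: Cspace_mid)
        have fn: "supnorm K f \<le> 1" "supnorm K (fs n) \<le> 1" "\<Psi> f \<le> L" "\<Psi> (fs n) \<le> L"
          using ball f fs Nf by auto
        have "(\<lambda>x. 2 * m x) = (\<lambda>x. f x + fs n x)" by (simp add: m_def fun_eq_iff field_simps)
        then have "supnorm K (\<lambda>x. 2 * m x) \<le> 2"
          using supnorm_add[OF K f, of "fs n"] fs fn by simp
        then have M2: "\<Psi> (\<lambda>x. 2 * m x) \<le> M" by (intro M Cspace_scale m)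
        have "s \<notin> S m" using n0[OF n] upper by (force simp: m_def)
        then have "L < \<Psi> (\<lambda>x. m x / s)" using s by (simp add: S_def)
        also have "(\<lambda>x. m x / s) = (\<lambda>x. (1-\<kappa>) * m x + \<kappa> * (2 * m x))"
        proof
          fix x
          have "m x / s = m x * (1 / s)" by simp
          also have "\<dots> = (1-\<kappa>) * m x + \<kappa> * (2 * m x)" unfolding s(3) by (simp add: algebra_simps)
          finally show "m x / s = (1-\<kappa>) * m x + \<kappa> * (2 * m x)" .
        qed
        also have "\<Psi> \<dots> \<le> (1-\<kappa>) * \<Psi> m + \<kappa> * \<Psi> (\<lambda>x. 2 * m x)"
          using \<kappa> by (intro convex_on_CD[OF conv] Cspace_intros m) auto
        also have "\<dots> \<le> 1 * \<Psi> m + \<kappa> * M"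
          using \<kappa> M2 nonneg[OF m] by (intro add_mono mult_left_mono mult_right_mono) auto
        finally show ?thesis
          using fn \<kappa>(3) by (simp add: mid_defect_def m_def)
      qed
      then show ?thesis by blast
    qed
    have defect_le: "mid_defect \<Phi> f g \<le> mid_defect \<Psi> f g" if g: "g \<in> Cspace K" for g
    proof -
      have "0 \<le> mid_defect (\<lambda>f. \<Phi> (\<lambda>x. - f x)) f g" "0 \<le> mid_defect (\<lambda>f. (supnorm K f)\<^sup>2) f g"
        by (intro mid_defect_nonneg[OF _ f g] convex_on_C_reflect conv\<Phi> convex_on_C_square
          convex_on_C_supnorm K sn0; assumption)+
      then show ?thesis by (simp add: mid_defect_def \<Psi>_def)
    qed
    show "(\<lambda>n. N (\<lambda>x. f x - fs n x)) \<longlonglongrightarrow> 0"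
      unfolding LIMSEQ_iff
    proof (intro allI impI)
      fix r :: real assume r: "0 < r"
      define e where "e = r / (2 * b)"
      have e: "0 < e" "b * e < r" using r b by (auto simp: e_def)
      obtain d where d: "0 < d" "\<And>g. g \<in> Cspace K \<Longrightarrow> supnorm K g \<le> 1 \<Longrightarrow> mid_defect \<Phi> f g < d \<Longrightarrow>
          supnorm K (\<lambda>x. f x - g x) \<le> e"
        using rotund[OF f _ e(1)] ball[OF f Nf] by auto
      obtain n0 where n0: "\<forall>n\<ge>n0. mid_defect \<Psi> f (fs n) < d" using key[OF d(1)] by auto
      have "norm (N (\<lambda>x. f x - fs n x) - 0) < r" if "n \<ge> n0" for n
      proof -
        have fsn: "fs n \<in> Cspace K" "N (fs n) = 1" using fs by auto
        have "supnorm K (\<lambda>x. f x - fs n x) \<le> e"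
          using n0 that defect_le[OF fsn(1)] ball[OF fsn]
          by (intro d(2)[OF fsn(1)]) (auto intro: le_less_trans)
        then have "b * supnorm K (\<lambda>x. f x - fs n x) \<le> b * e" using b by simp
        then show ?thesis
          using Nb[OF Cspace_diff[OF f fsn(1)]] N_nonneg[OF Cspace_diff[OF f fsn(1)]] e(2) by simp
      qed
      then show "\<exists>n0. \<forall>n\<ge>n0. norm (N (\<lambda>x. f x - fs n x) - 0) < r" by blast
    qed
  qed
  ultimately show ?thesis
    unfolding has_LUR_lsc_norm_def equivalent_norm_on_C_def by blast
qed

section \<open>Locally uniformly rotund norms and their extension to bounded functions\<close>

lemma
  assumes "is_norm_on_C K N"
  shows is_norm_on_C_nonneg: "\<And>f. f \<in> Cspace K \<Longrightarrow> 0 \<le> N f"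
    and is_norm_on_C_eq_0: "\<And>f. f \<in> Cspace K \<Longrightarrow> N f = 0 \<longleftrightarrow> f = (\<lambda>x. 0)"
    and is_norm_on_C_scale: "\<And>f c. f \<in> Cspace K \<Longrightarrow> N (\<lambda>x. c * f x) = \<bar>c\<bar> * N f"
    and is_norm_on_C_add: "\<And>f g. f \<in> Cspace K \<Longrightarrow> g \<in> Cspace K \<Longrightarrow> N (\<lambda>x. f x + g x) \<le> N f + N g"
  using assms by (auto simp: is_norm_on_C_def)

lemma is_norm_on_C_minus_commute:
  assumes "is_norm_on_C K N" "f \<in> Cspace K" "g \<in> Cspace K"
  shows "N (\<lambda>x. f x - g x) = N (\<lambda>x. g x - f x)"
  using is_norm_on_C_scale[OF assms(1) Cspace_diff[OF assms(3,2)], of "-1"] by simp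

lemma convex_on_C_norm:
  assumes "is_norm_on_C K N"
  shows "convex_on_C K N"
  unfolding convex_on_C_def
proof (intro ballI allI impI)
  fix f g and t :: real assume *: "f \<in> Cspace K" "g \<in> Cspace K" "0 \<le> t \<and> t \<le> 1"
  show "N (\<lambda>x. (1-t) * f x + t * g x) \<le> (1-t) * N f + t * N g"
    using is_norm_on_C_add[OF assms Cspace_scale[OF *(1)] Cspace_scale[OF *(2)], of "1-t" t] *
    by (simp add: is_norm_on_C_scale[OF assms])
qed

text \<open>Squaring removes the normalisation from \<open>LUR_on_C\<close>. Along a sequence with
  vanishing defect, \<open>mid_defect_square\<close> makes the norms converge to \<open>N f\<close>,
  the norms of the midpoints follow, and rescaling to the unit sphere costs only a null
  sequence.\<close>

lemma LUR_on_C_defect: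
  assumes N: "is_norm_on_C K N" and LUR: "LUR_on_C K N" and f: "f \<in> Cspace K" and e: "0 < e"
  obtains d where "0 < d" "\<And>g. g \<in> Cspace K \<Longrightarrow> mid_defect (\<lambda>f. (N f)\<^sup>2) f g < d \<Longrightarrow> N (\<lambda>x. f x - g x) < e"
proof (rule ccontr)
  note N0 = is_norm_on_C_nonneg[OF N] and Ns = is_norm_on_C_scale[OF N] and Na = is_norm_on_C_add[OF N]
  assume neg: "\<not> thesis"
  have "\<exists>g. g \<in> Cspace K \<and> mid_defect (\<lambda>f. (N f)\<^sup>2) f g < inverse (real (Suc n)) \<and> e \<le> N (\<lambda>x. f x - g x)" for n
    using neg that[of "inverse (real (Suc n))"] by (meson inverse_positive_iff_positive not_le of_nat_0_less_iff zero_less_Suc)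
  then obtain gs where gs: "\<And>n. gs n \<in> Cspace K" and
    small: "\<And>n. mid_defect (\<lambda>f. (N f)\<^sup>2) f (gs n) < inverse (real (Suc n))" and
    far: "\<And>n. e \<le> N (\<lambda>x. f x - gs n x)"
    by metis
  have D0: "0 \<le> mid_defect (\<lambda>f. (N f)\<^sup>2) f (gs n)" for n
    by (intro mid_defect_nonneg[OF convex_on_C_square[OF convex_on_C_norm[OF N] N0] f gs])
  have D: "(\<lambda>n. mid_defect (\<lambda>f. (N f)\<^sup>2) f (gs n)) \<longlonglongrightarrow> 0"
    by (rule tendsto_sandwich[OF _ _ tendsto_const LIMSEQ_inverse_real_of_nat])
       (auto intro!: always_eventually D0 less_imp_le[OF small] simp del: of_nat_Suc)
  define c where "c = N f"
  define a where "a n = N (gs n)" for n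
  define m where "m n = N (\<lambda>x. (f x + gs n x) / 2)" for n
  have sq: "(\<lambda>n. (c - a n)\<^sup>2) \<longlonglongrightarrow> 0"
  proof (rule tendsto_sandwich[OF _ _ tendsto_const])
    show "(\<lambda>n. 2 * mid_defect (\<lambda>f. (N f)\<^sup>2) f (gs n)) \<longlonglongrightarrow> 0"
      using tendsto_mult_left[OF D, of 2] by simp
    show "\<forall>\<^sub>F n in sequentially. (c - a n)\<^sup>2 \<le> 2 * mid_defect (\<lambda>f. (N f)\<^sup>2) f (gs n)"
      unfolding c_def a_def
      by (intro always_eventually allI mid_defect_square[OF convex_on_C_norm[OF N] N0 f gs])
  qed auto
  have "(\<lambda>n. sqrt ((c - a n)\<^sup>2)) \<longlonglongrightarrow> sqrt 0" by (intro tendsto_intros sq)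
  then have ca: "(\<lambda>n. c - a n) \<longlonglongrightarrow> 0" by (simp add: tendsto_rabs_zero_iff)
  from tendsto_diff[OF tendsto_const ca, of c] have a: "a \<longlonglongrightarrow> c" by simp
  have "(\<lambda>n. (c\<^sup>2 + (a n)\<^sup>2 - mid_defect (\<lambda>f. (N f)\<^sup>2) f (gs n)) / 2) \<longlonglongrightarrow> (c\<^sup>2 + c\<^sup>2 - 0) / 2"
    by (intro tendsto_intros a D) simp
  moreover have "(c\<^sup>2 + (a n)\<^sup>2 - mid_defect (\<lambda>f. (N f)\<^sup>2) f (gs n)) / 2 = (m n)\<^sup>2" for n
    by (simp add: mid_defect_def c_def a_def m_def)
  ultimately have "(\<lambda>n. (m n)\<^sup>2) \<longlonglongrightarrow> c\<^sup>2" by simp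
  then have "(\<lambda>n. sqrt ((m n)\<^sup>2)) \<longlonglongrightarrow> sqrt (c\<^sup>2)" by (rule tendsto_real_sqrt)
  moreover have "0 \<le> c" "0 \<le> m n" for n
    unfolding m_def c_def by (intro N0 f Cspace_mid gs)+
  then have "sqrt (c\<^sup>2) = c" "(\<lambda>n. sqrt ((m n)\<^sup>2)) = m" by auto
  ultimately have m: "m \<longlonglongrightarrow> c" by metis
  have "(\<lambda>n. N (\<lambda>x. f x - gs n x)) \<longlonglongrightarrow> 0"
  proof (cases "c = 0")
    case True
    then have "f = (\<lambda>x. 0)" using is_norm_on_C_eq_0[OF N f] by (simp add: c_def)
    then have "N (\<lambda>x. f x - gs n x) = a n" for n
      using Ns[OF gs, of "-1" n] by (simp add: a_def)
    then show ?thesis using a True by simp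
  next
    case False
    then have c: "0 < c" using N0[OF f] by (simp add: c_def)
    define f' where "f' = (\<lambda>x. (1/c) * f x)"
    \<comment> \<open>\<open>LUR_on_C\<close> asks for unit vectors at every index;
      \<open>f'\<close> fills the finitely many places where \<open>gs n\<close> may be
      zero.\<close>
    define fs where "fs n = (if a n = 0 then f' else (\<lambda>x. (1 / a n) * gs n x))" for n
    have f': "f' \<in> Cspace K" "N f' = 1"
      unfolding f'_def using c by (auto simp only: Ns[OF f] c_def[symmetric] intro!: Cspace_scale f) simp
    have fs: "fs n \<in> Cspace K" "N (fs n) = 1" for n
    proof -
      show "fs n \<in> Cspace K" using f' gs[of n] Cspace_scale[of "gs n" K "1 / a n"] by (simp add: fs_def)
      show "N (fs n) = 1"
        using f' Ns[OF gs, of "1 / a n" n] N0[OF gs, of n] by (auto simp: fs_def a_def)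
    qed
    have ne: "\<forall>\<^sub>F n in sequentially. 0 < a n" using order_tendstoD(1)[OF a c] .
    have cmp: "N (\<lambda>x. k * gs n x - fs n x) = \<bar>k * a n - 1\<bar>" if "0 < a n" for k n
    proof -
      have "(\<lambda>x. k * gs n x - fs n x) = (\<lambda>x. (k - 1 / a n) * gs n x)"
        using that by (simp add: fs_def fun_eq_iff algebra_simps)
      then have "N (\<lambda>x. k * gs n x - fs n x) = \<bar>k - 1 / a n\<bar> * a n" by (simp add: Ns gs a_def)
      also have "\<dots> = \<bar>(k - 1 / a n) * a n\<bar>" using that by (simp add: abs_mult)
      also have "(k - 1 / a n) * a n = k * a n - 1" using that by (simp add: algebra_simps)
      finally show ?thesis .
    qed
    have "(\<lambda>n. N (\<lambda>x. (f' x + fs n x) / 2)) \<longlonglongrightarrow> 1"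
    proof (rule tendsto_sandwich)
      show "\<forall>\<^sub>F n in sequentially. m n / c - \<bar>(1/c) * a n - 1\<bar> / 2 \<le> N (\<lambda>x. (f' x + fs n x) / 2)"
      proof (rule eventually_mono[OF ne])
        fix n assume n: "0 < a n"
        define u where "u = (\<lambda>x. (f' x + fs n x) / 2)"
        \<comment> \<open>The error of replacing \<open>gs n / c\<close> by \<open>fs n\<close> in
          the midpoint; its norm is half of the rescaling error computed in
          \<open>cmp\<close>.\<close>
        define v where "v = (\<lambda>x. (1/2) * ((1/c) * gs n x - fs n x))"
        have uv: "u \<in> Cspace K" "v \<in> Cspace K"
          unfolding u_def v_def by (intro Cspace_mid Cspace_scale Cspace_diff f' fs gs)+
        have "(\<lambda>x. (1/c) * ((f x + gs n x) / 2)) = (\<lambda>x. u x + v x)"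
          using c by (simp add: fun_eq_iff u_def v_def f'_def field_simps)
        then have "m n / c = N (\<lambda>x. u x + v x)"
          using Ns[OF Cspace_mid[OF f gs], of "1/c" n] c by (simp add: m_def)
        also have "\<dots> \<le> N u + N v" by (rule Na[OF uv])
        also have "N v = \<bar>(1/c) * a n - 1\<bar> / 2"
          using Ns[OF Cspace_diff[OF Cspace_scale[OF gs] fs(1)], of "1/2" "1/c" n n] cmp[OF n, of "1/c"]
          by (simp add: v_def)
        finally show "m n / c - \<bar>(1/c) * a n - 1\<bar> / 2 \<le> N (\<lambda>x. (f' x + fs n x) / 2)"
          by (simp add: u_def)
      qed
      show "\<forall>\<^sub>F n in sequentially. N (\<lambda>x. (f' x + fs n x) / 2) \<le> 1"
        using convex_on_C_mid[OF convex_on_C_norm[OF N] f'(1) fs(1)] f' fs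
        by (intro always_eventually allI) simp
      have "(\<lambda>n. m n / c - \<bar>(1/c) * a n - 1\<bar> / 2) \<longlonglongrightarrow> c / c - \<bar>(1/c) * c - 1\<bar> / 2"
        using c by (intro tendsto_intros m a) auto
      then show "(\<lambda>n. m n / c - \<bar>(1/c) * a n - 1\<bar> / 2) \<longlonglongrightarrow> 1" using c by simp
    qed simp
    then have L: "(\<lambda>n. N (\<lambda>x. f' x - fs n x)) \<longlonglongrightarrow> 0"
      using LUR[unfolded LUR_on_C_def, rule_format, OF f'(1), of fs] f' fs by simp
    show ?thesis
    proof (rule tendsto_sandwich[OF _ _ tendsto_const])
      show "\<forall>\<^sub>F n in sequentially. 0 \<le> N (\<lambda>x. f x - gs n x)"
        by (intro always_eventually allI N0 Cspace_diff f gs)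
      show "\<forall>\<^sub>F n in sequentially. N (\<lambda>x. f x - gs n x) \<le> c * (N (\<lambda>x. f' x - fs n x) + \<bar>(1/c) * a n - 1\<bar>)"
      proof (rule eventually_mono[OF ne])
        fix n assume n: "0 < a n"
        define u where "u = (\<lambda>x. f' x - fs n x)"
        define v where "v = (\<lambda>x. fs n x - (1/c) * gs n x)"
        have uv: "u \<in> Cspace K" "v \<in> Cspace K"
          unfolding u_def v_def by (intro Cspace_scale Cspace_diff f' fs gs)+
        have "N v = \<bar>(1/c) * a n - 1\<bar>"
          unfolding v_def cmp[OF n, symmetric]
          by (rule is_norm_on_C_minus_commute[OF N fs(1) Cspace_scale[OF gs]])
        moreover have "(\<lambda>x. f x - gs n x) = (\<lambda>x. c * (u x + v x))"
          using c by (simp add: fun_eq_iff u_def v_def f'_def field_simps)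
        then have "N (\<lambda>x. f x - gs n x) = c * N (\<lambda>x. u x + v x)"
          using Ns[OF Cspace_add[OF uv], of c] c by simp
        ultimately show "N (\<lambda>x. f x - gs n x) \<le> c * (N (\<lambda>x. f' x - fs n x) + \<bar>(1/c) * a n - 1\<bar>)"
          using Na[OF uv] c by (simp add: u_def)
      qed
      have "(\<lambda>n. c * (N (\<lambda>x. f' x - fs n x) + \<bar>(1/c) * a n - 1\<bar>)) \<longlonglongrightarrow> c * (0 + \<bar>(1/c) * c - 1\<bar>)"
        by (intro tendsto_intros L a)
      then show "(\<lambda>n. c * (N (\<lambda>x. f' x - fs n x) + \<bar>(1/c) * a n - 1\<bar>)) \<longlonglongrightarrow> 0" using c by simp
    qed
  qed
  from order_tendstoD(2)[OF this e] far show False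
    by (auto simp: eventually_sequentially not_le[symmetric])
qed

text \<open>In a Hausdorff space a finite set is closed and discrete, so any values on it are
  continuous and Tietze's theorem extends them with the same bound.\<close>

lemma finite_interpolation:
  assumes K: "compact_space K" "Hausdorff_space K" and F: "finite F" "F \<subseteq> topspace K"
    and c: "0 \<le> c" "\<And>y. y \<in> F \<Longrightarrow> \<bar>h y\<bar> \<le> c"
  obtains g where "g \<in> Cspace K" "\<And>y. y \<in> F \<Longrightarrow> g y = h y" "\<And>y. \<bar>g y\<bar> \<le> c"
proof -
  have "subtopology K F = discrete_topology F"
    using F K Hausdorff_space_subtopology
    by (intro finite_topspace_imp_discrete_topology) auto
  then have cont: "continuous_map (subtopology K F) euclideanreal h"
    by simp
  have "closedin K F"
    using F K by (meson Hausdorff_imp_t1_space t1_space_closedin_finite)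
  moreover have "normal_space K"
    using K compact_Hausdorff_or_regular_imp_normal_space by blast
  moreover have "is_interval {-c..c}" "{-c..c} \<noteq> {}" "h ` F \<subseteq> {-c..c}"
    using c by (auto simp: is_interval_cc abs_le_iff minus_le_iff)
  ultimately obtain g where g: "continuous_map K euclideanreal g" "g ` topspace K \<subseteq> {-c..c}"
    "\<And>x. x \<in> F \<Longrightarrow> g x = h x"
    using Tietze_extension_realinterval[of K F "{-c..c}" h] cont by blast
  define g' where "g' x = (if x \<in> topspace K then g x else 0)" for x
  have "continuous_map K euclideanreal g'"
    using g(1) by (rule continuous_map_eq) (simp add: g'_def)
  then show thesis
    using g F c by (intro that[of g']) (auto simp: Cspace_def g'_def abs_le_iff)
qed

section \<open>Extension of a norm by finite interpolation\<close>

locale C_norm =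
  fixes K :: "'a topology" and N :: "('a \<Rightarrow> real) \<Rightarrow> real" and b :: real
  assumes K: "compact_space K" "Hausdorff_space K" and norm: "is_norm_on_C K N"
    and b: "0 < b" "\<And>f. f \<in> Cspace K \<Longrightarrow> N f \<le> b * supnorm K f"
begin

lemmas N_nonneg = is_norm_on_C_nonneg[OF norm]
lemmas N_add = is_norm_on_C_add[OF norm]

text \<open>For finite \<open>F\<close> this is the quotient norm that \<open>N\<close> induces on
  the values on \<open>F\<close>. Only those values of \<open>h\<close> enter, so \<open>h\<close>
  may be discontinuous, and the result is Lipschitz in them.\<close>

definition ext_fin :: "'a set \<Rightarrow> ('a \<Rightarrow> real) \<Rightarrow> real" where
  "ext_fin F h = Inf (N ` {g\<in>Cspace K. \<forall>y\<in>F. g y = h y})"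

definition ext_norm :: "('a \<Rightarrow> real) \<Rightarrow> real" where
  "ext_norm h = (SUP F\<in>{F. finite F \<and> F \<subseteq> topspace K}. ext_fin F h)"

abbreviation bounded_fun :: "('a \<Rightarrow> real) \<Rightarrow> bool" where
  "bounded_fun h \<equiv> \<exists>c. \<forall>y\<in>topspace K. \<bar>h y\<bar> \<le> c"

context
  fixes F assumes F: "finite F" "F \<subseteq> topspace K"
begin

lemma interpolant_exists: "\<exists>g\<in>Cspace K. \<forall>y\<in>F. g y = h y"
proof -
  have "\<bar>h y\<bar> \<le> (\<Sum>y\<in>F. \<bar>h y\<bar>)" if "y \<in> F" for y
    using that F by (intro member_le_sum) auto
  then show ?thesis
    using finite_interpolation[OF K F, of "\<Sum>y\<in>F. \<bar>h y\<bar>" h] by (metis sum_nonneg abs_ge_zero)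
qed

lemma bdd_ext_fin: "bdd_below (N ` {g\<in>Cspace K. \<forall>y\<in>F. g y = h y})"
  by (rule bdd_belowI[of _ 0]) (auto intro: N_nonneg)

lemma ext_fin_le: "g \<in> Cspace K \<Longrightarrow> (\<And>y. y \<in> F \<Longrightarrow> g y = h y) \<Longrightarrow> ext_fin F h \<le> N g"
  unfolding ext_fin_def by (rule cInf_lower[OF _ bdd_ext_fin]) auto

lemma ext_fin_nonneg: "0 \<le> ext_fin F h"
  unfolding ext_fin_def using interpolant_exists[of h] by (intro cInf_greatest) (auto intro: N_nonneg)

lemma ext_fin_approx:
  assumes "ext_fin F h < r"
  obtains g where "g \<in> Cspace K" "\<And>y. y \<in> F \<Longrightarrow> g y = h y" "N g < r"
proof -
  have "N ` {g\<in>Cspace K. \<forall>y\<in>F. g y = h y} \<noteq> {}"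
    using interpolant_exists[of h] by blast
  then obtain r' where "r' \<in> N ` {g\<in>Cspace K. \<forall>y\<in>F. g y = h y}" "r' < r"
    using assms cInf_less_iff[OF _ bdd_ext_fin] unfolding ext_fin_def by blast
  then show thesis by (auto intro: that)
qed

text \<open>The difference \<open>u - v\<close> on \<open>F\<close> is interpolated by a continuous
  function of sup-norm at most \<open>c\<close>, whose \<open>N\<close> is at most
  \<open>b * c\<close>; it corrects a near-optimal interpolant of \<open>v\<close>.\<close>

lemma ext_fin_lipschitz:
  assumes "0 \<le> c" "\<And>y. y \<in> F \<Longrightarrow> \<bar>u y - v y\<bar> \<le> c"
  shows "ext_fin F u \<le> ext_fin F v + b * c"
proof (rule field_le_epsilon)
  fix e :: real assume "0 < e"
  then obtain g where g: "g \<in> Cspace K" "\<And>y. y \<in> F \<Longrightarrow> g y = v y" "N g < ext_fin F v + e"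
    using ext_fin_approx[of v "ext_fin F v + e"] by auto
  obtain w where w: "w \<in> Cspace K" "\<And>y. y \<in> F \<Longrightarrow> w y = u y - v y" "\<And>y. \<bar>w y\<bar> \<le> c"
    using finite_interpolation[OF K F assms(1), of "\<lambda>y. u y - v y"] assms(2) by blast
  have "ext_fin F u \<le> N (\<lambda>x. g x + w x)"
    using g w by (intro ext_fin_le Cspace_add) auto
  also have "\<dots> \<le> N g + N w" by (rule N_add[OF g(1) w(1)])
  also have "N w \<le> b * c"
    using b(2)[OF w(1)] supnorm_least[of c K w] w(3) assms(1) b(1)
    by (meson mult_left_mono less_imp_le order_trans)
  finally show "ext_fin F u \<le> ext_fin F v + b * c + e" using g(3) by simp
qed

lemma ext_fin_bound:
  assumes "0 \<le> c" "\<And>y. y \<in> F \<Longrightarrow> \<bar>h y\<bar> \<le> c"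
  shows "ext_fin F h \<le> b * c"
proof -
  have "ext_fin F (\<lambda>x. 0) \<le> N (\<lambda>x. 0)" by (rule ext_fin_le) auto
  also have "N (\<lambda>x. 0) = 0" using is_norm_on_C_eq_0[OF norm Cspace_zero] by simp
  finally show ?thesis using ext_fin_lipschitz[of c h "\<lambda>x. 0"] assms by auto
qed

lemma ext_fin_convex:
  assumes "0 \<le> t" "t \<le> 1"
  shows "ext_fin F (\<lambda>x. (1-t) * u x + t * v x) \<le> (1-t) * ext_fin F u + t * ext_fin F v"
proof (rule field_le_epsilon)
  fix e :: real assume e: "0 < e"
  obtain g where g: "g \<in> Cspace K" "\<And>y. y \<in> F \<Longrightarrow> g y = u y" "N g < ext_fin F u + e"
    using ext_fin_approx[of u "ext_fin F u + e"] e by auto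
  obtain w where w: "w \<in> Cspace K" "\<And>y. y \<in> F \<Longrightarrow> w y = v y" "N w < ext_fin F v + e"
    using ext_fin_approx[of v "ext_fin F v + e"] e by auto
  have "ext_fin F (\<lambda>x. (1-t) * u x + t * v x) \<le> N (\<lambda>x. (1-t) * g x + t * w x)"
    using g w by (intro ext_fin_le Cspace_comb) auto
  also have "\<dots> \<le> (1-t) * N g + t * N w"
    by (rule convex_on_CD[OF convex_on_C_norm[OF norm] g(1) w(1) assms])
  also have "\<dots> \<le> (1-t) * (ext_fin F u + e) + t * (ext_fin F v + e)"
    using g w assms by (intro add_mono mult_left_mono) auto
  finally show "ext_fin F (\<lambda>x. (1-t) * u x + t * v x) \<le> (1-t) * ext_fin F u + t * ext_fin F v + e"
    by (simp add: algebra_simps)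
qed

end

lemma ext_fin_mono:
  assumes "finite F'" "F' \<subseteq> topspace K" "F \<subseteq> F'"
  shows "ext_fin F h \<le> ext_fin F' h"
proof (rule field_le_epsilon)
  fix e :: real assume "0 < e"
  then obtain g where g: "g \<in> Cspace K" "\<And>y. y \<in> F' \<Longrightarrow> g y = h y" "N g < ext_fin F' h + e"
    using ext_fin_approx[OF assms(1,2), of h "ext_fin F' h + e"] by auto
  then have "ext_fin F h \<le> N g"
    using assms by (intro ext_fin_le) (auto intro: finite_subset)
  with g(3) show "ext_fin F h \<le> ext_fin F' h + e" by simp
qed

lemma bdd_ext_norm:
  assumes "bounded_fun h"
  shows "bdd_above ((\<lambda>F. ext_fin F h) ` {F. finite F \<and> F \<subseteq> topspace K})"
proof -
  obtain c where c: "\<forall>y\<in>topspace K. \<bar>h y\<bar> \<le> c" using assms by blast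
  have "ext_fin F h \<le> b * max 0 c" if "finite F" "F \<subseteq> topspace K" for F
    using that c by (intro ext_fin_bound) (auto simp: le_max_iff_disj)
  then show ?thesis by (intro bdd_aboveI[of _ "b * max 0 c"]) auto
qed

lemma ext_norm_upper: "bounded_fun h \<Longrightarrow> finite F \<Longrightarrow> F \<subseteq> topspace K \<Longrightarrow> ext_fin F h \<le> ext_norm h"
  unfolding ext_norm_def by (rule cSUP_upper[OF _ bdd_ext_norm]) auto

lemma ext_norm_least:
  "(\<And>F. finite F \<Longrightarrow> F \<subseteq> topspace K \<Longrightarrow> ext_fin F h \<le> c) \<Longrightarrow> ext_norm h \<le> c"
  unfolding ext_norm_def by (rule cSUP_least) auto

lemma ext_norm_nonneg: "bounded_fun h \<Longrightarrow> 0 \<le> ext_norm h"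
  using ext_norm_upper[of h "{}"] ext_fin_nonneg[of "{}" h] by auto

lemma ext_norm_bound: "0 \<le> c \<Longrightarrow> (\<And>y. y \<in> topspace K \<Longrightarrow> \<bar>h y\<bar> \<le> c) \<Longrightarrow> ext_norm h \<le> b * c"
  by (intro ext_norm_least ext_fin_bound) auto

lemma ext_norm_approx:
  assumes "bounded_fun h" "r < ext_norm h"
  obtains F where "finite F" "F \<subseteq> topspace K" "r < ext_fin F h"
  using assms less_cSUP_iff[OF _ bdd_ext_norm[OF assms(1)], of r] unfolding ext_norm_def by auto

lemma ext_norm_lipschitz:
  assumes "bounded_fun v" "0 \<le> c" "\<And>y. y \<in> topspace K \<Longrightarrow> \<bar>u y - v y\<bar> \<le> c"
  shows "ext_norm u \<le> ext_norm v + b * c"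
proof (rule ext_norm_least)
  fix F assume F: "finite F" "F \<subseteq> topspace K"
  have "ext_fin F u \<le> ext_fin F v + b * c"
    using F assms by (intro ext_fin_lipschitz) auto
  then show "ext_fin F u \<le> ext_norm v + b * c"
    using ext_norm_upper[OF assms(1) F] by simp
qed

lemma ext_norm_convex:
  assumes "bounded_fun u" "bounded_fun v" "0 \<le> t" "t \<le> 1"
  shows "ext_norm (\<lambda>x. (1-t) * u x + t * v x) \<le> (1-t) * ext_norm u + t * ext_norm v"
proof (rule ext_norm_least)
  fix F assume F: "finite F" "F \<subseteq> topspace K"
  have "ext_fin F (\<lambda>x. (1-t) * u x + t * v x) \<le> (1-t) * ext_fin F u + t * ext_fin F v"
    by (rule ext_fin_convex[OF F assms(3,4)])
  also have "\<dots> \<le> (1-t) * ext_norm u + t * ext_norm v"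
    using ext_norm_upper[OF assms(1) F] ext_norm_upper[OF assms(2) F] assms
    by (intro add_mono mult_left_mono) auto
  finally show "ext_fin F (\<lambda>x. (1-t) * u x + t * v x) \<le> (1-t) * ext_norm u + t * ext_norm v" .
qed

lemma bounded_fun_Cspace: "g \<in> Cspace K \<Longrightarrow> bounded_fun g"
  using supnorm_upper[OF K(1)] by blast

text \<open>Lower semicontinuity supplies, for each \<open>r < N g\<close>, a finite set on which
  agreement with \<open>g\<close> already forces \<open>N\<close> above \<open>r\<close>.\<close>

lemma ext_norm_ge:
  assumes lsc: "pointwise_lsc_on_C K N" and g: "g \<in> Cspace K"
  shows "N g \<le> ext_norm g"
proof (rule dense_le)
  fix r assume r: "r < N g"
  obtain F d where F: "finite F" "F \<subseteq> topspace K" "0 < d"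
    "\<forall>h\<in>Cspace K. (\<forall>x\<in>F. \<bar>h x - g x\<bar> < d) \<longrightarrow> r < N h"
    by (rule lscD[OF lsc g r])
  have "r \<le> ext_fin F g"
  proof (rule ccontr)
    assume "\<not> r \<le> ext_fin F g"
    then obtain h where "h \<in> Cspace K" "\<And>y. y \<in> F \<Longrightarrow> h y = g y" "N h < r"
      using ext_fin_approx[OF F(1,2), of g r] by auto
    then show False using F(3,4) by force
  qed
  then show "r \<le> ext_norm g"
    using ext_norm_upper[OF bounded_fun_Cspace[OF g] F(1,2)] by simp
qed

text \<open>Rotundity at a continuous \<open>g\<close> survives even against discontinuous
  \<open>v\<close>. A finite set that nearly norms the midpoint is enlarged by the point to be
  tested, and \<open>v\<close> is replaced by a near-optimal continuous interpolant \<open>u\<close>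
  on that set: the defect at \<open>u\<close> is still below \<open>d\<close>, and \<open>u\<close>
  equals \<open>v\<close> at the tested point. Since \<open>d\<close> depends only on
  \<open>g\<close> and \<open>e\<close>, the bound is uniform in the point.\<close>

lemma ext_norm_LUR:
  assumes LUR: "LUR_on_C K N" and lsc: "pointwise_lsc_on_C K N" and a: "0 < a"
    and lower: "\<And>f. f \<in> Cspace K \<Longrightarrow> a * supnorm K f \<le> N f"
    and g: "g \<in> Cspace K" and e: "0 < e"
  obtains d where "0 < d" "\<And>v y. bounded_fun v \<Longrightarrow> mid_defect (\<lambda>h. (ext_norm h)\<^sup>2) g v < d \<Longrightarrow>
    y \<in> topspace K \<Longrightarrow> \<bar>g y - v y\<bar> < e"
proof -
  obtain d where d: "0 < d" "\<And>u. u \<in> Cspace K \<Longrightarrow> mid_defect (\<lambda>f. (N f)\<^sup>2) g u < d \<Longrightarrow>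
      N (\<lambda>x. g x - u x) < a * e"
    using LUR_on_C_defect[OF norm LUR g, of "a * e"] a e by auto
  show thesis
  proof (rule that[OF d(1)])
    fix v y0 assume v: "bounded_fun v" and D: "mid_defect (\<lambda>h. (ext_norm h)\<^sup>2) g v < d"
      and y0: "y0 \<in> topspace K"
    define m where "m = (\<lambda>x. (g x + v x) / 2)"
    note bg = bounded_fun_Cspace[OF g]
    have bm: "bounded_fun m"
    proof -
      obtain c c' where "\<forall>y\<in>topspace K. \<bar>g y\<bar> \<le> c" "\<forall>y\<in>topspace K. \<bar>v y\<bar> \<le> c'"
        using bg v by blast
      then have "\<forall>y\<in>topspace K. \<bar>m y\<bar> \<le> (c + c') / 2"
        unfolding m_def by (auto simp: abs_le_iff) (smt (verit))+
      then show ?thesis by blast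
    qed
    define A V M where "A = ext_norm g" and "V = ext_norm v" and "M = ext_norm m"
    have pos: "0 \<le> A" "0 \<le> V" "0 \<le> M"
      unfolding A_def V_def M_def by (intro ext_norm_nonneg bg v bm)+
    \<comment> \<open>One slack \<open>t\<close> absorbs both approximations: that of
      \<open>ext_fin\<close> by an interpolant and that of the supremum at the midpoint by a finite
      set. The truncation at 0 keeps squaring monotone when \<open>M < t\<close>.\<close>
    have "((\<lambda>t. A\<^sup>2 + (V + t)\<^sup>2 - 2 * (max 0 (M - t))\<^sup>2) \<longlongrightarrow> A\<^sup>2 + (V + 0)\<^sup>2 - 2 * (max 0 (M - 0))\<^sup>2) (at_right 0)"
      by (intro tendsto_intros)
    moreover have "A\<^sup>2 + (V + 0)\<^sup>2 - 2 * (max 0 (M - 0))\<^sup>2 < d"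
      using D pos by (simp add: mid_defect_def A_def V_def M_def m_def)
    ultimately have "\<forall>\<^sub>F t in at_right 0. A\<^sup>2 + (V + t)\<^sup>2 - 2 * (max 0 (M - t))\<^sup>2 < d"
      by (rule order_tendstoD(2))
    then have "\<forall>\<^sub>F t in at_right 0. 0 < t \<and> A\<^sup>2 + (V + t)\<^sup>2 - 2 * (max 0 (M - t))\<^sup>2 < d"
      using eventually_at_right_less[of "0::real"] by (rule eventually_conj[rotated])
    then obtain t where t: "0 < t" "A\<^sup>2 + (V + t)\<^sup>2 - 2 * (max 0 (M - t))\<^sup>2 < d"
      using eventually_happens[of _ "at_right (0::real)"] by auto
    obtain F where F: "finite F" "F \<subseteq> topspace K" "M - t < ext_fin F m"
      using ext_norm_approx[OF bm, of "M - t"] t(1) by (auto simp: M_def)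
    define F' where "F' = insert y0 F"
    have F': "finite F'" "F' \<subseteq> topspace K" using F y0 by (auto simp: F'_def)
    have Mt: "M - t < ext_fin F' m"
      using F(3) ext_fin_mono[OF F', of F m] subset_insertI[of F y0] unfolding F'_def by linarith
    obtain u where u: "u \<in> Cspace K" "\<And>y. y \<in> F' \<Longrightarrow> u y = v y" "N u < ext_fin F' v + t"
      using ext_fin_approx[OF F', of v "ext_fin F' v + t"] t(1) by auto
    have "N u \<le> V + t"
      using u(3) ext_norm_upper[OF v F'] by (simp add: V_def)
    then have 1: "(N u)\<^sup>2 \<le> (V + t)\<^sup>2" using N_nonneg[OF u(1)] by (rule power_mono)
    have 2: "(N g)\<^sup>2 \<le> A\<^sup>2"
      unfolding A_def using ext_norm_ge[OF lsc g] N_nonneg[OF g] by (rule power_mono)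
    have "ext_fin F' m \<le> N (\<lambda>x. (g x + u x) / 2)"
      using g u by (intro ext_fin_le F' Cspace_mid) (auto simp: m_def)
    then have "max 0 (M - t) \<le> N (\<lambda>x. (g x + u x) / 2)"
      using Mt N_nonneg[OF Cspace_mid[OF g u(1)]] by simp
    then have 3: "(max 0 (M - t))\<^sup>2 \<le> (N (\<lambda>x. (g x + u x) / 2))\<^sup>2"
      by (rule power_mono) simp
    have "mid_defect (\<lambda>f. (N f)\<^sup>2) g u < d"
      using 1 2 3 t(2) by (simp add: mid_defect_def)
    then have "a * supnorm K (\<lambda>x. g x - u x) < a * e"
      using d(2)[OF u(1)] lower[OF Cspace_diff[OF g u(1)]] by simp
    then have "supnorm K (\<lambda>x. g x - u x) < e" using a by simp
    then show "\<bar>g y0 - v y0\<bar> < e"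
      using supnorm_upper[OF K(1) Cspace_diff[OF g u(1)], of y0] u(2)[of y0] by (simp add: F'_def)
  qed
qed

end

section \<open>Oscillation on the fibres of a fully closed map\<close>

lemma mid_defect_add: "mid_defect (\<lambda>f. \<Phi> f + \<Psi> f) f g = mid_defect \<Phi> f g + mid_defect \<Psi> f g"
  by (simp add: mid_defect_def)

lemma mid_defect_cmult: "mid_defect (\<lambda>f. c * \<Phi> f) f g = c * mid_defect \<Phi> f g"
  by (simp add: mid_defect_def algebra_simps)

lemma mid_defect_sum: "mid_defect (\<lambda>f. \<Sum>i\<in>I. G i f) f g = (\<Sum>i\<in>I. mid_defect (G i) f g)"
  by (simp add: mid_defect_def sum.distrib sum_subtractf sum_distrib_left)

lemma sum_exchange_le:
  fixes w :: "'i \<Rightarrow> real"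
  assumes "finite A" "finite B" "\<And>y. y \<in> A - B \<Longrightarrow> w y \<le> s" "\<And>y. y \<in> B - A \<Longrightarrow> r \<le> w y"
  shows "sum w A \<le> sum w B + real (card (A - B)) * s - real (card (B - A)) * r"
proof -
  have "sum w A = sum w (A \<inter> B) + sum w (A - B)" "sum w B = sum w (A \<inter> B) + sum w (B - A)"
    using sum.Int_Diff[OF assms(1), of w B] sum.Int_Diff[OF assms(2), of w A] by (simp_all add: Int_commute)
  moreover have "sum w (A - B) \<le> real (card (A - B)) * s"
    using assms(3) by (rule sum_bounded_above)
  moreover have "real (card (B - A)) * r \<le> sum w (B - A)"
    using assms(4) by (rule sum_bounded_below)
  ultimately show ?thesis by linarith
qed

lemma finite_pos_lower_bound:
  fixes d :: "'i \<Rightarrow> real"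
  assumes "finite A" "\<And>y. y \<in> A \<Longrightarrow> 0 < d y"
  obtains r where "0 < r" "\<And>y. y \<in> A \<Longrightarrow> r \<le> d y"
\<comment> \<open>The inserted 1 covers the empty set.\<close>
proof (rule that[of "Min (insert 1 (d ` A))"])
  show "0 < Min (insert 1 (d ` A))" using assms by (subst Min_gr_iff) auto
  show "\<And>y. y \<in> A \<Longrightarrow> Min (insert 1 (d ` A)) \<le> d y" using assms by (intro Min_le) auto
qed

locale fully_closed_map =
  fixes X :: "'a topology" and Y :: "'b topology" and p :: "'a \<Rightarrow> 'b"
  assumes X: "compact_space X" "Hausdorff_space X"
    and Y: "compact_space Y" "Hausdorff_space Y"
    and p: "fully_closed X Y p"
begin

definition fibre :: "'b \<Rightarrow> 'a set" where
  "fibre y = {x \<in> topspace X. p x = y}"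

definition osc :: "'b \<Rightarrow> ('a \<Rightarrow> real) \<Rightarrow> real" where
  "osc y f = (SUP z\<in>fibre y \<times> fibre y. f (fst z) - f (snd z))"

lemma p_continuous: "continuous_map X Y p" and p_surj: "p ` topspace X = topspace Y"
  and p_fully_closed: "\<And>F1 F2. closedin X F1 \<Longrightarrow> closedin X F2 \<Longrightarrow> F1 \<inter> F2 = {} \<Longrightarrow> finite (p ` F1 \<inter> p ` F2)"
  using p by (auto simp: fully_closed_def)

lemma fibre_subset: "fibre y \<subseteq> topspace X"
  by (auto simp: fibre_def)

lemma fibre_ne: "y \<in> topspace Y \<Longrightarrow> fibre y \<noteq> {}"
  unfolding fibre_def p_surj[symmetric] by auto

lemma p_in: "x \<in> topspace X \<Longrightarrow> p x \<in> topspace Y"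
  using p_surj by auto

lemma closedin_fibre: "y \<in> topspace Y \<Longrightarrow> closedin X (fibre y)"
  unfolding fibre_def using closedin_continuous_map_preimage[OF p_continuous, of "{y}"]
    Hausdorff_imp_t1_space[OF Y(2)] by (simp add: closedin_t1_singleton)

lemma bdd_osc:
  assumes "f \<in> Cspace X"
  shows "bdd_above ((\<lambda>z. f (fst z) - f (snd z)) ` (fibre y \<times> fibre y))"
proof (rule bdd_aboveI2[of _ _ "2 * supnorm X f"])
  fix z
  show "f (fst z) - f (snd z) \<le> 2 * supnorm X f"
    using supnorm_upper[OF X(1) assms, of "fst z"] supnorm_upper[OF X(1) assms, of "snd z"] by linarith
qed

lemma osc_upper:
  assumes "f \<in> Cspace X" "x \<in> fibre y" "x' \<in> fibre y"
  shows "\<bar>f x - f x'\<bar> \<le> osc y f"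
proof -
  have "f x - f x' \<le> osc y f" if "x \<in> fibre y" "x' \<in> fibre y" for x x'
    unfolding osc_def using cSUP_upper[OF _ bdd_osc[OF assms(1)], of "(x, x')" y] that by simp
  from this[of x x'] this[of x' x] show ?thesis using assms by linarith
qed

lemma osc_least:
  assumes "y \<in> topspace Y" "\<And>x x'. x \<in> fibre y \<Longrightarrow> x' \<in> fibre y \<Longrightarrow> f x - f x' \<le> c"
  shows "osc y f \<le> c"
  unfolding osc_def using fibre_ne[OF assms(1)] assms(2) by (intro cSUP_least) auto

lemma osc_nonneg: "f \<in> Cspace X \<Longrightarrow> y \<in> topspace Y \<Longrightarrow> 0 \<le> osc y f"
  using osc_upper[of f _ y] fibre_ne[of y] by fastforce

lemma osc_le_close:
  assumes "y \<in> topspace Y" "\<And>x. x \<in> fibre y \<Longrightarrow> \<bar>f x - g x\<bar> \<le> c"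
  shows "osc y (\<lambda>x. f x - g x) \<le> 2 * c"
  by (rule osc_least[OF assms(1)]) (smt (verit) assms(2))

lemma osc_le_supnorm: "f \<in> Cspace X \<Longrightarrow> y \<in> topspace Y \<Longrightarrow> osc y f \<le> 2 * supnorm X f"
  using osc_le_close[of y f "\<lambda>x. 0" "supnorm X f"] supnorm_upper[OF X(1)] by simp

lemma osc_comb:
  assumes "f \<in> Cspace X" "g \<in> Cspace X" "y \<in> topspace Y"
  shows "osc y (\<lambda>x. a * f x + b * g x) \<le> \<bar>a\<bar> * osc y f + \<bar>b\<bar> * osc y g"
proof (rule osc_least[OF assms(3)])
  fix x x' assume *: "x \<in> fibre y" "x' \<in> fibre y"
  have "a * f x + b * g x - (a * f x' + b * g x') = a * (f x - f x') + b * (g x - g x')"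
    by (simp add: algebra_simps)
  also have "\<dots> \<le> \<bar>a * (f x - f x')\<bar> + \<bar>b * (g x - g x')\<bar>" by linarith
  also have "\<dots> \<le> \<bar>a\<bar> * osc y f + \<bar>b\<bar> * osc y g"
    using osc_upper[OF assms(1) *] osc_upper[OF assms(2) *]
    by (auto simp: abs_mult intro!: add_mono mult_left_mono)
  finally show "a * f x + b * g x - (a * f x' + b * g x') \<le> \<bar>a\<bar> * osc y f + \<bar>b\<bar> * osc y g" .
qed

lemma osc_diff:
  assumes "f \<in> Cspace X" "g \<in> Cspace X" "y \<in> topspace Y"
  shows "osc y (\<lambda>x. f x - g x) \<le> osc y f + osc y g"
  using osc_comb[OF assms, of 1 "-1"] by simp

lemma osc_triangle:
  assumes "f \<in> Cspace X" "g \<in> Cspace X" "y \<in> topspace Y"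
  shows "osc y f \<le> osc y g + osc y (\<lambda>x. f x - g x)"
  using osc_comb[OF assms(2) Cspace_diff[OF assms(1,2)] assms(3), of 1 1] by simp

lemma convex_on_C_osc: "y \<in> topspace Y \<Longrightarrow> convex_on_C X (osc y)"
  unfolding convex_on_C_def
proof (intro ballI allI impI)
  fix f g and t :: real
  assume "y \<in> topspace Y" "f \<in> Cspace X" "g \<in> Cspace X" "0 \<le> t \<and> t \<le> 1"
  then show "osc y (\<lambda>x. (1-t) * f x + t * g x) \<le> (1-t) * osc y f + t * osc y g"
    using osc_comb[of f g y "1-t" t] by simp
qed

lemma lsc_osc:
  assumes "y \<in> topspace Y"
  shows "pointwise_lsc_on_C X (osc y)"
proof -
  have "pointwise_lsc_on_C X (\<lambda>f. SUP z\<in>fibre y \<times> fibre y. f (fst z) + - f (snd z))"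
  proof (rule lsc_SUP)
    show "fibre y \<times> fibre y \<noteq> {}" using fibre_ne[OF assms] by simp
    show "pointwise_lsc_on_C X (\<lambda>f. f (fst z) + - f (snd z))" if "z \<in> fibre y \<times> fibre y" for z
      using that fibre_subset[of y] by (intro lsc_add lsc_coordinate lsc_minus_coordinate) auto
  qed (use bdd_osc in simp)
  then show ?thesis by (simp add: osc_def[abs_def])
qed

text \<open>Two grid levels that separate values on infinitely many fibres would give disjoint
  closed sets whose images meet in an infinite set.\<close>

lemma finite_large_osc:
  assumes f: "f \<in> Cspace X" and e: "0 < e"
  shows "finite {y \<in> topspace Y. e \<le> osc y f}"
proof -
  \<comment> \<open>Grid of step \<open>e/3\<close>: an oscillation of at least \<open>e\<close>
    yields two values more than \<open>2e/3\<close> apart, and between them lie two consecutive grid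
    levels. Boundedness of \<open>f\<close> leaves finitely many levels to consider.\<close>
  define F1 F2 where "F1 j = {x \<in> topspace X. f x \<in> {..of_int j * (e/3)}}"
    and "F2 j = {x \<in> topspace X. f x \<in> {of_int (j + 1) * (e/3)..}}" for j :: int
  have cont: "continuous_map X euclideanreal f" using f by (simp add: Cspace_def)
  have "finite (p ` F1 j \<inter> p ` F2 j)" for j
  proof (rule p_fully_closed)
    show "closedin X (F1 j)" "closedin X (F2 j)"
      unfolding F1_def F2_def by (intro closedin_continuous_map_preimage[OF cont]; simp)+
    have "of_int j * (e/3) < of_int (j + 1) * (e/3)" using e by (simp add: algebra_simps)
    then show "F1 j \<inter> F2 j = {}" by (auto simp: F1_def F2_def)
  qed
  moreover define J where "J = {- \<lceil>3 * supnorm X f / e\<rceil> .. \<lceil>3 * supnorm X f / e\<rceil> + 1}"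
  ultimately have "finite (\<Union>j\<in>J. p ` F1 j \<inter> p ` F2 j)" by (simp add: J_def)
  moreover have "{y \<in> topspace Y. e \<le> osc y f} \<subseteq> (\<Union>j\<in>J. p ` F1 j \<inter> p ` F2 j)"
  proof
    fix y assume "y \<in> {y \<in> topspace Y. e \<le> osc y f}"
    then have y: "y \<in> topspace Y" "2 * (e/3) < osc y f" using e by auto
    then obtain x x' where x: "x \<in> fibre y" "x' \<in> fibre y" "2 * (e/3) < f x - f x'"
      using fibre_ne[OF y(1)] less_cSUP_iff[OF _ bdd_osc[OF f, of y], of "2 * (e/3)"]
      unfolding osc_def by fastforce
    define j where "j = \<lceil>3 * f x' / e\<rceil>"
    have j: "3 * f x' / e \<le> of_int j" "of_int j < 3 * f x' / e + 1"
      unfolding j_def by linarith+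
    have "f x' \<le> of_int j * (e/3)" "of_int (j + 1) * (e/3) \<le> f x"
      using j x(3) e by (auto simp: field_simps)
    then have "x' \<in> F1 j" "x \<in> F2 j" "y = p x" "y = p x'"
      using x by (auto simp: F1_def F2_def fibre_def)
    then have "y \<in> p ` F1 j \<inter> p ` F2 j" by blast
    moreover have "\<bar>3 * f x' / e\<bar> \<le> 3 * supnorm X f / e"
      using supnorm_upper[OF X(1) f, of x'] e by (simp add: divide_right_mono abs_mult)
    then have "j \<in> J" unfolding J_def j_def by (simp; linarith)
    ultimately show "y \<in> (\<Union>j\<in>J. p ` F1 j \<inter> p ` F2 j)" by blast
  qed
  ultimately show ?thesis by (rule finite_subset[rotated])
qed

section \<open>Restriction to fibres and the Day-type functional\<close>

definition fibre_restrict :: "'b \<Rightarrow> ('a \<Rightarrow> real) \<Rightarrow> 'a \<Rightarrow> real" where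
  "fibre_restrict y f = (\<lambda>x. if x \<in> fibre y then f x else 0)"

abbreviation fibre_space :: "'b \<Rightarrow> 'a topology" where
  "fibre_space y \<equiv> subtopology X (fibre y)"

lemma topspace_fibre: "topspace (fibre_space y) = fibre y"
  using fibre_subset[of y] by (auto simp: topspace_subtopology)

lemma compact_fibre: "y \<in> topspace Y \<Longrightarrow> compact_space (fibre_space y)"
  using X(1) closedin_fibre by (simp add: closedin_compact_space compact_space_subtopology)

lemma fibre_restrict_Cspace:
  assumes "f \<in> Cspace X"
  shows "fibre_restrict y f \<in> Cspace (fibre_space y)"
proof -
  have "continuous_map (fibre_space y) euclideanreal f"
    using assms by (simp add: Cspace_def continuous_map_from_subtopology)
  then have "continuous_map (fibre_space y) euclideanreal (fibre_restrict y f)"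
    by (rule continuous_map_eq) (auto simp: fibre_restrict_def topspace_fibre)
  then show ?thesis unfolding Cspace_def topspace_fibre by (simp add: fibre_restrict_def)
qed

lemma fibre_restrict_comb:
  "fibre_restrict y (\<lambda>x. a * f x + b * g x) = (\<lambda>x. a * fibre_restrict y f x + b * fibre_restrict y g x)"
  by (auto simp: fibre_restrict_def)

lemma fibre_restrict_mid:
  "fibre_restrict y (\<lambda>x. (f x + g x) / 2) = (\<lambda>x. (fibre_restrict y f x + fibre_restrict y g x) / 2)"
  by (auto simp: fibre_restrict_def)

lemma supnorm_fibre_restrict:
  "f \<in> Cspace X \<Longrightarrow> supnorm (fibre_space y) (fibre_restrict y f) \<le> supnorm X f"
  by (rule supnorm_least) (auto simp: fibre_restrict_def supnorm_nonneg[OF X(1)] supnorm_upper[OF X(1)])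

lemma convex_on_C_fibre_restrict:
  assumes "convex_on_C (fibre_space y) \<Phi>"
  shows "convex_on_C X (\<lambda>f. \<Phi> (fibre_restrict y f))"
  unfolding convex_on_C_def fibre_restrict_comb
  by (auto intro!: convex_on_CD[OF assms] fibre_restrict_Cspace)

lemma lsc_fibre_restrict:
  assumes "pointwise_lsc_on_C (fibre_space y) \<Phi>"
  shows "pointwise_lsc_on_C X (\<lambda>f. \<Phi> (fibre_restrict y f))"
proof (rule lscI)
  fix f a assume f: "f \<in> Cspace X" and a: "a < \<Phi> (fibre_restrict y f)"
  obtain F d where F: "finite F" "F \<subseteq> topspace (fibre_space y)" "0 < d"
    "\<forall>g\<in>Cspace (fibre_space y). (\<forall>x\<in>F. \<bar>g x - fibre_restrict y f x\<bar> < d) \<longrightarrow> a < \<Phi> g"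
    by (rule lscD[OF assms fibre_restrict_Cspace[OF f], OF a])
  have "a < \<Phi> (fibre_restrict y g)" if "g \<in> Cspace X" "\<forall>x\<in>F. \<bar>g x - f x\<bar> < d" for g
    using that F(2) unfolding topspace_fibre
    by (intro F(4)[rule_format] fibre_restrict_Cspace) (auto simp: fibre_restrict_def)
  then show "\<exists>F d. finite F \<and> F \<subseteq> topspace X \<and> 0 < d \<and>
      (\<forall>g\<in>Cspace X. (\<forall>x\<in>F. \<bar>g x - f x\<bar> < d) \<longrightarrow> a < \<Phi> (fibre_restrict y g))"
    using F(1,2,3) fibre_subset[of y] unfolding topspace_fibre by (intro exI[of _ F] exI[of _ d]) auto
qed

text \<open>A Day-type construction: a near-maximizing finite set for
  \<open>\<Sum>\<^sub>A osc + (1/k) \<Sum>\<^sub>A N\<^sup>2\<close> must be the set of the fibres with large oscillation, so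
  that the rotundity of the norms on these fibres becomes available.\<close>

lemma fibrewise_rotund_functional:
  assumes fibres: "\<forall>y\<in>topspace Y. has_LUR_lsc_norm (fibre_space y)"
  obtains W where "admissible X W"
    "\<And>f e. f \<in> Cspace X \<Longrightarrow> 0 < e \<Longrightarrow>
      \<exists>d>0. \<forall>g\<in>Cspace X. mid_defect W f g < d \<longrightarrow> (\<forall>y\<in>topspace Y. osc y (\<lambda>x. f x - g x) \<le> e)"
proof -
  note sn0 = supnorm_nonneg[OF X(1)]
  have "\<forall>y\<in>topspace Y. \<exists>N a b. is_norm_on_C (fibre_space y) N \<and>
      LUR_on_C (fibre_space y) N \<and> pointwise_lsc_on_C (fibre_space y) N \<and>
      0 < a \<and> 0 < b \<and> (\<forall>f\<in>Cspace (fibre_space y).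
        a * supnorm (fibre_space y) f \<le> N f \<and> N f \<le> b * supnorm (fibre_space y) f)"
    using fibres unfolding has_LUR_lsc_norm_def equivalent_norm_on_C_def by blast
  then obtain N a b where Nab: "\<forall>y\<in>topspace Y. is_norm_on_C (fibre_space y) (N y) \<and>
      LUR_on_C (fibre_space y) (N y) \<and> pointwise_lsc_on_C (fibre_space y) (N y) \<and>
      0 < a y \<and> 0 < b y \<and> (\<forall>f\<in>Cspace (fibre_space y).
        a y * supnorm (fibre_space y) f \<le> N y f \<and> N y f \<le> b y * supnorm (fibre_space y) f)"
    unfolding bchoice_iff by blast
  then have N: "\<And>y. y \<in> topspace Y \<Longrightarrow> is_norm_on_C (fibre_space y) (N y)"
    and LUR: "\<And>y. y \<in> topspace Y \<Longrightarrow> LUR_on_C (fibre_space y) (N y)"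
    and lscN: "\<And>y. y \<in> topspace Y \<Longrightarrow> pointwise_lsc_on_C (fibre_space y) (N y)"
    and ab: "\<And>y. y \<in> topspace Y \<Longrightarrow> 0 < a y" "\<And>y. y \<in> topspace Y \<Longrightarrow> 0 < b y"
    and lower: "\<And>y f. y \<in> topspace Y \<Longrightarrow> f \<in> Cspace (fibre_space y) \<Longrightarrow>
      a y * supnorm (fibre_space y) f \<le> N y f"
    and upper: "\<And>y f. y \<in> topspace Y \<Longrightarrow> f \<in> Cspace (fibre_space y) \<Longrightarrow>
      N y f \<le> b y * supnorm (fibre_space y) f"
    by simp_all
  \<comment> \<open>The equivalence constants of the fibre norms may be unbounded in
    \<open>y\<close>; dividing by \<open>(b y)\<^sup>2\<close> gives the common bound
    \<open>\<nu>_le\<close>.\<close>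
  define \<nu> where "\<nu> y f = (1 / (b y)\<^sup>2) * (N y (fibre_restrict y f))\<^sup>2" for y f
  have \<nu>_nonneg: "0 \<le> \<nu> y f" for y f by (simp add: \<nu>_def)
  have \<nu>_le: "\<nu> y f \<le> (supnorm X f)\<^sup>2" if y: "y \<in> topspace Y" and f: "f \<in> Cspace X" for y f
  proof -
    have "N y (fibre_restrict y f) \<le> b y * supnorm X f"
      using upper[OF y fibre_restrict_Cspace[OF f]] supnorm_fibre_restrict[OF f, of y] ab(2)[OF y]
      by (meson less_imp_le mult_left_mono order_trans)
    then have "(N y (fibre_restrict y f))\<^sup>2 \<le> (b y * supnorm X f)\<^sup>2"
      using is_norm_on_C_nonneg[OF N[OF y] fibre_restrict_Cspace[OF f]] by (rule power_mono)
    then show ?thesis using ab(2)[OF y] by (simp add: \<nu>_def field_simps power_mult_distrib)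
  qed
  have conv\<nu>: "convex_on_C X (\<nu> y)" and lsc\<nu>: "pointwise_lsc_on_C X (\<nu> y)" if y: "y \<in> topspace Y" for y
  proof -
    note N0 = is_norm_on_C_nonneg[OF N[OF y]]
    show "convex_on_C X (\<nu> y)" unfolding \<nu>_def[abs_def]
      by (intro convex_on_C_cmult convex_on_C_fibre_restrict convex_on_C_square
          convex_on_C_norm[OF N[OF y]] N0) auto
    show "pointwise_lsc_on_C X (\<nu> y)" unfolding \<nu>_def[abs_def]
      by (intro lsc_cmult lsc_fibre_restrict lsc_square lscN[OF y] N0) auto
  qed
  \<comment> \<open>At most \<open>m\<close> fibres rather than exactly \<open>m\<close>: the family
    is never empty, and the empty set makes the suprema nonnegative.\<close>
  define I where "I m = {A. finite A \<and> A \<subseteq> topspace Y \<and> card A \<le> m}" for m :: nat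
  have I_ne: "I m \<noteq> {}" for m by (auto simp: I_def intro!: exI[of _ "{}"])
  define S where "S A f = (\<Sum>y\<in>A. osc y f)" for A f
  define G where "G k A f = S A f + inverse (real (Suc k)) * (\<Sum>y\<in>A. \<nu> y f)" for k A f
  define \<theta> where "\<theta> m k f = (SUP A\<in>I m. G k A f)" for m k f
  define \<sigma> where "\<sigma> m f = (SUP A\<in>I m. S A f)" for m f
  have S_nonneg: "0 \<le> S A f" if "A \<in> I m" "f \<in> Cspace X" for A m f
    unfolding S_def using that by (intro sum_nonneg osc_nonneg) (auto simp: I_def)
  have S_le: "S A f \<le> real m * (2 * supnorm X f)" if A: "A \<in> I m" and f: "f \<in> Cspace X" for A m f
  proof -
    have "S A f \<le> real (card A) * (2 * supnorm X f)"
      unfolding S_def using A f by (intro sum_bounded_above osc_le_supnorm) (auto simp: I_def)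
    also have "\<dots> \<le> real m * (2 * supnorm X f)"
      using A sn0[OF f] by (intro mult_right_mono) (auto simp: I_def)
    finally show ?thesis .
  qed
  have \<nu>_sum_le: "(\<Sum>y\<in>A. \<nu> y f) \<le> real m * (supnorm X f)\<^sup>2" if A: "A \<in> I m" and f: "f \<in> Cspace X" for A m f
  proof -
    have "(\<Sum>y\<in>A. \<nu> y f) \<le> real (card A) * (supnorm X f)\<^sup>2"
      using A f by (intro sum_bounded_above \<nu>_le) (auto simp: I_def)
    also have "\<dots> \<le> real m * (supnorm X f)\<^sup>2"
      using A by (intro mult_right_mono) (auto simp: I_def)
    finally show ?thesis .
  qed
  have G_S: "S A f \<le> G k A f" for k A f
    by (simp add: G_def sum_nonneg \<nu>_nonneg)
  have G_le: "G k A f \<le> 2 * real m * (1 + (supnorm X f)\<^sup>2)" if A: "A \<in> I m" and f: "f \<in> Cspace X" for k A m f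
  proof -
    have "inverse (real (Suc k)) * (\<Sum>y\<in>A. \<nu> y f) \<le> 1 * (\<Sum>y\<in>A. \<nu> y f)"
      by (intro mult_right_mono sum_nonneg \<nu>_nonneg) (simp add: inverse_le_1_iff)
    then have "G k A f \<le> real m * (2 * supnorm X f) + real m * (supnorm X f)\<^sup>2"
      using S_le[OF A f] \<nu>_sum_le[OF A f] by (simp add: G_def)
    also have "\<dots> = real m * (2 * supnorm X f + (supnorm X f)\<^sup>2)" by (simp add: algebra_simps)
    also have "\<dots> \<le> real m * (2 * (1 + (supnorm X f)\<^sup>2))"
    proof (rule mult_left_mono)
      have "0 \<le> (1 - supnorm X f)\<^sup>2" by simp
      then show "2 * supnorm X f + (supnorm X f)\<^sup>2 \<le> 2 * (1 + (supnorm X f)\<^sup>2)"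
        by (simp add: power2_eq_square algebra_simps)
    qed simp
    finally show ?thesis by (simp add: algebra_simps)
  qed
  have bddS: "bdd_above ((\<lambda>A. S A f) ` I m)" and bddG: "bdd_above ((\<lambda>A. G k A f) ` I m)"
    if "f \<in> Cspace X" for f m k
    using S_le[OF _ that] G_le[OF _ that] by (meson bdd_aboveI2)+
  have convS: "convex_on_C X (S A)" and lscS: "pointwise_lsc_on_C X (S A)" if "A \<in> I m" for A m
    unfolding S_def[abs_def] using that
    by (auto simp: I_def intro!: convex_on_C_sum lsc_sum convex_on_C_osc lsc_osc)
  have convG: "convex_on_C X (G k A)" and lscG: "pointwise_lsc_on_C X (G k A)" if "A \<in> I m" for A m k
    unfolding G_def[abs_def] using that convS[OF that] lscS[OF that]
    by (auto simp: I_def simp del: of_nat_Suc intro!: convex_on_C_add convex_on_C_cmult convex_on_C_sum conv\<nu>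
        lsc_add lsc_cmult lsc_sum lsc\<nu>)
  have \<sigma>_upper: "S A f \<le> \<sigma> m f" if "A \<in> I m" "f \<in> Cspace X" for A m f
    unfolding \<sigma>_def using that by (intro cSUP_upper bddS)
  have \<theta>_upper: "G k A f \<le> \<theta> m k f" if "A \<in> I m" "f \<in> Cspace X" for A m k f
    unfolding \<theta>_def using that by (intro cSUP_upper bddG)
  have \<sigma>_nonneg: "0 \<le> \<sigma> m f" if "f \<in> Cspace X" for m f
    using \<sigma>_upper[of "{}" m f] that by (simp add: I_def S_def)
  have conv\<sigma>: "convex_on_C X (\<sigma> m)" and lsc\<sigma>: "pointwise_lsc_on_C X (\<sigma> m)" for m
    unfolding \<sigma>_def[abs_def]
    by (rule convex_on_C_SUP[OF I_ne convS bddS], assumption+)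
       (rule lsc_SUP[OF I_ne lscS bddS], assumption+)
  have conv\<theta>: "convex_on_C X (\<theta> m k)" and lsc\<theta>: "pointwise_lsc_on_C X (\<theta> m k)" for m k
    unfolding \<theta>_def[abs_def]
    by (rule convex_on_C_SUP[OF I_ne convG bddG], assumption+)
       (rule lsc_SUP[OF I_ne lscG bddG], assumption+)
  \<comment> \<open>\<open>\<theta>\<close> identifies the fibres of large oscillation and yields
    closeness on them; the square of \<open>\<sigma>\<close> makes \<open>\<sigma> m g\<close> close
    to \<open>\<sigma> m f\<close>, which limits the oscillation of \<open>g\<close> on all other
    fibres.\<close>
  define \<Phi> where "\<Phi> m k f = \<theta> m k f + (\<sigma> m f)\<^sup>2" for m k f
  have adm\<Phi>: "admissible X (\<Phi> m k)" for m k
    unfolding admissible_def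
  proof (intro conjI ballI)
    have "0 \<le> \<theta> m k f" if "f \<in> Cspace X" for f
      using \<theta>_upper[of "{}" m f k] that by (simp add: I_def G_def S_def)
    then show "0 \<le> \<Phi> m k f" if "f \<in> Cspace X" for f using that by (simp add: \<Phi>_def)
    show "convex_on_C X (\<Phi> m k)" "pointwise_lsc_on_C X (\<Phi> m k)"
      unfolding \<Phi>_def[abs_def]
      by (intro convex_on_C_add lsc_add conv\<theta> lsc\<theta> convex_on_C_square lsc_square conv\<sigma> lsc\<sigma> \<sigma>_nonneg;
          assumption)+
    show "quad_bounded_on_C X (\<Phi> m k)"
      unfolding quad_bounded_on_C_def
    proof (intro exI[of _ "2 * real m + 4 * (real m)\<^sup>2"] conjI ballI)
      fix f assume f: "f \<in> Cspace X"
      have "\<theta> m k f \<le> 2 * real m * (1 + (supnorm X f)\<^sup>2)"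
        unfolding \<theta>_def using I_ne G_le[OF _ f] by (intro cSUP_least) auto
      moreover have "\<sigma> m f \<le> real m * (2 * supnorm X f)"
        unfolding \<sigma>_def using I_ne S_le[OF _ f] by (intro cSUP_least) auto
      then have "(\<sigma> m f)\<^sup>2 \<le> (real m * (2 * supnorm X f))\<^sup>2"
        using \<sigma>_nonneg[OF f] by (rule power_mono)
      moreover have "(real m * (2 * supnorm X f))\<^sup>2 \<le> 4 * (real m)\<^sup>2 * (1 + (supnorm X f)\<^sup>2)"
        by (simp add: power_mult_distrib algebra_simps)
      ultimately show "\<Phi> m k f \<le> (2 * real m + 4 * (real m)\<^sup>2) * (1 + (supnorm X f)\<^sup>2)"
        by (simp add: \<Phi>_def distrib_right)
    qed simp
  qed
  have adm': "admissible X (case prod_decode j of (m, k) \<Rightarrow> \<Phi> m k)" for j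
    using adm\<Phi> by (simp split: prod.split)
  obtain W where W: "admissible X W" "\<forall>j. \<exists>c>0. \<forall>f\<in>Cspace X. \<forall>g\<in>Cspace X.
      mid_defect (case prod_decode j of (m, k) \<Rightarrow> \<Phi> m k) f g \<le> c * mid_defect W f g"
    by (rule admissible_series[OF X(1), of "\<lambda>j. case prod_decode j of (m, k) \<Rightarrow> \<Phi> m k", OF adm'])
  have W\<Phi>: "\<exists>c>0. \<forall>f\<in>Cspace X. \<forall>g\<in>Cspace X. mid_defect (\<Phi> m k) f g \<le> c * mid_defect W f g" for m k
    using W(2)[rule_format, of "prod_encode (m, k)"] by simp
  have small: "\<exists>d>0. \<forall>g\<in>Cspace X. mid_defect W f g < d \<longrightarrow> mid_defect (\<theta> m k) f g < \<eta> \<and>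
      mid_defect (\<lambda>f. (\<sigma> m f)\<^sup>2) f g < \<eta>" if f: "f \<in> Cspace X" and \<eta>: "0 < \<eta>" for m k f \<eta>
  proof -
    obtain c where c: "0 < c" "\<And>g. g \<in> Cspace X \<Longrightarrow> mid_defect (\<Phi> m k) f g \<le> c * mid_defect W f g"
      using W\<Phi>[of m k] f by blast
    have "mid_defect (\<theta> m k) f g < \<eta> \<and> mid_defect (\<lambda>f. (\<sigma> m f)\<^sup>2) f g < \<eta>"
      if g: "g \<in> Cspace X" "mid_defect W f g < \<eta> / c" for g
    proof -
      have "mid_defect (\<Phi> m k) f g = mid_defect (\<theta> m k) f g + mid_defect (\<lambda>f. (\<sigma> m f)\<^sup>2) f g"
        unfolding \<Phi>_def[abs_def] by (rule mid_defect_add)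
      moreover have "c * mid_defect W f g < \<eta>" using g(2) c(1) by (simp add: field_simps)
      moreover have "0 \<le> mid_defect (\<theta> m k) f g" by (rule mid_defect_nonneg[OF conv\<theta> f g(1)])
      moreover have "0 \<le> mid_defect (\<lambda>f. (\<sigma> m f)\<^sup>2) f g"
        by (rule mid_defect_nonneg[OF convex_on_C_square[OF conv\<sigma> \<sigma>_nonneg] f g(1)])
      ultimately show ?thesis using c(2)[OF g(1)] by linarith
    qed
    then show ?thesis using \<eta> c(1) by (intro exI[of _ "\<eta> / c"]) auto
  qed
  have "\<exists>d>0. \<forall>g\<in>Cspace X. mid_defect W f g < d \<longrightarrow> (\<forall>y\<in>topspace Y. osc y (\<lambda>x. f x - g x) \<le> e)"
    if f: "f \<in> Cspace X" and e: "0 < e" for f e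
  proof -
    \<comment> \<open>Outside \<open>A0\<close> the final estimate is \<open>r\<close> for
      \<open>f\<close> plus \<open>3r\<close> for \<open>g\<close>.\<close>
    define r where "r = e / 4"
    have r: "0 < r" using e by (simp add: r_def)
    define A0 where "A0 = {y \<in> topspace Y. r \<le> osc y f}"
    \<comment> \<open>Lowering the level to \<open>r/2\<close> still gives a finite set, so the
      oscillations outside \<open>A0\<close> are bounded by some \<open>s\<close> strictly below
      \<open>r\<close>. The gap \<open>r - s\<close> drives the argument.\<close>
    define B where "B = {y \<in> topspace Y. r / 2 \<le> osc y f}"
    have fin: "finite A0" "finite B"
      unfolding A0_def B_def using r by (intro finite_large_osc f; simp)+
    define s where "s = Max (insert (r/2) ((\<lambda>y. osc y f) ` (B - A0)))"
    have s: "0 < s" "s < r"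
    proof -
      have "r / 2 \<le> s" unfolding s_def using fin by (intro Max_ge) auto
      then show "0 < s" using r by simp
      show "s < r" unfolding s_def using fin r by (subst Max_less_iff) (auto simp: A0_def B_def)
    qed
    have outside: "osc y f \<le> s" if "y \<in> topspace Y" "y \<notin> A0" for y
    proof (cases "y \<in> B")
      case True
      then show ?thesis unfolding s_def using fin that by (intro Max_ge) auto
    next
      case False
      then have "osc y f \<le> r / 2" using that by (simp add: B_def)
      also have "r / 2 \<le> s" unfolding s_def using fin by (intro Max_ge) auto
      finally show ?thesis .
    qed
    have A0Y: "A0 \<subseteq> topspace Y" by (auto simp: A0_def)
    define m where "m = card A0"
    have A0I: "A0 \<in> I m" using fin A0Y by (simp add: I_def m_def)
    have exchange: "S A f \<le> S A0 f + real (card (A - A0)) * s - real (card (A0 - A)) * r"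
      if "A \<in> I n" for A n
      unfolding S_def using that fin outside
      by (intro sum_exchange_le) (auto simp: I_def A0_def)
    have card_diff: "card (A - A0) + card A0 = card (A0 - A) + card A" if "finite A" for A
      using card_Int_Diff[OF that, of A0] card_Int_Diff[OF fin(1), of A] by (simp add: Int_commute)
    \<comment> \<open>A competitor with at most \<open>m = card A0\<close> members misses some fibre
      of \<open>A0\<close>. It trades terms of size at least \<open>r\<close> for no more terms of
      size at most \<open>s\<close>, so it loses at least \<open>r - s\<close>.\<close>
    have gap: "S A f \<le> S A0 f - (r - s)" if A: "A \<in> I m" "A \<noteq> A0" for A
    proof -
      have "finite A" "card A \<le> card A0" using A by (auto simp: I_def m_def)
      have "A0 - A \<noteq> {}"
        using card_subset_eq[OF \<open>finite A\<close>, of A0] card_mono[OF \<open>finite A\<close>, of A0] \<open>card A \<le> card A0\<close> A(2)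
        by auto
      then have "1 \<le> card (A0 - A)" using fin by (simp add: Suc_le_eq card_gt_0_iff)
      moreover have "card (A - A0) \<le> card (A0 - A)"
        using card_diff[OF \<open>finite A\<close>] \<open>card A \<le> card A0\<close> by simp
      then have "real (card (A - A0)) * s \<le> real (card (A0 - A)) * s"
        using s by (intro mult_right_mono) auto
      moreover have "1 * (r - s) \<le> real (card (A0 - A)) * (r - s)"
        using s \<open>1 \<le> card (A0 - A)\<close> by (intro mult_right_mono) auto
      ultimately show ?thesis using exchange[OF A(1)] by (simp add: algebra_simps)
    qed
    have next_le: "\<sigma> (Suc m) f \<le> S A0 f + s"
      unfolding \<sigma>_def
    proof (rule cSUP_least[OF I_ne])
      fix A assume A: "A \<in> I (Suc m)"
      then have "finite A" "card A \<le> Suc (card A0)" by (auto simp: I_def m_def)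
      then have "card (A - A0) \<le> Suc (card (A0 - A))"
        using card_diff[of A] by simp
      then have "real (card (A - A0)) * s \<le> real (Suc (card (A0 - A))) * s"
        using s by (intro mult_right_mono) auto
      moreover have "real (card (A0 - A)) * s \<le> real (card (A0 - A)) * r"
        using s by (intro mult_left_mono) auto
      ultimately show "S A f \<le> S A0 f + s" using exchange[OF A] by (simp add: algebra_simps)
    qed
    \<comment> \<open>\<open>D\<close> bounds the rotund part on \<open>m\<close> fibres, the added
      1 making it positive. With \<open>1/(k+1)\<close> chosen this small, that part cannot
      compensate the loss \<open>r - s\<close>.\<close>
    define D where "D = real m * (supnorm X f)\<^sup>2 + 1"
    have D: "0 < D" by (simp add: D_def add_nonneg_pos)
    obtain k where k: "inverse (real (Suc k)) < (r - s) / 4 / D"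
      using reals_Archimedean[of "(r - s) / 4 / D"] s D by auto
    then have kD: "inverse (real (Suc k)) * D < (r - s) / 4"
      using D by (simp add: pos_less_divide_eq)
    \<comment> \<open>Small enough to be summed over the \<open>m\<close> fibres of
      \<open>A0\<close>: closeness \<open>r'\<close> on a fibre allows an oscillation of at most
      \<open>2r'\<close>.\<close>
    define r' where "r' = r / (2 * (real m + 1))"
    have r': "0 < r'" using r by (simp add: r'_def add_nonneg_pos)
    have mr': "2 * real m * r' \<le> r" "2 * r' \<le> r"
      using r by (auto simp: r'_def field_simps)
    have "\<exists>d>0. \<forall>h\<in>Cspace (fibre_space y). mid_defect (\<lambda>f. (N y f)\<^sup>2) (fibre_restrict y f) h < d \<longrightarrow>
        N y (\<lambda>x. fibre_restrict y f x - h x) < a y * r'" if y: "y \<in> A0" for y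
    proof -
      have "y \<in> topspace Y" using y A0Y by auto
      then obtain d where "0 < d" "\<And>h. h \<in> Cspace (fibre_space y) \<Longrightarrow>
          mid_defect (\<lambda>f. (N y f)\<^sup>2) (fibre_restrict y f) h < d \<Longrightarrow> N y (\<lambda>x. fibre_restrict y f x - h x) < a y * r'"
        using LUR_on_C_defect[OF N LUR fibre_restrict_Cspace[OF f], of y "a y * r'"] ab r' by auto
      then show ?thesis by blast
    qed
    then have "\<exists>\<delta>. \<forall>y\<in>A0. 0 < \<delta> y \<and> (\<forall>h\<in>Cspace (fibre_space y).
        mid_defect (\<lambda>f. (N y f)\<^sup>2) (fibre_restrict y f) h < \<delta> y \<longrightarrow>
        N y (\<lambda>x. fibre_restrict y f x - h x) < a y * r')"
      by (intro bchoice ballI)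
    then obtain \<delta> where "\<forall>y\<in>A0. 0 < \<delta> y \<and> (\<forall>h\<in>Cspace (fibre_space y).
        mid_defect (\<lambda>f. (N y f)\<^sup>2) (fibre_restrict y f) h < \<delta> y \<longrightarrow>
        N y (\<lambda>x. fibre_restrict y f x - h x) < a y * r')" ..
    then have \<delta>: "\<And>y. y \<in> A0 \<Longrightarrow> 0 < \<delta> y"
      "\<And>y h. y \<in> A0 \<Longrightarrow> h \<in> Cspace (fibre_space y) \<Longrightarrow>
        mid_defect (\<lambda>f. (N y f)\<^sup>2) (fibre_restrict y f) h < \<delta> y \<Longrightarrow>
        N y (\<lambda>x. fibre_restrict y f x - h x) < a y * r'"
      by simp_all
    have "0 < \<delta> y / (b y)\<^sup>2" if "y \<in> A0" for y
      using \<delta>(1)[OF that] ab(2)[of y] that A0Y by auto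
    then obtain q where q: "0 < q" "\<And>y. y \<in> A0 \<Longrightarrow> q \<le> \<delta> y / (b y)\<^sup>2"
      using finite_pos_lower_bound[OF fin(1), of "\<lambda>y. \<delta> y / (b y)\<^sup>2"] by blast
    \<comment> \<open>The first entry keeps \<open>2 * \<eta>\<close> at no more than half the gap,
      so near-maximality forces \<open>A = A0\<close>; the second allows for the factor
      \<open>k + 1\<close> that appears when the rotund part is isolated.\<close>
    define \<eta> where "\<eta> = min ((r - s) / 4) (q / (2 * real (Suc k)))"
    have \<eta>: "0 < \<eta>" "2 * \<eta> \<le> (r - s) / 2" "2 * \<eta> * real (Suc k) \<le> q"
    proof -
      show "0 < \<eta>" using s q by (simp add: \<eta>_def)
      have "\<eta> \<le> (r - s) / 4" unfolding \<eta>_def by (rule min.cobounded1)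
      then show "2 * \<eta> \<le> (r - s) / 2" by simp
      have "\<eta> \<le> q / (2 * real (Suc k))" by (simp add: \<eta>_def)
      then show "2 * \<eta> * real (Suc k) \<le> q" by (simp add: field_simps del: of_nat_Suc)
    qed
    obtain d1 where d1: "0 < d1" "\<And>g. g \<in> Cspace X \<Longrightarrow> mid_defect W f g < d1 \<Longrightarrow> mid_defect (\<theta> m k) f g < \<eta>"
      using small[OF f \<eta>(1), of m k] by blast
    obtain d2 where d2: "0 < d2" "\<And>g. g \<in> Cspace X \<Longrightarrow> mid_defect W f g < d2 \<Longrightarrow>
        mid_defect (\<lambda>f. (\<sigma> (Suc m) f)\<^sup>2) f g < r\<^sup>2 / 2"
      using small[OF f, of "r\<^sup>2 / 2" "Suc m" k] r by auto
    have "osc y (\<lambda>x. f x - g x) \<le> e"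
      if g: "g \<in> Cspace X" and def: "mid_defect W f g < min d1 d2" and y: "y \<in> topspace Y" for g y
    proof -
      obtain A where A: "A \<in> I m" "\<theta> m k f - 2 * \<eta> < G k A f" "mid_defect (G k A) f g < 2 * \<eta>"
      proof (rule SUP_near_max[OF I_ne bddG convG f g, where \<eta> = \<eta>])
        show "mid_defect (\<lambda>f. SUP A\<in>I m. G k A f) f g < \<eta>"
          using d1(2)[OF g] def by (simp add: \<theta>_def[abs_def])
      qed (use \<eta> that in \<open>auto simp: \<theta>_def\<close>)
      have "A = A0"
      proof (rule ccontr)
        assume "A \<noteq> A0"
        have "inverse (real (Suc k)) * (\<Sum>y\<in>A. \<nu> y f) \<le> inverse (real (Suc k)) * D"
          using \<nu>_sum_le[OF A(1) f] by (intro mult_left_mono) (auto simp: D_def)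
        then have "G k A f < S A f + (r - s) / 4" using kD unfolding G_def by linarith
        also have "\<dots> \<le> S A0 f - 3 * (r - s) / 4" using gap[OF A(1) \<open>A \<noteq> A0\<close>] by (simp add: field_simps)
        also have "S A0 f \<le> \<theta> m k f" using G_S[of A0 f k] \<theta>_upper[OF A0I f, of k] by simp
        finally show False using A(2) \<eta>(2) s by (simp add: field_simps)
      qed
      have near: "\<bar>f x - g x\<bar> \<le> r'" if z: "z \<in> A0" and x: "x \<in> fibre z" for z x
      proof -
        have zY: "z \<in> topspace Y" using z A0Y by auto
        have D\<nu>: "0 \<le> mid_defect (\<nu> y) f g" if "y \<in> A0" for y
          using that A0Y by (intro mid_defect_nonneg[OF conv\<nu> f g]) auto
        have "inverse (real (Suc k)) * mid_defect (\<nu> z) f g \<le>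
            inverse (real (Suc k)) * (\<Sum>y\<in>A0. mid_defect (\<nu> y) f g)"
          using z fin D\<nu> by (intro mult_left_mono member_le_sum) auto
        moreover have "mid_defect (G k A0) f g =
            mid_defect (S A0) f g + inverse (real (Suc k)) * (\<Sum>y\<in>A0. mid_defect (\<nu> y) f g)"
          unfolding G_def[abs_def] mid_defect_add mid_defect_cmult mid_defect_sum ..
        moreover have "0 \<le> mid_defect (S A0) f g"
          by (rule mid_defect_nonneg[OF convS[OF A0I] f g])
        ultimately have "inverse (real (Suc k)) * mid_defect (\<nu> z) f g < 2 * \<eta>"
          using A(3) unfolding \<open>A = A0\<close> by linarith
        then have "mid_defect (\<nu> z) f g < 2 * \<eta> * real (Suc k)"
          by (simp add: field_simps del: of_nat_Suc)
        also have "\<dots> \<le> \<delta> z / (b z)\<^sup>2" using \<eta>(3) q(2)[OF z] by linarith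
        also have "mid_defect (\<nu> z) f g =
            1 / (b z)\<^sup>2 * mid_defect (\<lambda>f. (N z f)\<^sup>2) (fibre_restrict z f) (fibre_restrict z g)"
          unfolding \<nu>_def[abs_def] mid_defect_cmult by (simp add: mid_defect_def fibre_restrict_mid)
        finally have "mid_defect (\<lambda>f. (N z f)\<^sup>2) (fibre_restrict z f) (fibre_restrict z g) < \<delta> z"
          using ab(2)[OF zY] by (simp add: divide_less_cancel)
        then have "N z (\<lambda>x. fibre_restrict z f x - fibre_restrict z g x) < a z * r'"
          by (rule \<delta>(2)[OF z fibre_restrict_Cspace[OF g]])
        moreover note lower[OF zY Cspace_diff[OF fibre_restrict_Cspace[OF f] fibre_restrict_Cspace[OF g]]]
        ultimately have "a z * supnorm (fibre_space z) (\<lambda>x. fibre_restrict z f x - fibre_restrict z g x) < a z * r'"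
          by linarith
        then have "supnorm (fibre_space z) (\<lambda>x. fibre_restrict z f x - fibre_restrict z g x) < r'"
          using ab(1)[OF zY] by simp
        then show ?thesis
          using supnorm_upper[OF compact_fibre[OF zY]
              Cspace_diff[OF fibre_restrict_Cspace[OF f, of z] fibre_restrict_Cspace[OF g, of z]], of x] x
          by (simp add: fibre_restrict_def)
      qed
      have osc_near: "osc z (\<lambda>x. f x - g x) \<le> 2 * r'" if "z \<in> A0" for z
        using that A0Y near by (intro osc_le_close) auto
      show ?thesis
      proof (cases "y \<in> A0")
        case True
        then show ?thesis using osc_near[OF True] mr'(2) r by (simp add: r_def)
      next
        case False
        \<comment> \<open>One fibre more than \<open>A0\<close>: the sum for \<open>g\<close> over
          \<open>insert y A0\<close> is below \<open>S A0 f + s + r\<close>, while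
          \<open>S A0 g\<close> is at least \<open>S A0 f - r\<close>, which leaves less than
          \<open>3r\<close> for \<open>osc y g\<close>.\<close>
        have "(\<sigma> (Suc m) f - \<sigma> (Suc m) g)\<^sup>2 \<le> 2 * mid_defect (\<lambda>f. (\<sigma> (Suc m) f)\<^sup>2) f g"
          by (rule mid_defect_square[OF conv\<sigma> \<sigma>_nonneg f g])
        also have "\<dots> < r\<^sup>2" using d2(2)[OF g] def by simp
        finally have "\<bar>\<sigma> (Suc m) f - \<sigma> (Suc m) g\<bar> < r"
          using r power2_less_imp_less[of "\<bar>\<sigma> (Suc m) f - \<sigma> (Suc m) g\<bar>" r] by simp
        moreover have "insert y A0 \<in> I (Suc m)"
          using A0I y False by (auto simp: I_def)
        then have "S (insert y A0) g \<le> \<sigma> (Suc m) g" by (rule \<sigma>_upper[OF _ g])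
        then have "osc y g + S A0 g \<le> \<sigma> (Suc m) g"
          using fin False by (simp add: S_def)
        moreover have "S A0 f - S A0 g \<le> (\<Sum>z\<in>A0. 2 * r')"
          unfolding S_def sum_subtractf[symmetric]
        proof (rule sum_mono)
          fix z assume "z \<in> A0"
          then show "osc z f - osc z g \<le> 2 * r'"
            using osc_triangle[OF f g, of z] osc_near[of z] A0Y by auto
        qed
        then have "S A0 f - S A0 g \<le> r" using mr'(1) by (simp add: m_def)
        ultimately have "osc y g \<le> 3 * r" using next_le s by linarith
        moreover have "osc y f \<le> r" using outside[OF y False] s by simp
        ultimately show ?thesis using osc_diff[OF f g y] by (simp add: r_def)
      qed
    qed
    then show ?thesis using d1(1) d2(1) by (intro exI[of _ "min d1 d2"]) auto
  qed
  then show thesis using that W(1) by blast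
qed

end

section \<open>Partitions of unity and approximation modulo the base\<close>

lemma has_sum_dist_le:
  fixes a :: "'i \<Rightarrow> real"
  assumes "(a has_sum s) D" "finite F" "F \<subseteq> D"
    "\<And>G. finite G \<Longrightarrow> F \<subseteq> G \<Longrightarrow> G \<subseteq> D \<Longrightarrow> \<bar>sum a G - t\<bar> \<le> c"
  shows "\<bar>s - t\<bar> \<le> c"
proof (rule tendsto_upperbound)
  show "((\<lambda>G. \<bar>sum a G - t\<bar>) \<longlongrightarrow> \<bar>s - t\<bar>) (finite_subsets_at_top D)"
    using assms(1) unfolding has_sum_def by (intro tendsto_intros)
  show "\<forall>\<^sub>F G in finite_subsets_at_top D. \<bar>sum a G - t\<bar> \<le> c"
    unfolding eventually_finite_subsets_at_top using assms by blast
qed simp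

text \<open>The weights are the increments of the supremum of the bumps \<open>1 - \<rho> f d\<close> along a well-ordering
  of the centres \<open>d\<close>. They telescope to the full supremum, which is 1 since \<open>f\<close> is itself a centre.\<close>

lemma pseudometric_partition_of_unity:
  fixes \<rho> :: "'c \<Rightarrow> 'c \<Rightarrow> real"
  assumes refl: "\<And>f. f \<in> D \<Longrightarrow> \<rho> f f = 0"
    and sym: "\<And>f g. f \<in> D \<Longrightarrow> g \<in> D \<Longrightarrow> \<rho> f g = \<rho> g f"
    and triangle: "\<And>f g h. f \<in> D \<Longrightarrow> g \<in> D \<Longrightarrow> h \<in> D \<Longrightarrow> \<rho> f h \<le> \<rho> f g + \<rho> g h"
  obtains w where "\<And>f d. 0 \<le> w f d"
    "\<And>f d. f \<in> D \<Longrightarrow> d \<in> D \<Longrightarrow> 0 < w f d \<Longrightarrow> \<rho> f d < 1"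
    "\<And>f g d. f \<in> D \<Longrightarrow> g \<in> D \<Longrightarrow> d \<in> D \<Longrightarrow> \<bar>w f d - w g d\<bar> \<le> 2 * \<rho> f g"
    "\<And>f F. f \<in> D \<Longrightarrow> finite F \<Longrightarrow> F \<subseteq> D \<Longrightarrow> sum (w f) F \<le> 1"
    "\<And>f e. f \<in> D \<Longrightarrow> 0 < e \<Longrightarrow> \<exists>F. finite F \<and> F \<subseteq> D \<and> 1 - e \<le> sum (w f) F"
proof -
  obtain r where r: "well_order_on D r" using well_order_on by blast
  define less where "less a b \<longleftrightarrow> (a, b) \<in> r - Id" for a b
  have wf: "wf (r - Id)" using r by (simp add: well_order_on_def)
  have total: "a = b \<or> less a b \<or> less b a" if "a \<in> D" "b \<in> D" for a b
    using r that unfolding less_def well_order_on_def linear_order_on_def total_on_def by blast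
  have trans: "less a c" if "less a b" "less b c" for a b c
  proof -
    have "trans r" "antisym r"
      using r unfolding well_order_on_def linear_order_on_def partial_order_on_def preorder_on_def by auto
    then show ?thesis using that unfolding less_def by (auto dest: transD antisymD)
  qed
  have irrefl: "\<not> less a a" for a by (simp add: less_def)
  have \<rho>_nonneg: "0 \<le> \<rho> f g" if "f \<in> D" "g \<in> D" for f g
    using triangle[OF that(1,2,1)] sym[OF that] refl[OF that(1)] by simp
  define u where "u f d = max 0 (1 - \<rho> f d)" for f d
  \<comment> \<open>The inserted 0 is the value at the least centre and keeps \<open>v\<close>
    nonnegative.\<close>
  define v where "v f d = Sup (insert 0 (u f ` {d'\<in>D. less d' d}))" for f d
  define w where "w f d = max 0 (u f d - v f d)" for f d
  have bdd: "bdd_above (insert 0 (u f ` {d'\<in>D. less d' d}))" if "f \<in> D" for f d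
    using \<rho>_nonneg[OF that] by (auto simp: u_def bdd_above_def intro!: exI[of _ 1])
  have v_upper: "u f d' \<le> v f d" if "f \<in> D" "d' \<in> D" "less d' d" for f d d'
    unfolding v_def using that by (intro cSup_upper bdd) auto
  have v_nonneg: "0 \<le> v f d" if "f \<in> D" for f d
    unfolding v_def using that by (intro cSup_upper bdd) auto
  have u_lip: "u f d \<le> u g d + \<rho> f g" if "f \<in> D" "g \<in> D" "d \<in> D" for f g d
    using triangle[OF that(2,1,3)] sym[OF that(1,2)] \<rho>_nonneg[OF that(1,2)] by (simp add: u_def max_def)
  have v_lip: "v f d \<le> v g d + \<rho> f g" if fg: "f \<in> D" "g \<in> D" for f g d
    unfolding v_def[of f]
  proof (rule cSup_least)
    fix z assume "z \<in> insert 0 (u f ` {d'\<in>D. less d' d})"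
    then show "z \<le> v g d + \<rho> f g"
      using v_nonneg[OF fg(2), of d] \<rho>_nonneg[OF fg] u_lip[OF fg] v_upper[OF fg(2)] by force
  qed simp
  show thesis
  proof (rule that[of w])
    show "0 \<le> w f d" for f d by (simp add: w_def)
    show "\<rho> f d < 1" if "f \<in> D" "d \<in> D" "0 < w f d" for f d
    proof (rule ccontr)
      assume "\<not> \<rho> f d < 1"
      then have "u f d = 0" by (simp add: u_def)
      then show False using that v_nonneg[of f d] by (simp add: w_def)
    qed
    show "\<bar>w f d - w g d\<bar> \<le> 2 * \<rho> f g" if "f \<in> D" "g \<in> D" "d \<in> D" for f g d
    proof -
      have "\<bar>u f d - u g d\<bar> \<le> \<rho> f g" "\<bar>v f d - v g d\<bar> \<le> \<rho> f g"
        using u_lip[OF that] u_lip[OF that(2,1,3)] v_lip[OF that(1,2), of d] v_lip[OF that(2,1), of d]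
          sym[OF that(1,2)] by linarith+
      then show ?thesis unfolding w_def by linarith
    qed
    have max_ex: "\<exists>d\<in>F. \<forall>d'\<in>F. d' = d \<or> less d' d" if "finite F" "F \<noteq> {}" "F \<subseteq> D" for F
      using that
    proof (induction F rule: finite_ne_induct)
      case (insert a F)
      then obtain d where d: "d \<in> F" "\<forall>d'\<in>F. d' = d \<or> less d' d" by auto
      have "a \<in> D" "d \<in> D" using insert.prems d by auto
      then consider "a = d" | "less a d" | "less d a" using total by blast
      then show ?case
      proof cases
        case 3
        then show ?thesis using d trans by (intro bexI[of _ a]) auto
      qed (use d in \<open>auto intro!: bexI[of _ d]\<close>)
    qed simp
    have "sum (w f) F \<le> c" if f: "f \<in> D" and "finite F" "F \<subseteq> D" "0 \<le> c" "\<forall>d\<in>F. u f d \<le> c" for f F c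
      using that(2-)
    proof (induction F arbitrary: c rule: finite_psubset_induct)
      case (psubset F)
      show ?case
      proof (cases "F = {}")
        case False
        then obtain d where d: "d \<in> F" "\<forall>d'\<in>F. d' = d \<or> less d' d"
          using max_ex[OF psubset.hyps False psubset.prems(1)] by blast
        have F: "F - {d} \<subset> F" using d by blast
        have eq: "sum (w f) F = w f d + sum (w f) (F - {d})"
          using d psubset.hyps by (simp add: sum.remove)
        show ?thesis
        proof (cases "u f d \<le> v f d")
          case True
          have "sum (w f) (F - {d}) \<le> c"
            using psubset.prems by (intro psubset.IH[OF F]) auto
          then show ?thesis using True eq by (simp add: w_def)
        next
          case False
          have "\<forall>d'\<in>F - {d}. u f d' \<le> v f d"
            using d(2) psubset.prems(1) v_upper[OF f] by blast
          then have "sum (w f) (F - {d}) \<le> v f d"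
            using psubset.prems(1) v_nonneg[OF f] by (intro psubset.IH[OF F]) auto
          moreover have "u f d \<le> c" using psubset.prems d by blast
          ultimately show ?thesis using False eq by (simp add: w_def)
        qed
      qed (use psubset.prems in simp)
    qed
    then show "sum (w f) F \<le> 1" if "f \<in> D" "finite F" "F \<subseteq> D" for f F
      using that \<rho>_nonneg[OF that(1)] by (auto simp: u_def subset_iff)
    \<comment> \<open>Transfinite induction along the well-ordering: a predecessor whose bump nearly
      attains \<open>v f d\<close> brings its finite set, and adding \<open>d\<close> raises the sum
      to nearly \<open>u f d\<close>.\<close>
    have lower: "\<forall>e>0. \<exists>F. finite F \<and> F \<subseteq> {d'\<in>D. d' = d \<or> less d' d} \<and> u f d - e \<le> sum (w f) F"
      if f: "f \<in> D" and "d \<in> D" for f d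
      using that(2)
    proof (induction d rule: wf_induct_rule[OF wf])
      case (1 d)
      show ?case
      proof (intro allI impI)
        fix e :: real assume e: "0 < e"
        have "\<exists>z\<in>insert 0 (u f ` {d'\<in>D. less d' d}). v f d - e/2 < z"
          using e by (intro less_cSupD) (auto simp: v_def)
        then obtain z where "z \<in> insert 0 (u f ` {d'\<in>D. less d' d})" "v f d - e/2 < z" by blast
        then have z: "z = 0 \<or> (\<exists>d'\<in>D. less d' d \<and> z = u f d')" "v f d - e/2 < z" by auto
        have "\<exists>F. finite F \<and> F \<subseteq> {d'\<in>D. less d' d} \<and> v f d - e \<le> sum (w f) F"
        proof (cases "z = 0")
          case True
          then show ?thesis using z e by (intro exI[of _ "{}"]) auto
        next
          case False
          then obtain d' where d': "d' \<in> D" "less d' d" "z = u f d'" using z by auto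
          have "\<forall>e>0. \<exists>F. finite F \<and> F \<subseteq> {d''\<in>D. d'' = d' \<or> less d'' d'} \<and> u f d' - e \<le> sum (w f) F"
            using 1(1)[OF d'(2)[unfolded less_def] d'(1)] .
          from this[rule_format, of "e/2"] e obtain F where F: "finite F"
            "F \<subseteq> {d''\<in>D. d'' = d' \<or> less d'' d'}" "u f d' - e/2 \<le> sum (w f) F" by auto
          have "F \<subseteq> {d'\<in>D. less d' d}" using F(2) d'(2) trans[of _ d' d] by blast
          moreover have "v f d - e \<le> sum (w f) F" using F(3) d'(3) z(2) by simp
          ultimately show ?thesis using F(1) by blast
        qed
        then obtain F where F: "finite F" "F \<subseteq> {d'\<in>D. less d' d}" "v f d - e \<le> sum (w f) F" by blast
        have "d \<notin> F" using F(2) irrefl by auto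
        then have "sum (w f) (insert d F) = w f d + sum (w f) F" using F(1) by simp
        moreover have "u f d - v f d \<le> w f d" by (simp add: w_def)
        ultimately show "\<exists>F. finite F \<and> F \<subseteq> {d'\<in>D. d' = d \<or> less d' d} \<and> u f d - e \<le> sum (w f) F"
          using F 1(2) by (intro exI[of _ "insert d F"]) auto
      qed
    qed
    show "\<exists>F. finite F \<and> F \<subseteq> D \<and> 1 - e \<le> sum (w f) F" if f: "f \<in> D" and e: "0 < e" for f e
    proof -
      have "u f f = 1" using refl[OF f] by (simp add: u_def)
      then show ?thesis using lower[OF f f] e by fastforce
    qed
  qed
qed

text \<open>Coordinatewise closeness on a finite set carrying mass at least \<open>1 - e\<close> of
  \<open>w\<close> suffices: neither total exceeds 1, so the mass outside that set is at most
  \<open>e\<close> for \<open>w\<close> and \<open>e + card F * \<delta>\<close> for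
  \<open>w'\<close>.\<close>

lemma weights_l1_continuous:
  fixes w w' :: "'i \<Rightarrow> real"
  assumes nonneg: "\<And>d. 0 \<le> w d" "\<And>d. 0 \<le> w' d"
    and le1: "\<And>G. finite G \<Longrightarrow> G \<subseteq> D \<Longrightarrow> sum w G \<le> 1" "\<And>G. finite G \<Longrightarrow> G \<subseteq> D \<Longrightarrow> sum w' G \<le> 1"
    and F: "finite F" "F \<subseteq> D" "1 - e \<le> sum w F"
    and close: "\<And>d. d \<in> F \<Longrightarrow> \<bar>w d - w' d\<bar> \<le> \<delta>"
    and G: "finite G" "G \<subseteq> D"
  shows "(\<Sum>d\<in>G. \<bar>w d - w' d\<bar>) \<le> 2 * e + 2 * real (card F) * \<delta>"
proof -
  have split: "sum g (G \<union> F) = sum g F + sum g (G - F)" for g :: "'i \<Rightarrow> real"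
    using F(1) G(1) by (metis Diff_disjoint Un_Diff_cancel Un_commute finite_Diff sum.union_disjoint)
  have "(\<Sum>d\<in>G. \<bar>w d - w' d\<bar>) \<le> (\<Sum>d\<in>G \<union> F. \<bar>w d - w' d\<bar>)"
    using F G by (intro sum_mono2) auto
  also have "\<dots> = (\<Sum>d\<in>F. \<bar>w d - w' d\<bar>) + (\<Sum>d\<in>G - F. \<bar>w d - w' d\<bar>)" by (rule split)
  also have "(\<Sum>d\<in>G - F. \<bar>w d - w' d\<bar>) \<le> (\<Sum>d\<in>G - F. w d + w' d)"
    by (intro sum_mono) (smt (verit) nonneg)
  also have "\<dots> = sum w (G - F) + sum w' (G - F)" by (rule sum.distrib)
  also have "sum w (G - F) \<le> e"
    using le1(1)[of "G \<union> F"] F G split[of w] by auto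
  also have "sum w' (G - F) \<le> e + real (card F) * \<delta>"
  proof -
    have "sum w F - sum w' F \<le> (\<Sum>d\<in>F. \<delta>)"
      unfolding sum_subtractf[symmetric] using close by (intro sum_mono) (auto simp: abs_le_iff)
    then show ?thesis using le1(2)[of "G \<union> F"] F G split[of w'] by auto
  qed
  also have "(\<Sum>d\<in>F. \<bar>w d - w' d\<bar>) \<le> real (card F) * \<delta>"
    using close by (rule sum_bounded_above)
  finally show ?thesis by (simp add: mult.commute)
qed

section \<open>Functions that factor through the base, exactly or approximately\<close>

context fully_closed_map
begin

text \<open>In general discontinuous, so composing with it leads from \<open>Cspace X\<close> only
  to bounded functions on \<open>Y\<close>.\<close>

definition section_of :: "'b \<Rightarrow> 'a" where
  "section_of y = (SOME x. x \<in> fibre y)"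

lemma section_of: "y \<in> topspace Y \<Longrightarrow> section_of y \<in> fibre y"
  unfolding section_of_def using fibre_ne[of y] by (simp add: some_in_eq)

lemma in_fibre: "x \<in> topspace X \<Longrightarrow> x \<in> fibre (p x)"
  by (simp add: fibre_def)

lemma pullback_Cspace:
  assumes "g \<in> Cspace Y"
  shows "(\<lambda>x. if x \<in> topspace X then g (p x) else 0) \<in> Cspace X"
proof -
  have "continuous_map X euclideanreal (g \<circ> p)"
    using p_continuous assms by (intro continuous_map_compose) (auto simp: Cspace_def)
  then show ?thesis
    unfolding Cspace_def by (auto intro: continuous_map_eq)
qed

text \<open>Vanishing oscillation gives a factor on points; it is continuous because a continuous
  surjection from a compact space onto a Hausdorff space is a quotient map.\<close>

lemma factor_through_base:
  assumes f: "f \<in> Cspace X" and "\<And>y. y \<in> topspace Y \<Longrightarrow> osc y f \<le> 0"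
  obtains g where "g \<in> Cspace Y" "\<And>x. x \<in> topspace X \<Longrightarrow> f x = g (p x)"
proof -
  define g where "g y = (if y \<in> topspace Y then f (section_of y) else 0)" for y
  have eq: "f x = g (p x)" if x: "x \<in> topspace X" for x
    using osc_upper[OF f in_fibre[OF x] section_of[OF p_in[OF x]]] assms(2)[OF p_in[OF x]] p_in[OF x]
    by (simp add: g_def)
  have "quotient_map X Y p"
    by (rule continuous_imp_quotient_map[OF p_continuous X(1) Y(2) p_surj])
  moreover have "continuous_map X euclideanreal (g \<circ> p)"
    using f eq by (auto simp: Cspace_def intro: continuous_map_eq)
  ultimately have "continuous_map Y euclideanreal g"
    by (rule continuous_compose_quotient_map)
  then show thesis using eq by (intro that[of g]) (auto simp: Cspace_def g_def)
qed

text \<open>The values \<open>f (section_of y)\<close> are averaged with a partition of unity on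
  \<open>Y\<close>. On the fibres over a neighbourhood of \<open>y\<close>, \<open>f\<close> stays
  within \<open>r\<close> of \<open>f (section_of y)\<close>, because the points where it does not
  form a closed set whose image is closed and misses \<open>y\<close>.\<close>

lemma approx_by_base:
  assumes f: "f \<in> Cspace X" and r: "\<And>y. y \<in> topspace Y \<Longrightarrow> osc y f < r"
  obtains g where "g \<in> Cspace Y" "\<And>x. x \<in> topspace X \<Longrightarrow> \<bar>f x - g (p x)\<bar> \<le> r"
proof -
  have cont: "continuous_map X euclideanreal f" using f by (simp add: Cspace_def)
  define E where "E y = {x \<in> topspace X. \<bar>f x - f (section_of y)\<bar> \<in> {r..}}" for y
  have "closedin X (E y)" for y
    unfolding E_def by (rule closedin_continuous_map_preimage[of X euclideanreal])
      (auto intro!: continuous_intros cont)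
  then have clE: "closedin Y (p ` E y)" for y
    using continuous_imp_closed_map[OF p_continuous X(1) Y(2)] by (simp add: closed_map_def)
  have "\<exists>u. continuous_map Y euclideanreal u \<and> (\<forall>z\<in>topspace Y. 0 \<le> u z) \<and> u y = 1 \<and> (\<forall>z\<in>p ` E y. u z = 0)"
    if y: "y \<in> topspace Y" for y
  proof -
    have "y \<notin> p ` E y"
      using osc_upper[OF f _ section_of[OF y]] r[OF y] by (force simp: E_def fibre_def)
    moreover have "normal_space Y"
      using Y compact_Hausdorff_or_regular_imp_normal_space by blast
    moreover have "closedin Y {y}"
      using y Hausdorff_imp_t1_space[OF Y(2)] by (simp add: closedin_t1_singleton)
    ultimately obtain u where u: "continuous_map Y euclideanreal u" "u ` (p ` E y) \<subseteq> {0}" "u ` {y} \<subseteq> {1}"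
      using Urysohn_lemma_alt[of Y "p ` E y" "{y}" 0 1] clE[of y] by (auto simp: disjnt_def)
    \<comment> \<open>The absolute value makes the Urysohn function nonnegative without altering the
      values 0 and 1.\<close>
    then show ?thesis
      by (intro exI[of _ "\<lambda>z. \<bar>u z\<bar>"]) (auto intro!: continuous_intros)
  qed
  then have "\<exists>u. \<forall>y\<in>topspace Y. continuous_map Y euclideanreal (u y) \<and> (\<forall>z\<in>topspace Y. 0 \<le> u y z) \<and>
      u y y = 1 \<and> (\<forall>z\<in>p ` E y. u y z = 0)"
    by (intro bchoice ballI)
  then obtain u where u: "\<And>y. y \<in> topspace Y \<Longrightarrow> continuous_map Y euclideanreal (u y)"
    "\<And>y z. y \<in> topspace Y \<Longrightarrow> z \<in> topspace Y \<Longrightarrow> 0 \<le> u y z"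
    "\<And>y. y \<in> topspace Y \<Longrightarrow> u y y = 1" "\<And>y z. y \<in> topspace Y \<Longrightarrow> z \<in> p ` E y \<Longrightarrow> u y z = 0"
    by blast
  define U where "U y = {z \<in> topspace Y. u y z \<in> {0<..}}" for y
  have "openin Y (U y)" if "y \<in> topspace Y" for y
    unfolding U_def by (rule openin_continuous_map_preimage[OF u(1)[OF that]]) simp
  moreover have "topspace Y \<subseteq> \<Union> (U ` topspace Y)"
    using u(3) by (fastforce simp: U_def)
  ultimately obtain \<F> where \<F>: "finite \<F>" "\<F> \<subseteq> U ` topspace Y" "topspace Y \<subseteq> \<Union> \<F>"
    using Y(1) unfolding compact_space_alt by (metis (no_types, lifting) imageE)
  then obtain T where T: "finite T" "T \<subseteq> topspace Y" "\<F> = U ` T"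
    by (meson finite_subset_image)
  define s where "s z = (\<Sum>y\<in>T. u y z)" for z
  have s: "0 < s z" if z: "z \<in> topspace Y" for z
  proof -
    obtain y where "y \<in> T" "0 < u y z" using \<F>(3) T(3) z by (auto simp: U_def)
    then show ?thesis unfolding s_def using T z u(2) by (intro sum_pos2[of T y]) auto
  qed
  define g where "g z = (if z \<in> topspace Y then (\<Sum>y\<in>T. u y z * f (section_of y)) / s z else 0)" for z
  have "continuous_map Y euclideanreal (\<lambda>z. (\<Sum>y\<in>T. u y z * f (section_of y)) / s z)"
  proof (rule continuous_map_real_divide)
    show "continuous_map Y euclideanreal (\<lambda>z. \<Sum>y\<in>T. u y z * f (section_of y))"
      using T u(1) by (intro continuous_map_sum continuous_map_real_mult_right) auto
    show "continuous_map Y euclideanreal s"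
      unfolding s_def[abs_def] using T u(1) by (intro continuous_map_sum) auto
    show "\<And>z. z \<in> topspace Y \<Longrightarrow> s z \<noteq> 0" using s by fastforce
  qed
  then have "continuous_map Y euclideanreal g"
    by (rule continuous_map_eq) (simp add: g_def)
  then have "g \<in> Cspace Y" by (simp add: Cspace_def g_def)
  moreover have "\<bar>f x - g (p x)\<bar> \<le> r" if x: "x \<in> topspace X" for x
  proof -
    note px = p_in[OF x]
    have bound: "\<bar>u y (p x) * (f x - f (section_of y))\<bar> \<le> u y (p x) * r" if y: "y \<in> T" for y
    proof (cases "x \<in> E y")
      case True
      then show ?thesis using u(4)[of y "p x"] y T by auto
    next
      case False
      then have "\<bar>f x - f (section_of y)\<bar> \<le> r" using x by (simp add: E_def)
      then show ?thesis using u(2)[of y "p x"] y T px by (auto simp: abs_mult intro!: mult_left_mono)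
    qed
    have "f x - g (p x) = (\<Sum>y\<in>T. u y (p x) * (f x - f (section_of y))) / s (p x)"
      using s[OF px] px
      by (simp add: g_def right_diff_distrib sum_subtractf sum_distrib_right[symmetric] s_def[symmetric] diff_divide_distrib)
    also have "\<bar>\<dots>\<bar> = \<bar>\<Sum>y\<in>T. u y (p x) * (f x - f (section_of y))\<bar> / s (p x)"
      using s[OF px] by simp
    also have "\<dots> \<le> (\<Sum>y\<in>T. u y (p x) * r) / s (p x)"
      using bound s[OF px] by (intro divide_right_mono order_trans[OF sum_abs sum_mono]) auto
    also have "\<dots> = r" using s[OF px] by (simp add: sum_distrib_right[symmetric] s_def[symmetric])
    finally show ?thesis .
  qed
  ultimately show thesis by (rule that)
qed

end

lemma has_sum_real_diff:
  fixes a b :: "'i \<Rightarrow> real"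
  assumes "(a has_sum s) D" "(b has_sum t) D"
  shows "((\<lambda>d. a d - b d) has_sum (s - t)) D"
  using has_sum_add[OF assms(1), of "\<lambda>d. - b d" "- t"] assms(2) by (simp add: has_sum_uminus)

section \<open>The quotient of C(X) by C(Y) and its continuous lifting\<close>

context fully_closed_map
begin

text \<open>Up to a factor 2 this is the distance from the copy of \<open>Cspace Y\<close> in
  \<open>Cspace X\<close>, by \<open>approx_by_base\<close> and \<open>max_osc_le_close\<close>. The
  inserted 0 is the value for empty \<open>Y\<close>.\<close>

definition max_osc :: "('a \<Rightarrow> real) \<Rightarrow> real" where
  "max_osc f = Sup (insert 0 ((\<lambda>y. osc y f) ` topspace Y))"

lemma bdd_max_osc: "f \<in> Cspace X \<Longrightarrow> bdd_above (insert 0 ((\<lambda>y. osc y f) ` topspace Y))"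
  using osc_le_supnorm[of f] by (auto simp: bdd_above_def intro!: exI[of _ "max 0 (2 * supnorm X f)"] le_max_iff_disj[THEN iffD2])

lemma osc_le_max_osc: "f \<in> Cspace X \<Longrightarrow> y \<in> topspace Y \<Longrightarrow> osc y f \<le> max_osc f"
  unfolding max_osc_def by (intro cSup_upper bdd_max_osc) auto

lemma max_osc_nonneg: "f \<in> Cspace X \<Longrightarrow> 0 \<le> max_osc f"
  unfolding max_osc_def by (intro cSup_upper bdd_max_osc) auto

lemma max_osc_least: "0 \<le> c \<Longrightarrow> (\<And>y. y \<in> topspace Y \<Longrightarrow> osc y f \<le> c) \<Longrightarrow> max_osc f \<le> c"
  unfolding max_osc_def by (intro cSup_least) auto

lemma max_osc_comb:
  assumes "f \<in> Cspace X" "g \<in> Cspace X"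
  shows "max_osc (\<lambda>x. a * f x + b * g x) \<le> \<bar>a\<bar> * max_osc f + \<bar>b\<bar> * max_osc g"
proof (rule max_osc_least)
  fix y assume y: "y \<in> topspace Y"
  show "osc y (\<lambda>x. a * f x + b * g x) \<le> \<bar>a\<bar> * max_osc f + \<bar>b\<bar> * max_osc g"
    using osc_le_max_osc[OF assms(1) y] osc_le_max_osc[OF assms(2) y]
    by (intro order_trans[OF osc_comb[OF assms y]] add_mono mult_left_mono) auto
qed (use max_osc_nonneg assms in auto)

lemma max_osc_scale: "f \<in> Cspace X \<Longrightarrow> max_osc (\<lambda>x. a * f x) \<le> \<bar>a\<bar> * max_osc f"
  using max_osc_comb[of f f a 0] by simp

lemma max_osc_diff_commute:
  "f \<in> Cspace X \<Longrightarrow> g \<in> Cspace X \<Longrightarrow> max_osc (\<lambda>x. f x - g x) = max_osc (\<lambda>x. g x - f x)"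
  using max_osc_scale[OF Cspace_diff[of f X g], of "-1"] max_osc_scale[OF Cspace_diff[of g X f], of "-1"]
  by simp

lemma max_osc_diff_triangle:
  assumes "f \<in> Cspace X" "g \<in> Cspace X" "h \<in> Cspace X"
  shows "max_osc (\<lambda>x. f x - h x) \<le> max_osc (\<lambda>x. f x - g x) + max_osc (\<lambda>x. g x - h x)"
  using max_osc_comb[OF Cspace_diff[OF assms(1,2)] Cspace_diff[OF assms(2,3)], of 1 1] by simp

lemma max_osc_triangle:
  assumes "f \<in> Cspace X" "g \<in> Cspace X"
  shows "max_osc f \<le> max_osc g + max_osc (\<lambda>x. f x - g x)"
  using max_osc_comb[OF assms(2) Cspace_diff[OF assms(1,2)], of 1 1] by simp

lemma max_osc_le_close:
  assumes "0 \<le> c" "\<And>x. x \<in> topspace X \<Longrightarrow> \<bar>f x - g x\<bar> \<le> c"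
  shows "max_osc (\<lambda>x. f x - g x) \<le> 2 * c"
  using assms fibre_subset by (intro max_osc_least osc_le_close) auto

text \<open>Each centre \<open>d\<close> gets some lift \<open>l d\<close> that differs from
  \<open>d\<close> by a function on the base and is bounded by \<open>max_osc d + 1\<close>.
  Averaging these lifts with weights supported on centres within distance 1 of \<open>f\<close>
  costs at most 1 of oscillation, and the average is continuous in \<open>f\<close> because the
  weights are continuous in the l1-norm.\<close>

lemma almost_lift_exists:
  obtains P where "\<And>f. f \<in> Cspace X \<Longrightarrow> P f \<in> Cspace X"
    "\<And>f x. f \<in> Cspace X \<Longrightarrow> \<bar>P f x\<bar> \<le> max_osc f + 2"
    "\<And>f y. f \<in> Cspace X \<Longrightarrow> y \<in> topspace Y \<Longrightarrow> osc y (\<lambda>x. f x - P f x) \<le> 1"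
    "\<And>f e. f \<in> Cspace X \<Longrightarrow> 0 < e \<Longrightarrow> \<exists>\<delta>>0. \<forall>h\<in>Cspace X.
      max_osc (\<lambda>x. f x - h x) < \<delta> \<longrightarrow> (\<forall>x. \<bar>P f x - P h x\<bar> \<le> e)"
proof -
  let ?C = "Cspace X"
  have "\<exists>l\<in>?C. (\<forall>y\<in>topspace Y. \<forall>x\<in>fibre y. \<forall>x'\<in>fibre y. l x - l x' = d x - d x') \<and>
      (\<forall>x. \<bar>l x\<bar> \<le> max_osc d + 1)" if d: "d \<in> ?C" for d
  proof -
    have "osc y d < max_osc d + 1" if "y \<in> topspace Y" for y
      using osc_le_max_osc[OF d that] by simp
    then obtain g where g: "g \<in> Cspace Y" "\<And>x. x \<in> topspace X \<Longrightarrow> \<bar>d x - g (p x)\<bar> \<le> max_osc d + 1"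
      using approx_by_base[OF d] by blast
    define l where "l x = d x - (if x \<in> topspace X then g (p x) else 0)" for x
    have "l \<in> ?C" unfolding l_def by (rule Cspace_diff[OF d pullback_Cspace[OF g(1)]])
    moreover have "l x - l x' = d x - d x'" if "x \<in> fibre y" "x' \<in> fibre y" for x x' y
      using that by (simp add: l_def fibre_def)
    moreover have "\<bar>l x\<bar> \<le> max_osc d + 1" for x
      using g(2)[of x] d max_osc_nonneg[OF d] by (auto simp: l_def Cspace_def)
    ultimately show ?thesis by blast
  qed
  then have "\<exists>l. \<forall>d\<in>?C. l d \<in> ?C \<and> (\<forall>y\<in>topspace Y. \<forall>x\<in>fibre y. \<forall>x'\<in>fibre y. l d x - l d x' = d x - d x') \<and>
      (\<forall>x. \<bar>l d x\<bar> \<le> max_osc d + 1)"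
    by (intro bchoice ballI) blast
  then obtain l where l: "\<And>d. d \<in> ?C \<Longrightarrow> l d \<in> ?C"
    "\<And>d y x x'. d \<in> ?C \<Longrightarrow> y \<in> topspace Y \<Longrightarrow> x \<in> fibre y \<Longrightarrow> x' \<in> fibre y \<Longrightarrow> l d x - l d x' = d x - d x'"
    "\<And>d x. d \<in> ?C \<Longrightarrow> \<bar>l d x\<bar> \<le> max_osc d + 1"
    by blast
  obtain w where w0: "\<And>f d. 0 \<le> w f d"
    and w_near: "\<And>f d. f \<in> ?C \<Longrightarrow> d \<in> ?C \<Longrightarrow> 0 < w f d \<Longrightarrow> max_osc (\<lambda>x. f x - d x) < 1"
    and w_lip: "\<And>f g d. f \<in> ?C \<Longrightarrow> g \<in> ?C \<Longrightarrow> d \<in> ?C \<Longrightarrow> \<bar>w f d - w g d\<bar> \<le> 2 * max_osc (\<lambda>x. f x - g x)"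
    and w_le: "\<And>f F. f \<in> ?C \<Longrightarrow> finite F \<Longrightarrow> F \<subseteq> ?C \<Longrightarrow> sum (w f) F \<le> 1"
    and w_ge: "\<And>f e. f \<in> ?C \<Longrightarrow> 0 < e \<Longrightarrow> \<exists>F. finite F \<and> F \<subseteq> ?C \<and> 1 - e \<le> sum (w f) F"
  proof (rule pseudometric_partition_of_unity[of ?C "\<lambda>f g. max_osc (\<lambda>x. f x - g x)"])
    show "max_osc (\<lambda>x. f x - f x) = 0" if "f \<in> ?C" for f
      using max_osc_scale[OF that, of 0] max_osc_nonneg[OF Cspace_zero] by simp
  qed (use max_osc_diff_commute max_osc_diff_triangle in \<open>assumption | blast\<close>)+
  \<comment> \<open>A positive weight places \<open>d\<close> within 1 of \<open>f\<close>, which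
    turns the bound on \<open>l d\<close> into one depending on \<open>f\<close> alone.\<close>
  have l_bound: "\<bar>l d x\<bar> \<le> max_osc f + 2" if "f \<in> ?C" "d \<in> ?C" "0 < w f d" for f d x
    using l(3)[OF that(2), of x] w_near[OF that] max_osc_triangle[OF that(2,1)] max_osc_diff_commute[OF that(1,2)]
    by linarith
  have w_sum: "(w f has_sum 1) ?C" if f: "f \<in> ?C" for f
    unfolding has_sum_def tendsto_iff eventually_finite_subsets_at_top
  proof (intro allI impI)
    fix e :: real assume e: "0 < e"
    then obtain F where F: "finite F" "F \<subseteq> ?C" "1 - e/2 \<le> sum (w f) F"
      using w_ge[OF f, of "e/2"] by auto
    have "dist (sum (w f) G) 1 < e" if "finite G" "F \<subseteq> G" "G \<subseteq> ?C" for G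
      using sum_mono2[of G F "w f"] w_le[OF f that(1,3)] F e w0 that by (simp add: dist_real_def)
    with F show "\<exists>F. finite F \<and> F \<subseteq> ?C \<and> (\<forall>G. finite G \<and> F \<subseteq> G \<and> G \<subseteq> ?C \<longrightarrow> dist (sum (w f) G) 1 < e)"
      by blast
  qed
  define P where "P f x = (\<Sum>\<^sub>\<infinity>d\<in>?C. w f d * l d x)" for f x
  have P_sum: "((\<lambda>d. w f d * l d x) has_sum P f x) ?C" if f: "f \<in> ?C" for f x
    unfolding P_def
  proof (rule has_sum_infsum, rule Infinite_Sum.abs_summable_summable, rule Infinite_Sum.abs_summable_on_comparison_test')
    show "(\<lambda>d. w f d * (max_osc f + 2)) summable_on ?C"
      by (rule summable_on_cmult_left[OF has_sum_imp_summable[OF w_sum[OF f]]])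
    show "norm (w f d * l d x) \<le> w f d * (max_osc f + 2)" if "d \<in> ?C" for d
    proof (cases "w f d = 0")
      case False
      then have "0 < w f d" using w0[of f d] by simp
      then show ?thesis using l_bound[OF f that, of x] by (simp add: abs_mult mult_left_mono)
    qed simp
  qed
  have partial_bound: "\<bar>\<Sum>d\<in>G. a d * l d x\<bar> \<le> c * (\<Sum>d\<in>G. \<bar>a d\<bar>)"
    if "\<And>d. d \<in> G \<Longrightarrow> a d \<noteq> 0 \<Longrightarrow> \<bar>l d x\<bar> \<le> c" for G c x and a :: "('a \<Rightarrow> real) \<Rightarrow> real"
  proof -
    have "\<bar>\<Sum>d\<in>G. a d * l d x\<bar> \<le> (\<Sum>d\<in>G. \<bar>a d\<bar> * c)"
    proof (rule order_trans[OF sum_abs sum_mono])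
      fix d assume "d \<in> G"
      then show "\<bar>a d * l d x\<bar> \<le> \<bar>a d\<bar> * c"
        using that[of d] by (cases "a d = 0") (auto simp: abs_mult mult_left_mono)
    qed
    then show ?thesis by (simp add: sum_distrib_left mult.commute)
  qed
  have P_C: "P f \<in> ?C" if f: "f \<in> ?C" for f
  proof (rule Cspace_uniform_limit)
    fix e :: real assume e: "0 < e"
    define c where "c = max_osc f + 2"
    have c: "0 < c" using max_osc_nonneg[OF f] by (simp add: c_def)
    obtain F where F: "finite F" "F \<subseteq> ?C" "1 - e / (2 * c) \<le> sum (w f) F"
      using w_ge[OF f, of "e / (2 * c)"] e c by auto
    \<comment> \<open>Beyond \<open>F\<close> at most \<open>e / (2 * c)\<close> of the mass
      remains, whatever the point \<open>x\<close>, so the finite sums converge uniformly.\<close>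
    have close: "\<bar>P f x - (\<Sum>d\<in>F. w f d * l d x)\<bar> \<le> e/2" for x
    proof (rule has_sum_dist_le[OF P_sum[OF f] F(1,2)])
      fix G assume G: "finite G" "F \<subseteq> G" "G \<subseteq> ?C"
      have split: "sum g G = sum g F + sum g (G - F)" for g :: "('a \<Rightarrow> real) \<Rightarrow> real"
        using sum.subset_diff[OF G(2,1), of g] by simp
      have "\<bar>(\<Sum>d\<in>G. w f d * l d x) - (\<Sum>d\<in>F. w f d * l d x)\<bar> = \<bar>\<Sum>d\<in>G - F. w f d * l d x\<bar>"
        unfolding split[of "\<lambda>d. w f d * l d x"] by simp
      also have "\<dots> \<le> c * (\<Sum>d\<in>G - F. \<bar>w f d\<bar>)"
      proof (rule partial_bound)
        fix d assume "d \<in> G - F" "w f d \<noteq> 0"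
        then show "\<bar>l d x\<bar> \<le> c" using l_bound[OF f, of d x] w0[of f d] G by (auto simp: c_def)
      qed
      also have "(\<Sum>d\<in>G - F. \<bar>w f d\<bar>) \<le> e / (2 * c)"
        using split[of "w f"] w_le[OF f G(1,3)] F(3) w0 by simp
      finally show "\<bar>(\<Sum>d\<in>G. w f d * l d x) - (\<Sum>d\<in>F. w f d * l d x)\<bar> \<le> e/2"
        using c by (simp add: mult_left_mono)
    qed
    have "(\<lambda>x. \<Sum>d\<in>F. w f d * l d x) \<in> ?C"
      using F by (intro Cspace_sum Cspace_scale l(1)) auto
    then show "\<exists>g\<in>?C. \<forall>x\<in>topspace X. \<bar>P f x - g x\<bar> < e"
      using e by (intro bexI[of _ "\<lambda>x. \<Sum>d\<in>F. w f d * l d x"] ballI le_less_trans[OF close]) auto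
  next
    fix x assume "x \<notin> topspace X"
    then have "l d x = 0" if "d \<in> ?C" for d using l(1)[OF that] by (simp add: Cspace_def)
    then have "P f x = (\<Sum>\<^sub>\<infinity>d\<in>?C. 0)" unfolding P_def by (intro infsum_cong) simp
    then show "P f x = 0" by simp
  qed
  have P_bound: "\<bar>P f x\<bar> \<le> max_osc f + 2" if f: "f \<in> ?C" for f x
  proof -
    have "\<bar>P f x - 0\<bar> \<le> max_osc f + 2"
    proof (rule has_sum_dist_le[OF P_sum[OF f], of "{}"])
      fix G assume G: "finite G" "G \<subseteq> ?C"
      have "\<bar>\<Sum>d\<in>G. w f d * l d x\<bar> \<le> (max_osc f + 2) * (\<Sum>d\<in>G. \<bar>w f d\<bar>)"
      proof (rule partial_bound)
        fix d assume "d \<in> G" "w f d \<noteq> 0"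
        then show "\<bar>l d x\<bar> \<le> max_osc f + 2" using l_bound[OF f, of d x] w0[of f d] G by auto
      qed
      also have "\<dots> \<le> (max_osc f + 2) * 1"
        using w_le[OF f G] w0 max_osc_nonneg[OF f] by (intro mult_left_mono) auto
      finally show "\<bar>(\<Sum>d\<in>G. w f d * l d x) - 0\<bar> \<le> max_osc f + 2" by simp
    qed auto
    then show ?thesis by simp
  qed
  have P_osc: "osc y (\<lambda>x. f x - P f x) \<le> 1" if f: "f \<in> ?C" and y: "y \<in> topspace Y" for f y
  proof (rule osc_least[OF y])
    fix x x' assume x: "x \<in> fibre y" "x' \<in> fibre y"
    have sum: "((\<lambda>d. w f d * (f x - f x') - (w f d * l d x - w f d * l d x')) has_sum
        (1 * (f x - f x') - (P f x - P f x'))) ?C"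
      by (intro has_sum_real_diff has_sum_cmult_left w_sum P_sum f)
    have "\<bar>1 * (f x - f x') - (P f x - P f x') - 0\<bar> \<le> 1"
    proof (rule has_sum_dist_le[OF sum, of "{}"])
      fix G assume G: "finite G" "G \<subseteq> ?C"
      have "\<bar>\<Sum>d\<in>G. w f d * (f x - f x') - (w f d * l d x - w f d * l d x')\<bar> \<le> (\<Sum>d\<in>G. w f d)"
      proof (rule order_trans[OF sum_abs sum_mono])
        fix d assume "d \<in> G"
        then have d: "d \<in> ?C" using G by auto
        have eq: "w f d * (f x - f x') - (w f d * l d x - w f d * l d x') = w f d * ((f x - d x) - (f x' - d x'))"
        proof -
          have "w f d * (f x - f x') - (w f d * l d x - w f d * l d x') = w f d * ((f x - f x') - (l d x - l d x'))"
            by (simp add: algebra_simps)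
          then show ?thesis unfolding l(2)[OF d y x] by simp
        qed
        show "\<bar>w f d * (f x - f x') - (w f d * l d x - w f d * l d x')\<bar> \<le> w f d"
        proof (cases "w f d = 0")
          case False
          then have "0 < w f d" using w0[of f d] by simp
          then have "\<bar>(f x - d x) - (f x' - d x')\<bar> \<le> 1"
            using osc_upper[OF Cspace_diff[OF f d] x] osc_le_max_osc[OF Cspace_diff[OF f d] y] w_near[OF f d]
            by linarith
          then show ?thesis unfolding eq using w0[of f d] by (simp add: abs_mult mult_left_le)
        qed simp
      qed
      also have "\<dots> \<le> 1" by (rule w_le[OF f G])
      finally show "\<bar>(\<Sum>d\<in>G. w f d * (f x - f x') - (w f d * l d x - w f d * l d x')) - 0\<bar> \<le> 1" by simp
    qed auto
    then show "f x - P f x - (f x' - P f x') \<le> 1" by (simp add: abs_le_iff)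
  qed
  have P_cont: "\<exists>\<delta>>0. \<forall>h\<in>?C. max_osc (\<lambda>x. f x - h x) < \<delta> \<longrightarrow> (\<forall>x. \<bar>P f x - P h x\<bar> \<le> e)"
    if f: "f \<in> ?C" and e: "0 < e" for f e
  proof -
    \<comment> \<open>One more than the bound in \<open>l_bound\<close> at \<open>f\<close>: it also
      covers the centres that carry weight at a nearby \<open>h\<close>, for which
      \<open>max_osc h \<le> max_osc f + 1\<close>.\<close>
    define c where "c = max_osc f + 3"
    have c: "0 < c" using max_osc_nonneg[OF f] by (simp add: c_def)
    define e' where "e' = e / (4 * c)"
    have e': "0 < e'" using e c by (simp add: e'_def)
    obtain F where F: "finite F" "F \<subseteq> ?C" "1 - e' \<le> sum (w f) F"
      using w_ge[OF f e'] by auto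
    define \<delta> where "\<delta> = min 1 (e' / (2 * (real (card F) + 1)))"
    have \<delta>: "0 < \<delta>" "\<delta> \<le> 1" using e' by (auto simp: \<delta>_def)
    have \<delta>': "2 * real (card F) * (2 * \<delta>) \<le> 2 * e'"
    proof -
      have "\<delta> \<le> e' / (2 * (real (card F) + 1))" by (simp add: \<delta>_def)
      then have "\<delta> * (2 * (real (card F) + 1)) \<le> e'" by (simp add: field_simps)
      then show ?thesis using \<delta> by (simp add: algebra_simps)
    qed
    have "\<bar>P f x - P h x\<bar> \<le> e" if h: "h \<in> ?C" and near: "max_osc (\<lambda>x. f x - h x) < \<delta>" for h x
    proof -
      have sum: "((\<lambda>d. w f d * l d x - w h d * l d x) has_sum (P f x - P h x)) ?C"
        by (intro has_sum_real_diff P_sum f h)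
      have h_le: "max_osc h \<le> max_osc f + 1"
        using max_osc_triangle[OF h f] max_osc_diff_commute[OF f h] near \<delta>(2) by linarith
      have "\<bar>P f x - P h x - 0\<bar> \<le> e"
      proof (rule has_sum_dist_le[OF sum, of "{}"])
        fix G assume G: "finite G" "G \<subseteq> ?C"
        have "(\<Sum>d\<in>G. w f d * l d x - w h d * l d x) = (\<Sum>d\<in>G. (w f d - w h d) * l d x)"
          by (simp add: left_diff_distrib)
        also have "\<bar>\<dots>\<bar> \<le> c * (\<Sum>d\<in>G. \<bar>w f d - w h d\<bar>)"
        proof (rule partial_bound)
          fix d assume "d \<in> G" "w f d - w h d \<noteq> 0"
          then have "d \<in> ?C" "0 < w f d \<or> 0 < w h d" using w0[of f d] w0[of h d] G by auto
          then show "\<bar>l d x\<bar> \<le> c"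
            using l_bound[OF f, of d x] l_bound[OF h, of d x] h_le by (auto simp: c_def)
        qed
        also have "(\<Sum>d\<in>G. \<bar>w f d - w h d\<bar>) \<le> 2 * e' + 2 * real (card F) * (2 * \<delta>)"
        proof (rule weights_l1_continuous[OF w0 w0 w_le[OF f] w_le[OF h] F _ G])
          fix d assume "d \<in> F"
          then show "\<bar>w f d - w h d\<bar> \<le> 2 * \<delta>" using w_lip[OF f h, of d] near F by auto
        qed auto
        also have "\<dots> \<le> 4 * e'" using \<delta>' by simp
        finally show "\<bar>(\<Sum>d\<in>G. w f d * l d x - w h d * l d x) - 0\<bar> \<le> e"
          using c by (simp add: e'_def mult_left_mono)
      qed auto
      then show ?thesis by simp
    qed
    then show ?thesis using \<delta>(1) by blast
  qed
  show thesis
    by (rule that[of P]) (fact P_C P_bound P_osc P_cont)+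
qed

text \<open>A Bartle--Graves selection for the quotient map of \<open>C(X)\<close> modulo \<open>C(Y)\<close>, obtained by correcting
  the almost lift at the scales \<open>2\<^sup>-\<^sup>j\<close>.\<close>

lemma lift_exists:
  obtains B where "\<And>f. f \<in> Cspace X \<Longrightarrow> B f \<in> Cspace X"
    "\<And>f. f \<in> Cspace X \<Longrightarrow> \<exists>g\<in>Cspace Y. \<forall>x\<in>topspace X. f x - B f x = g (p x)"
    "\<And>f x. f \<in> Cspace X \<Longrightarrow> \<bar>B f x\<bar> \<le> 2 * (max_osc f + 4)"
    "\<And>f e. f \<in> Cspace X \<Longrightarrow> 0 < e \<Longrightarrow> \<exists>\<delta>>0. \<forall>h\<in>Cspace X.
      max_osc (\<lambda>x. f x - h x) < \<delta> \<longrightarrow> (\<forall>x. \<bar>B f x - B h x\<bar> \<le> e)"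
proof -
  let ?C = "Cspace X"
  obtain P where P_C: "\<And>f. f \<in> ?C \<Longrightarrow> P f \<in> ?C"
    and P_bound: "\<And>f x. f \<in> ?C \<Longrightarrow> \<bar>P f x\<bar> \<le> max_osc f + 2"
    and P_osc: "\<And>f y. f \<in> ?C \<Longrightarrow> y \<in> topspace Y \<Longrightarrow> osc y (\<lambda>x. f x - P f x) \<le> 1"
    and P_cont: "\<And>f e. f \<in> ?C \<Longrightarrow> 0 < e \<Longrightarrow> \<exists>\<delta>>0. \<forall>h\<in>?C.
      max_osc (\<lambda>x. f x - h x) < \<delta> \<longrightarrow> (\<forall>x. \<bar>P f x - P h x\<bar> \<le> e)"
    by (rule almost_lift_exists) blast
  \<comment> \<open>Multiplying by \<open>2^j\<close> before \<open>P\<close> and dividing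
    afterwards turns the error 1 of \<open>P\<close> into \<open>1/2^j\<close>.\<close>
  define \<Delta> where "\<Delta> j r = (\<lambda>x. (1/2^j) * P (\<lambda>x. 2^j * r x) x)" for j :: nat and r
  define R where "R f = rec_nat f (\<lambda>j r. (\<lambda>x. r x - \<Delta> j r x))" for f
  have R0: "R f 0 = f" and RS: "R f (Suc j) = (\<lambda>x. R f j x - \<Delta> j (R f j) x)" for f j
    by (simp_all add: R_def)
  define S where "S f j = (\<lambda>x. f x - R f j x)" for f j
  have \<Delta>_C: "\<Delta> j r \<in> ?C" if "r \<in> ?C" for j r
    unfolding \<Delta>_def by (intro Cspace_scale P_C that)
  have R_C: "R f j \<in> ?C" if "f \<in> ?C" for f j
    by (induction j) (auto simp: R0 RS that intro!: Cspace_diff \<Delta>_C)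
  have S_C: "S f j \<in> ?C" if "f \<in> ?C" for f j
    unfolding S_def by (intro Cspace_diff that R_C)
  have SS: "S f (Suc j) x = S f j x + \<Delta> j (R f j) x" for f j x
    by (simp add: S_def RS)
  have osc_R: "osc y (R f (Suc j)) \<le> 1/2^j" if f: "f \<in> ?C" and y: "y \<in> topspace Y" for f j y
  proof -
    define h where "h = (\<lambda>x. 2^j * R f j x)"
    have h: "h \<in> ?C" unfolding h_def by (intro Cspace_scale R_C f)
    have "R f (Suc j) = (\<lambda>x. (1/2^j) * (h x - P h x) + 0 * h x)"
      by (simp add: RS \<Delta>_def h_def fun_eq_iff field_simps)
    then have "osc y (R f (Suc j)) \<le> (1/2^j) * osc y (\<lambda>x. h x - P h x)"
      using osc_comb[OF Cspace_diff[OF h P_C[OF h]] h y, of "1/2^j" 0] by simp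
    also have "\<dots> \<le> (1/2^j) * 1" by (intro mult_left_mono P_osc h y) simp
    finally show ?thesis by simp
  qed
  \<comment> \<open>For positive \<open>j\<close> the rescaled remainder has oscillation at most 2
    by \<open>osc_R\<close>, for \<open>j = 0\<close> it is \<open>f\<close>;
    \<open>max_osc f + 2\<close> covers both, and \<open>P\<close> adds another 2.\<close>
  have \<Delta>_bound: "\<bar>\<Delta> j (R f j) x\<bar> \<le> (max_osc f + 4) * (1/2)^j" if f: "f \<in> ?C" for f j x
  proof -
    have "2^j * max_osc (R f j) \<le> max_osc f + 2"
    proof (cases j)
      case (Suc i)
      have "max_osc (R f j) \<le> 1/2^i"
        unfolding Suc by (intro max_osc_least osc_R f) auto
      then have "2^j * max_osc (R f j) \<le> 2^j * (1/2^i)" by (intro mult_left_mono) auto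
      then show ?thesis using max_osc_nonneg[OF f] Suc by simp
    qed (simp add: R0)
    then have "max_osc (\<lambda>x. 2^j * R f j x) \<le> max_osc f + 2"
      using max_osc_scale[OF R_C[OF f], of "2^j" j] by simp
    then have "\<bar>P (\<lambda>x. 2^j * R f j x) x\<bar> \<le> max_osc f + 4"
      using P_bound[OF Cspace_scale[OF R_C[OF f]], of "2^j" j x] by simp
    then have "(1/2)^j * \<bar>P (\<lambda>x. 2^j * R f j x) x\<bar> \<le> (1/2)^j * (max_osc f + 4)"
      by (intro mult_left_mono) auto
    then show ?thesis by (simp add: \<Delta>_def abs_mult power_divide mult.commute)
  qed
  have S_step: "\<bar>S f (j + n) x - S f j x\<bar> \<le> 2 * (max_osc f + 4) * ((1/2)^j - (1/2)^(j+n))"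
    if f: "f \<in> ?C" for f j n x
  proof (induction n)
    case (Suc n)
    have "\<bar>S f (j + Suc n) x - S f j x\<bar> \<le> \<bar>S f (j + n) x - S f j x\<bar> + \<bar>\<Delta> (j+n) (R f (j+n)) x\<bar>"
      by (simp add: SS)
    also have "\<dots> \<le> 2 * (max_osc f + 4) * ((1/2)^j - (1/2)^(j+n)) + (max_osc f + 4) * (1/2)^(j+n)"
      by (intro add_mono Suc \<Delta>_bound f)
    also have "\<dots> = 2 * (max_osc f + 4) * ((1/2)^j - (1/2)^(j + Suc n))"
      by (simp add: algebra_simps)
    finally show ?case .
  qed simp
  have S_dist: "\<bar>S f n x - S f j x\<bar> \<le> 2 * (max_osc f + 4) * (1/2)^j" if f: "f \<in> ?C" and "j \<le> n" for f n j x
  proof -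
    have "2 * (max_osc f + 4) * ((1/2)^j - (1/2)^n) \<le> 2 * (max_osc f + 4) * (1/2)^j"
      using max_osc_nonneg[OF f] by (intro mult_left_mono) auto
    then show ?thesis using S_step[OF f, of j "n - j" x] that(2) by simp
  qed
  define B where "B f x = lim (\<lambda>j. S f j x)" for f x
  have small: "\<exists>j. c * (1/2)^j < e" if "0 < e" for c e :: real
  proof -
    have "(\<lambda>j. c * (1/2)^j) \<longlonglongrightarrow> c * 0"
      by (intro tendsto_mult_left LIMSEQ_power_zero) simp
    then have "\<forall>\<^sub>F j in sequentially. c * (1/2)^j < e"
      using that by (intro order_tendstoD) auto
    then show ?thesis by (auto simp: eventually_sequentially)
  qed
  have S_lim: "(\<lambda>j. S f j x) \<longlonglongrightarrow> B f x" if f: "f \<in> ?C" for f x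
  proof -
    have "Cauchy (\<lambda>j. S f j x)"
    proof (rule CauchyI')
      fix e :: real assume "0 < e"
      then obtain j where "2 * (max_osc f + 4) * (1/2)^j < e / 2"
        using small[of "e/2" "2 * (max_osc f + 4)"] by auto
      then have *: "\<bar>S f n x - S f j x\<bar> < e/2" if "j \<le> n" for n
        using S_dist[OF f that, of x] by linarith
      have "dist (S f m x) (S f n x) < e" if "j \<le> m" "m < n" for m n
        using *[of m] *[of n] that unfolding dist_real_def by linarith
      then show "\<exists>M. \<forall>m\<ge>M. \<forall>n>m. dist (S f m x) (S f n x) < e" by blast
    qed
    then show ?thesis unfolding B_def using Cauchy_convergent convergent_LIMSEQ_iff by blast
  qed
  have B_dist: "\<bar>B f x - S f j x\<bar> \<le> 2 * (max_osc f + 4) * (1/2)^j" if f: "f \<in> ?C" for f j x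
  proof (rule tendsto_upperbound)
    show "(\<lambda>n. \<bar>S f n x - S f j x\<bar>) \<longlonglongrightarrow> \<bar>B f x - S f j x\<bar>"
      by (intro tendsto_intros S_lim f)
    show "\<forall>\<^sub>F n in sequentially. \<bar>S f n x - S f j x\<bar> \<le> 2 * (max_osc f + 4) * (1/2)^j"
      using S_dist[OF f] by (auto simp: eventually_sequentially)
  qed simp
  have B_C: "B f \<in> ?C" if f: "f \<in> ?C" for f
  proof (rule Cspace_uniform_limit)
    fix e :: real assume "0 < e"
    then obtain j where "2 * (max_osc f + 4) * (1/2)^j < e"
      using small[of e "2 * (max_osc f + 4)"] by auto
    then have "\<bar>B f x - S f j x\<bar> < e" for x
      using B_dist[OF f, of x j] by linarith
    then show "\<exists>g\<in>?C. \<forall>x\<in>topspace X. \<bar>B f x - g x\<bar> < e"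
      using S_C[OF f] by blast
  next
    fix x assume "x \<notin> topspace X"
    then have "S f j x = 0" for j using S_C[OF f] by (simp add: Cspace_def)
    then show "B f x = 0" using S_lim[OF f, of x] by (simp add: LIMSEQ_const_iff)
  qed
  have B_base: "\<exists>g\<in>Cspace Y. \<forall>x\<in>topspace X. f x - B f x = g (p x)" if f: "f \<in> ?C" for f
  proof -
    have "osc y (\<lambda>x. f x - B f x) \<le> 0" if y: "y \<in> topspace Y" for y
    proof (rule field_le_epsilon)
      fix e :: real assume "0 < e"
      define c where "c = 4 * (max_osc f + 4) + 2"
      obtain j where j: "c * (1/2)^j < e" using small[OF \<open>0 < e\<close>, of c] by auto
      have c: "0 \<le> c" using max_osc_nonneg[OF f] by (simp add: c_def)
      have "osc y (\<lambda>x. f x - B f x) \<le> osc y (R f (Suc j)) + osc y (\<lambda>x. (f x - B f x) - R f (Suc j) x)"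
        by (intro osc_triangle Cspace_diff f B_C R_C y)
      also have "(\<lambda>x. (f x - B f x) - R f (Suc j) x) = (\<lambda>x. S f (Suc j) x - B f x)"
        by (simp add: S_def fun_eq_iff)
      also have "osc y \<dots> \<le> 2 * (2 * (max_osc f + 4) * (1/2)^Suc j)"
        using B_dist[OF f, of _ "Suc j"] by (intro osc_le_close y) (simp add: abs_minus_commute)
      also have "osc y (R f (Suc j)) \<le> 1/2^j" by (rule osc_R[OF f y])
      also have "1/2^j + 2 * (2 * (max_osc f + 4) * (1/2)^Suc j) \<le> c * (1/2)^j"
        using max_osc_nonneg[OF f] by (simp add: c_def power_divide field_simps)
      finally show "osc y (\<lambda>x. f x - B f x) \<le> 0 + e" using j by simp
    qed
    then obtain g where "g \<in> Cspace Y" "\<And>x. x \<in> topspace X \<Longrightarrow> f x - B f x = g (p x)"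
      by (rule factor_through_base[OF Cspace_diff[OF f B_C[OF f]]]) blast+
    then show ?thesis by blast
  qed
  have B_bound: "\<bar>B f x\<bar> \<le> 2 * (max_osc f + 4)" if f: "f \<in> ?C" for f x
    using B_dist[OF f, of x 0] by (simp add: S_def R0)
  \<comment> \<open>Induction on the stage: \<open>R f j = f - S f j\<close>, so closeness of
    \<open>f\<close> and \<open>h\<close> modulo the base together with closeness of the partial
    sums brings the remainders close modulo the base, and continuity of \<open>P\<close> at
    \<open>2^j * R f j\<close> handles the next correction.\<close>
  have S_cont: "\<forall>f\<in>?C. \<forall>e>0. \<exists>\<delta>>0. \<forall>h\<in>?C. max_osc (\<lambda>x. f x - h x) < \<delta> \<longrightarrow> (\<forall>x. \<bar>S f j x - S h j x\<bar> \<le> e)" for j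
  proof (induction j)
    case 0
    then show ?case by (auto simp: S_def R0 intro!: exI[of _ 1])
  next
    case (Suc j)
    show ?case
    proof (intro ballI allI impI)
      fix f and e :: real assume f: "f \<in> ?C" and e: "0 < e"
      obtain d where d: "0 < d" "\<And>h. h \<in> ?C \<Longrightarrow> max_osc (\<lambda>x. 2^j * R f j x - h x) < d \<Longrightarrow>
          \<forall>x. \<bar>P (\<lambda>x. 2^j * R f j x) x - P h x\<bar> \<le> e/2"
        using P_cont[OF Cspace_scale[OF R_C[OF f]], of "e/2" "2^j" j] e by auto
      define d' where "d' = d / 2^j"
      have d': "0 < d'" "2^j * d' = d" using d(1) by (auto simp: d'_def)
      define e' where "e' = min (e/2) (d'/8)"
      have e': "0 < e'" "e' \<le> e/2" "e' \<le> d'/8" using e d' by (auto simp: e'_def)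
      obtain \<delta> where \<delta>: "0 < \<delta>" "\<And>h. h \<in> ?C \<Longrightarrow> max_osc (\<lambda>x. f x - h x) < \<delta> \<Longrightarrow> \<forall>x. \<bar>S f j x - S h j x\<bar> \<le> e'"
        using Suc[rule_format, OF f e'(1)] by blast
      have "\<bar>S f (Suc j) x - S h (Suc j) x\<bar> \<le> e"
        if h: "h \<in> ?C" and near: "max_osc (\<lambda>x. f x - h x) < min \<delta> (d'/4)" for h x
      proof -
        have Sclose: "\<bar>S f j x - S h j x\<bar> \<le> e'" for x using \<delta>(2)[OF h] near by simp
        have "max_osc (\<lambda>x. S f j x - S h j x) \<le> 2 * e'"
          using Sclose e'(1) by (intro max_osc_le_close) auto
        moreover have "(\<lambda>x. R f j x - R h j x) = (\<lambda>x. 1 * (f x - h x) + -1 * (S f j x - S h j x))"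
          by (simp add: S_def fun_eq_iff)
        then have "max_osc (\<lambda>x. R f j x - R h j x) \<le> max_osc (\<lambda>x. f x - h x) + max_osc (\<lambda>x. S f j x - S h j x)"
          using max_osc_comb[OF Cspace_diff[OF f h] Cspace_diff[OF S_C[OF f] S_C[OF h]], of 1 "-1" j j] by simp
        ultimately have "max_osc (\<lambda>x. R f j x - R h j x) < d'" using near e'(3) d'(1) by simp
        then have "2^j * max_osc (\<lambda>x. R f j x - R h j x) < 2^j * d'" by simp
        moreover have "(\<lambda>x. 2^j * R f j x - 2^j * R h j x) = (\<lambda>x. 2^j * (R f j x - R h j x))"
          by (simp add: right_diff_distrib)
        then have "max_osc (\<lambda>x. 2^j * R f j x - 2^j * R h j x) \<le> 2^j * max_osc (\<lambda>x. R f j x - R h j x)"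
          using max_osc_scale[OF Cspace_diff[OF R_C[OF f] R_C[OF h]], of "2^j" j j] by simp
        ultimately have "\<bar>P (\<lambda>x. 2^j * R f j x) x - P (\<lambda>x. 2^j * R h j x) x\<bar> \<le> e/2"
          using d(2)[OF Cspace_scale[OF R_C[OF h]], of "2^j" j] d'(2) by simp
        moreover have "\<Delta> j (R f j) x - \<Delta> j (R h j) x =
            (1/2^j) * (P (\<lambda>x. 2^j * R f j x) x - P (\<lambda>x. 2^j * R h j x) x)"
          by (simp add: \<Delta>_def right_diff_distrib diff_divide_distrib)
        moreover have "(1/2^j) * \<bar>t\<bar> \<le> \<bar>t\<bar>" for t :: real
          by (rule mult_left_le_one_le) (auto simp: divide_le_eq)
        ultimately have "\<bar>\<Delta> j (R f j) x - \<Delta> j (R h j) x\<bar> \<le> e/2"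
          by (simp only: abs_mult) (smt (verit) zero_le_divide_1_iff zero_le_power)
        then show ?thesis using Sclose[of x] e'(2) unfolding SS by linarith
      qed
      then show "\<exists>\<delta>>0. \<forall>h\<in>?C. max_osc (\<lambda>x. f x - h x) < \<delta> \<longrightarrow> (\<forall>x. \<bar>S f (Suc j) x - S h (Suc j) x\<bar> \<le> e)"
        using \<delta>(1) d'(1) by (intro exI[of _ "min \<delta> (d'/4)"]) auto
    qed
  qed
  have B_cont: "\<exists>\<delta>>0. \<forall>h\<in>?C. max_osc (\<lambda>x. f x - h x) < \<delta> \<longrightarrow> (\<forall>x. \<bar>B f x - B h x\<bar> \<le> e)"
    if f: "f \<in> ?C" and e: "0 < e" for f e
  proof -
    \<comment> \<open>The 5 in place of 4 makes the same \<open>j\<close> serve every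
      \<open>h\<close> with \<open>max_osc h \<le> max_osc f + 1\<close>.\<close>
    obtain j where j: "2 * (max_osc f + 5) * (1/2)^j < e/3" using small[of "e/3"] e by auto
    obtain \<delta> where \<delta>: "0 < \<delta>" "\<And>h. h \<in> ?C \<Longrightarrow> max_osc (\<lambda>x. f x - h x) < \<delta> \<Longrightarrow> \<forall>x. \<bar>S f j x - S h j x\<bar> \<le> e/3"
      using S_cont[of j, rule_format, OF f, of "e/3"] e by auto
    have "\<bar>B f x - B h x\<bar> \<le> e" if h: "h \<in> ?C" and near: "max_osc (\<lambda>x. f x - h x) < min 1 \<delta>" for h x
    proof -
      have "max_osc h \<le> max_osc f + 1"
        using max_osc_triangle[OF h f] max_osc_diff_commute[OF f h] near by simp
      then have "2 * (max_osc h + 4) * (1/2)^j \<le> 2 * (max_osc f + 5) * (1/2)^j"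
        by (intro mult_right_mono) auto
      moreover have "2 * (max_osc f + 4) * (1/2)^j \<le> 2 * (max_osc f + 5) * (1/2)^j"
        by (intro mult_right_mono) auto
      moreover have "\<bar>S f j x - S h j x\<bar> \<le> e/3" using \<delta>(2)[OF h] near by simp
      ultimately show ?thesis using B_dist[OF f, of x j] B_dist[OF h, of x j] j by linarith
    qed
    then show ?thesis using \<delta>(1) by (intro exI[of _ "min 1 \<delta>"]) auto
  qed
  show thesis
    by (rule that[of B]) (fact B_C B_base B_bound B_cont)+
qed

end

section \<open>Three-space argument\<close>

lemma lsc_mid:
  assumes "pointwise_lsc_on_C K \<Phi>" and h: "h \<in> Cspace K"
  shows "pointwise_lsc_on_C K (\<lambda>f. \<Phi> (\<lambda>x. (f x + h x) / 2))"
proof (rule lscI)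
  fix f a assume f: "f \<in> Cspace K" and a: "a < \<Phi> (\<lambda>x. (f x + h x) / 2)"
  obtain F d where F: "finite F" "F \<subseteq> topspace K" "0 < d"
    "\<forall>g\<in>Cspace K. (\<forall>x\<in>F. \<bar>g x - (f x + h x) / 2\<bar> < d) \<longrightarrow> a < \<Phi> g"
    by (rule lscD[OF assms(1) Cspace_mid[OF f h], OF a])
  have "a < \<Phi> (\<lambda>x. (g x + h x) / 2)" if "g \<in> Cspace K" "\<forall>x\<in>F. \<bar>g x - f x\<bar> < d" for g
  proof (intro F(4)[rule_format] Cspace_mid h that(1))
    fix x assume "x \<in> F"
    then have "\<bar>g x - f x\<bar> < d" using that by simp
    then show "\<bar>(g x + h x) / 2 - (f x + h x) / 2\<bar> < d" by (simp add: abs_if field_simps split: if_splits)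
  qed
  with F show "\<exists>F d. finite F \<and> F \<subseteq> topspace K \<and> 0 < d \<and>
      (\<forall>g\<in>Cspace K. (\<forall>x\<in>F. \<bar>g x - f x\<bar> < d) \<longrightarrow> a < \<Phi> (\<lambda>x. (g x + h x) / 2))"
    by blast
qed

lemma convex_on_C_mid_arg:
  assumes "convex_on_C K \<Phi>" and h: "h \<in> Cspace K"
  shows "convex_on_C K (\<lambda>f. \<Phi> (\<lambda>x. (f x + h x) / 2))"
  unfolding convex_on_C_def
proof (intro ballI allI impI)
  fix f g and t :: real assume *: "f \<in> Cspace K" "g \<in> Cspace K" "0 \<le> t \<and> t \<le> 1"
  have "(\<lambda>x. ((1-t) * f x + t * g x + h x) / 2) = (\<lambda>x. (1-t) * ((f x + h x) / 2) + t * ((g x + h x) / 2))"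
    by (simp add: fun_eq_iff field_simps)
  then show "\<Phi> (\<lambda>x. ((1-t) * f x + t * g x + h x) / 2)
      \<le> (1-t) * \<Phi> (\<lambda>x. (f x + h x) / 2) + t * \<Phi> (\<lambda>x. (g x + h x) / 2)"
    using convex_on_CD[OF assms(1) Cspace_mid[OF *(1) h] Cspace_mid[OF *(2) h], of t] * by simp
qed

lemma square_le_perturbed:
  fixes a b t M :: real
  assumes "0 \<le> a" "a \<le> M" "0 \<le> b" "b \<le> M" "a \<le> b + t" "0 \<le> t"
  shows "a\<^sup>2 \<le> b\<^sup>2 + 2 * M * t"
proof -
  have "(a - b) * (a + b) \<le> t * (a + b)" using assms by (intro mult_right_mono) auto
  also have "\<dots> \<le> t * (2 * M)" using assms by (intro mult_left_mono) auto
  finally show ?thesis by (simp add: power2_eq_square algebra_simps)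
qed

context fully_closed_map
begin

lemma total_space_has_LUR_lsc_norm:
  assumes base: "has_LUR_lsc_norm Y"
    and fibres: "\<forall>y\<in>topspace Y. has_LUR_lsc_norm (fibre_space y)"
  shows "has_LUR_lsc_norm X"
proof -
  let ?C = "Cspace X"
  note sn0 = supnorm_nonneg[OF X(1)] and su = supnorm_upper[OF X(1)]
  obtain N a b where norm: "is_norm_on_C Y N" and LUR: "LUR_on_C Y N" and lscN: "pointwise_lsc_on_C Y N"
    and ab: "0 < a" "0 < b" and lower: "\<And>f. f \<in> Cspace Y \<Longrightarrow> a * supnorm Y f \<le> N f"
    and upper: "\<And>f. f \<in> Cspace Y \<Longrightarrow> N f \<le> b * supnorm Y f"
    using base unfolding has_LUR_lsc_norm_def equivalent_norm_on_C_def by blast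
  interpret C_norm Y N b
    by unfold_locales (fact Y norm ab upper)+
  obtain W where W: "admissible X W"
    and W_rotund: "\<And>f e. f \<in> ?C \<Longrightarrow> 0 < e \<Longrightarrow>
      \<exists>d>0. \<forall>g\<in>?C. mid_defect W f g < d \<longrightarrow> (\<forall>y\<in>topspace Y. osc y (\<lambda>x. f x - g x) \<le> e)"
    by (rule fibrewise_rotund_functional[OF fibres]) blast
  have W0: "\<And>f. f \<in> ?C \<Longrightarrow> 0 \<le> W f" and convW: "convex_on_C X W" and lscW: "pointwise_lsc_on_C X W"
    using W by (auto simp: admissible_def)
  obtain B where B_C: "\<And>f. f \<in> ?C \<Longrightarrow> B f \<in> ?C"
    and B_base: "\<And>f. f \<in> ?C \<Longrightarrow> \<exists>g\<in>Cspace Y. \<forall>x\<in>topspace X. f x - B f x = g (p x)"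
    and B_bound: "\<And>f x. f \<in> ?C \<Longrightarrow> \<bar>B f x\<bar> \<le> 2 * (max_osc f + 4)"
    and B_cont: "\<And>f e. f \<in> ?C \<Longrightarrow> 0 < e \<Longrightarrow> \<exists>\<delta>>0. \<forall>h\<in>?C.
      max_osc (\<lambda>x. f x - h x) < \<delta> \<longrightarrow> (\<forall>x. \<bar>B f x - B h x\<bar> \<le> e)"
    by (rule lift_exists) blast
  \<comment> \<open>Restricting \<open>h\<close> to the unit ball bounds \<open>max_osc h\<close> by
    2 and hence \<open>B h\<close> by \<open>2 * (2 + 4) = 12\<close>, so that the supremum over
    \<open>h\<close> is finite.\<close>
  define H where "H = {h \<in> ?C. supnorm X h \<le> 1}"
  have zeroH: "(\<lambda>x. 0) \<in> H" by (simp add: H_def)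
  then have H_ne: "H \<noteq> {}" by blast
  have B12: "\<bar>B h x\<bar> \<le> 12" if h: "h \<in> H" for h x
  proof -
    have "max_osc h \<le> 2"
      using h osc_le_supnorm[of h] by (intro max_osc_least) (force simp: H_def)+
    then show ?thesis using B_bound[of h x] h by (simp add: H_def)
  qed
  \<comment> \<open>For fixed \<open>h\<close> this is affine in \<open>f\<close>, which makes
    \<open>\<epsilon> h\<close> convex. The section also carries a finite subset of \<open>Y\<close>
    to one of \<open>X\<close>, as lower semicontinuity on \<open>X\<close> requires.\<close>
  define v where "v h f = (\<lambda>y. f (section_of y) - B h (section_of y))" for h f
  have v_bound: "\<bar>v h f y\<bar> \<le> supnorm X f + 12" if "h \<in> H" "f \<in> ?C" for h f y
    using su[OF that(2), of "section_of y"] B12[OF that(1), of "section_of y"] unfolding v_def by linarith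
  have bdv: "\<exists>c. \<forall>y\<in>topspace Y. \<bar>v h f y\<bar> \<le> c" if "h \<in> H" "f \<in> ?C" for h f
    using v_bound[OF that] by blast
  define \<epsilon> where "\<epsilon> h f = ext_norm (v h f)" for h f
  have \<epsilon>_nonneg: "0 \<le> \<epsilon> h f" if "h \<in> H" "f \<in> ?C" for h f
    unfolding \<epsilon>_def by (rule ext_norm_nonneg[OF bdv[OF that]])
  have \<epsilon>_le: "\<epsilon> h f \<le> b * (supnorm X f + 12)" if "h \<in> H" "f \<in> ?C" for h f
    unfolding \<epsilon>_def using sn0[OF that(2)] by (intro ext_norm_bound v_bound that) auto
  have conv\<epsilon>: "convex_on_C X (\<epsilon> h)" if h: "h \<in> H" for h
    unfolding convex_on_C_def
  proof (intro ballI allI impI)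
    fix f g and t :: real assume *: "f \<in> ?C" "g \<in> ?C" "0 \<le> t \<and> t \<le> 1"
    have "v h (\<lambda>x. (1-t) * f x + t * g x) = (\<lambda>y. (1-t) * v h f y + t * v h g y)"
      by (simp add: v_def fun_eq_iff algebra_simps)
    then show "\<epsilon> h (\<lambda>x. (1-t) * f x + t * g x) \<le> (1-t) * \<epsilon> h f + t * \<epsilon> h g"
      unfolding \<epsilon>_def using ext_norm_convex[OF bdv[OF h *(1)] bdv[OF h *(2)], of t] * by simp
  qed
  have lsc\<epsilon>: "pointwise_lsc_on_C X (\<epsilon> h)" if h: "h \<in> H" for h
  proof (rule lscI)
    fix f c assume f: "f \<in> ?C" and c: "c < \<epsilon> h f"
    obtain F where F: "finite F" "F \<subseteq> topspace Y" "c < ext_fin F (v h f)"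
      using ext_norm_approx[OF bdv[OF h f]] c unfolding \<epsilon>_def by blast
    define \<delta> where "\<delta> = (ext_fin F (v h f) - c) / (2 * b)"
    have \<delta>: "0 < \<delta>" "b * \<delta> < ext_fin F (v h f) - c" using F(3) ab by (auto simp: \<delta>_def)
    have "c < \<epsilon> h g" if g: "g \<in> ?C" "\<forall>x\<in>section_of ` F. \<bar>g x - f x\<bar> < \<delta>" for g
    proof -
      have "ext_fin F (v h f) \<le> ext_fin F (v h g) + b * \<delta>"
        using g(2) \<delta>(1) by (intro ext_fin_lipschitz F(1,2)) (auto simp: v_def abs_minus_commute less_imp_le)
      also have "ext_fin F (v h g) \<le> \<epsilon> h g"
        unfolding \<epsilon>_def by (rule ext_norm_upper[OF bdv[OF h g(1)] F(1,2)])
      finally show ?thesis using \<delta>(2) by simp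
    qed
    moreover have "section_of ` F \<subseteq> topspace X" using F(2) section_of fibre_subset by blast
    ultimately show "\<exists>F d. finite F \<and> F \<subseteq> topspace X \<and> 0 < d \<and>
        (\<forall>g\<in>?C. (\<forall>x\<in>F. \<bar>g x - f x\<bar> < d) \<longrightarrow> c < \<epsilon> h g)"
      using F(1) \<delta>(1) by (intro exI[of _ "section_of ` F"] exI[of _ \<delta>]) auto
  qed
  \<comment> \<open>The constant \<open>W 0\<close> makes the member \<open>h = 0\<close>
    nonnegative. By convexity \<open>\<phi> h f \<le> W f + W 0\<close>; the deficit is the defect
    of \<open>W\<close> at \<open>f\<close> and \<open>h\<close>, which vanishes at
    \<open>h = f\<close>.\<close>
  define \<phi> where "\<phi> h f = 2 * W (\<lambda>x. (f x + h x) / 2) + (W (\<lambda>x. 0) - W h)" for h f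
  define G where "G k h f = \<phi> h f + inverse (real (Suc k)) * (\<epsilon> h f)\<^sup>2" for k h f
  define \<theta> where "\<theta> k f = (SUP h\<in>H. G k h f)" for k f
  have conv\<phi>: "convex_on_C X (\<phi> h)" if "h \<in> H" for h
    unfolding \<phi>_def[abs_def] using that
    by (intro convex_on_C_add convex_on_C_cmult convex_on_C_const convex_on_C_mid_arg convW) (auto simp: H_def)
  have lsc\<phi>: "pointwise_lsc_on_C X (\<phi> h)" if "h \<in> H" for h
    unfolding \<phi>_def[abs_def] using that
    by (intro lsc_add lsc_cmult lsc_const lsc_mid lscW) (auto simp: H_def)
  have conv\<epsilon>2: "convex_on_C X (\<lambda>f. (\<epsilon> h f)\<^sup>2)" if "h \<in> H" for h
    by (rule convex_on_C_square[OF conv\<epsilon>[OF that] \<epsilon>_nonneg[OF that]])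
  have convG: "convex_on_C X (G k h)" if "h \<in> H" for k h
    unfolding G_def[abs_def] by (intro convex_on_C_add convex_on_C_cmult conv\<phi> conv\<epsilon>2 that) simp
  have lscG: "pointwise_lsc_on_C X (G k h)" if "h \<in> H" for k h
    unfolding G_def[abs_def] by (intro lsc_add lsc_cmult lsc\<phi> lsc_square lsc\<epsilon> \<epsilon>_nonneg that) auto
  obtain cW where cW: "0 \<le> cW" "\<And>f. f \<in> ?C \<Longrightarrow> W f \<le> cW * (1 + (supnorm X f)\<^sup>2)"
    using W by (auto simp: admissible_def quad_bounded_on_C_def)
  \<comment> \<open>The 288 comes from
    \<open>(s + 12)\<^sup>2 \<le> 2 * s\<^sup>2 + 288\<close>.\<close>
  define c where "c = cW + W (\<lambda>x. 0) + 288 * b\<^sup>2"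
  have c0: "0 \<le> c" using cW(1) W0[OF Cspace_zero] by (simp add: c_def)
  have G_le: "G k h f \<le> c * (1 + (supnorm X f)\<^sup>2)" if h: "h \<in> H" and f: "f \<in> ?C" for k h f
  proof -
    define s where "s = supnorm X f"
    have "\<phi> h f \<le> W f + W (\<lambda>x. 0)"
      using convex_on_C_mid[OF convW f, of h] h by (simp add: \<phi>_def H_def)
    also have "\<dots> \<le> cW * (1 + s\<^sup>2) + W (\<lambda>x. 0) * (1 + s\<^sup>2)"
      using cW(2)[OF f] mult_left_mono[OF _ W0[OF Cspace_zero], of 1 "1 + s\<^sup>2"]
      unfolding s_def[symmetric] by (intro add_mono) auto
    finally have 1: "\<phi> h f \<le> (cW + W (\<lambda>x. 0)) * (1 + s\<^sup>2)" by (simp add: algebra_simps)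
    have "(\<epsilon> h f)\<^sup>2 \<le> (b * (s + 12))\<^sup>2"
      unfolding s_def by (intro power_mono \<epsilon>_le \<epsilon>_nonneg h f)
    also have "\<dots> = b\<^sup>2 * (s + 12)\<^sup>2" by (simp add: power_mult_distrib)
    also have "\<dots> \<le> b\<^sup>2 * (288 * (1 + s\<^sup>2))"
    proof (rule mult_left_mono)
      have "24 * s \<le> s\<^sup>2 + 144"
        using zero_le_power2[of "s - 12"] by (simp add: power2_diff)
      then show "(s + 12)\<^sup>2 \<le> 288 * (1 + s\<^sup>2)"
        using zero_le_power2[of s] unfolding power2_sum distrib_left by (simp del: zero_le_power2; linarith)
    qed simp
    finally have "(\<epsilon> h f)\<^sup>2 \<le> b\<^sup>2 * (288 * (1 + s\<^sup>2))" .
    moreover have "inverse (real (Suc k)) * (\<epsilon> h f)\<^sup>2 \<le> 1 * (\<epsilon> h f)\<^sup>2"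
      by (intro mult_right_mono) (auto simp: inverse_le_1_iff)
    ultimately have "inverse (real (Suc k)) * (\<epsilon> h f)\<^sup>2 \<le> b\<^sup>2 * (288 * (1 + s\<^sup>2))" by linarith
    with 1 show ?thesis unfolding G_def c_def s_def[symmetric] by (simp add: algebra_simps)
  qed
  have bddG: "bdd_above ((\<lambda>h. G k h f) ` H)" if "f \<in> ?C" for f k
    using G_le[OF _ that] by (meson bdd_aboveI2)
  have \<theta>_upper: "G k h f \<le> \<theta> k f" if "h \<in> H" "f \<in> ?C" for k h f
    unfolding \<theta>_def using that by (intro cSUP_upper bddG)
  have adm\<theta>: "admissible X (\<theta> k)" for k
    unfolding admissible_def
  proof (intro conjI ballI)
    fix f assume f: "f \<in> ?C"
    have "0 \<le> W (\<lambda>x. (f x + 0) / 2)" by (intro W0 Cspace_mid f Cspace_zero)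
    then have "0 \<le> G k (\<lambda>x. 0) f" by (simp add: G_def \<phi>_def)
    then show "0 \<le> \<theta> k f" using \<theta>_upper[OF zeroH f, of k] by simp
  next
    show "convex_on_C X (\<theta> k)" "pointwise_lsc_on_C X (\<theta> k)"
      unfolding \<theta>_def[abs_def]
      by (rule convex_on_C_SUP[OF H_ne convG bddG], assumption+)
         (rule lsc_SUP[OF H_ne lscG bddG], assumption+)
    show "quad_bounded_on_C X (\<theta> k)"
      unfolding quad_bounded_on_C_def \<theta>_def
      by (intro exI[of _ c] conjI ballI c0 cSUP_least[OF H_ne] G_le)
  qed
  \<comment> \<open>\<open>W\<close> itself enters the series besides all \<open>\<theta> k\<close>:
    near-maximality brings \<open>h\<close> close to \<open>f\<close> modulo the base, whereas
    \<open>g\<close> is compared with \<open>f\<close> on the fibres through \<open>W\<close>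
    directly.\<close>
  have adm: "admissible X (case j of 0 \<Rightarrow> W | Suc k \<Rightarrow> \<theta> k)" for j
    using W adm\<theta> by (simp split: nat.split)
  obtain \<Phi> where \<Phi>: "admissible X \<Phi>" "\<forall>j. \<exists>c>0. \<forall>f\<in>?C. \<forall>g\<in>?C.
      mid_defect (case j of 0 \<Rightarrow> W | Suc k \<Rightarrow> \<theta> k) f g \<le> c * mid_defect \<Phi> f g"
    by (rule admissible_series[OF X(1), of "\<lambda>j. case j of 0 \<Rightarrow> W | Suc k \<Rightarrow> \<theta> k", OF adm])
  have small: "\<exists>d>0. \<forall>f\<in>?C. \<forall>g\<in>?C. mid_defect \<Phi> f g < d \<longrightarrow>
      mid_defect (case j of 0 \<Rightarrow> W | Suc k \<Rightarrow> \<theta> k) f g < \<eta>" if "0 < \<eta>" for j and \<eta> :: real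
  proof -
    obtain c where c: "0 < c" "\<forall>f\<in>?C. \<forall>g\<in>?C.
        mid_defect (case j of 0 \<Rightarrow> W | Suc k \<Rightarrow> \<theta> k) f g \<le> c * mid_defect \<Phi> f g"
      using \<Phi>(2) by blast
    have "mid_defect (case j of 0 \<Rightarrow> W | Suc k \<Rightarrow> \<theta> k) f g < \<eta>"
      if "f \<in> ?C" "g \<in> ?C" "mid_defect \<Phi> f g < \<eta> / c" for f g
    proof (rule le_less_trans)
      show "mid_defect (case j of 0 \<Rightarrow> W | Suc k \<Rightarrow> \<theta> k) f g \<le> c * mid_defect \<Phi> f g"
        using c(2) that by blast
      show "c * mid_defect \<Phi> f g < \<eta>" using that c(1) by (simp add: field_simps)
    qed
    then show ?thesis using c(1) that by (intro exI[of _ "\<eta> / c"]) simp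
  qed
  show ?thesis
  proof (rule has_LUR_lsc_norm_if_admissible[OF X(1) \<Phi>(1)])
    fix f and e :: real assume f: "f \<in> ?C" and f1: "supnorm X f \<le> 1" and e: "0 < e"
    have fH: "f \<in> H" using f f1 by (simp add: H_def)
    define e1 where "e1 = e / 4"
    have e1: "0 < e1" using e by (simp add: e1_def)
    obtain g0 where g0: "g0 \<in> Cspace Y" "\<forall>x\<in>topspace X. f x - B f x = g0 (p x)"
      using B_base[OF f] by blast
    have g0_eq: "g0 y = f (section_of y) - B f (section_of y)" if "y \<in> topspace Y" for y
      using g0(2) section_of[OF that] by (simp add: fibre_def)
    obtain d0 where d0: "0 < d0" "\<And>u y. (\<exists>c. \<forall>y\<in>topspace Y. \<bar>u y\<bar> \<le> c) \<Longrightarrow>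
        mid_defect (\<lambda>h. (ext_norm h)\<^sup>2) g0 u < d0 \<Longrightarrow> y \<in> topspace Y \<Longrightarrow> \<bar>g0 y - u y\<bar> < e1"
      by (rule ext_norm_LUR[OF LUR lscN ab(1) lower g0(1) e1]) blast+
    \<comment> \<open>On the unit ball the arguments of the extended norm are bounded by
      \<open>1 + 12\<close>.\<close>
    define M where "M = 13 * b"
    have M: "0 < M" using ab by (simp add: M_def)
    \<comment> \<open>Replacing \<open>v h f\<close> by \<open>g0\<close> raises the defect by at
      most \<open>2 * M * (b * e2)\<close> in the end term and by twice that in the doubled midpoint
      term; the total \<open>6 * M * (b * e2)\<close> uses half of \<open>d0\<close>.\<close>
    define e2 where "e2 = min e1 (d0 / (12 * M * b))"
    have e2: "0 < e2" "e2 \<le> e1" using e1 d0(1) M ab by (auto simp: e2_def)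
    have e2_d0: "6 * M * (b * e2) \<le> d0 / 2"
    proof -
      have "e2 \<le> d0 / (12 * M * b)" by (simp add: e2_def)
      then have "e2 * (12 * M * b) \<le> d0" using M ab by (simp add: pos_le_divide_eq)
      then show ?thesis by (simp add: algebra_simps)
    qed
    obtain \<delta> where \<delta>: "0 < \<delta>" "\<And>h. h \<in> ?C \<Longrightarrow> max_osc (\<lambda>x. f x - h x) < \<delta> \<Longrightarrow> \<forall>x. \<bar>B f x - B h x\<bar> \<le> e2"
      using B_cont[OF f e2(1)] by blast
    obtain dW where dW: "0 < dW" "\<And>h. h \<in> ?C \<Longrightarrow> mid_defect W f h < dW \<Longrightarrow>
        \<forall>y\<in>topspace Y. osc y (\<lambda>x. f x - h x) \<le> \<delta>/2"
      using W_rotund[OF f, of "\<delta>/2"] \<delta>(1) by auto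
    obtain dW' where dW': "0 < dW'" "\<And>h. h \<in> ?C \<Longrightarrow> mid_defect W f h < dW' \<Longrightarrow>
        \<forall>y\<in>topspace Y. osc y (\<lambda>x. f x - h x) \<le> e1"
      using W_rotund[OF f e1] by auto
    \<comment> \<open>With this \<open>k\<close> the extended-norm term contributes less than
      \<open>dW / 2\<close>, too little to let a near-maximizer \<open>h\<close> stray from
      \<open>f\<close> modulo the base.\<close>
    obtain k where "inverse (real (Suc k)) < dW / (2 * M\<^sup>2)"
      using reals_Archimedean[of "dW / (2 * M\<^sup>2)"] dW(1) M by auto
    then have k: "inverse (real (Suc k)) * M\<^sup>2 < dW / 2"
      using M by (simp add: pos_less_divide_eq del: of_nat_Suc)
    define \<eta> where "\<eta> = min (dW / 4) (d0 / (4 * real (Suc k)))"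
    have \<eta>: "0 < \<eta>" "2 * \<eta> \<le> dW / 2" "2 * \<eta> * real (Suc k) \<le> d0 / 2"
    proof -
      show "0 < \<eta>" using dW(1) d0(1) by (simp add: \<eta>_def)
      have "\<eta> \<le> dW / 4" unfolding \<eta>_def by (rule min.cobounded1)
      then show "2 * \<eta> \<le> dW / 2" by simp
      have "\<eta> \<le> d0 / (4 * real (Suc k))" unfolding \<eta>_def by (rule min.cobounded2)
      then show "2 * \<eta> * real (Suc k) \<le> d0 / 2" by (simp add: field_simps del: of_nat_Suc)
    qed
    obtain d1 where d1: "0 < d1" "\<And>g. g \<in> ?C \<Longrightarrow> mid_defect \<Phi> f g < d1 \<Longrightarrow> mid_defect (\<theta> k) f g < \<eta>"
      using small[OF \<eta>(1), of "Suc k"] f by auto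
    obtain d2 where d2: "0 < d2" "\<And>g. g \<in> ?C \<Longrightarrow> mid_defect \<Phi> f g < d2 \<Longrightarrow> mid_defect W f g < dW'"
      using small[OF dW'(1), of 0] f by auto
    have "supnorm X (\<lambda>x. f x - g x) \<le> e"
      if g: "g \<in> ?C" and g1: "supnorm X g \<le> 1" and def: "mid_defect \<Phi> f g < min d1 d2" for g
    proof -
      obtain h where h: "h \<in> H" "\<theta> k f - 2 * \<eta> < G k h f" "mid_defect (G k h) f g < 2 * \<eta>"
      proof (rule SUP_near_max[OF H_ne bddG convG f g, where \<eta> = \<eta>])
        show "mid_defect (\<lambda>f. SUP h\<in>H. G k h f) f g < \<eta>"
          using d1(2)[OF g] def by (simp add: \<theta>_def[abs_def])
      qed (use \<eta> that in \<open>auto simp: \<theta>_def\<close>)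
      have hC: "h \<in> ?C" using h(1) by (simp add: H_def)
      have \<epsilon>M: "\<epsilon> h u \<le> M" if "u \<in> ?C" "supnorm X u \<le> 1" for u
      proof -
        have "b * (supnorm X u + 12) \<le> b * 13" using that(2) ab by (intro mult_left_mono) auto
        then show ?thesis using \<epsilon>_le[OF h(1) that(1)] by (simp add: M_def)
      qed
      \<comment> \<open>Comparison with the member \<open>h = f\<close>: what \<open>h\<close> loses
        in \<open>\<phi>\<close> is the defect of \<open>W\<close> at \<open>f\<close> and
        \<open>h\<close>, and near-maximality bounds it by \<open>2 * \<eta>\<close> plus the small
        extended-norm term.\<close>
      have "W f + W (\<lambda>x. 0) \<le> G k f f" by (simp add: G_def \<phi>_def)
      also have "\<dots> \<le> \<theta> k f" by (rule \<theta>_upper[OF fH f])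
      also have "\<dots> < \<phi> h f + inverse (real (Suc k)) * (\<epsilon> h f)\<^sup>2 + 2 * \<eta>"
        using h(2) by (simp add: G_def)
      also have "inverse (real (Suc k)) * (\<epsilon> h f)\<^sup>2 \<le> inverse (real (Suc k)) * M\<^sup>2"
        by (intro mult_left_mono power_mono \<epsilon>M \<epsilon>_nonneg h f f1) simp
      finally have "mid_defect W f h < dW"
        using k \<eta>(2) unfolding \<phi>_def mid_defect_def by linarith
      then have "\<forall>y\<in>topspace Y. osc y (\<lambda>x. f x - h x) \<le> \<delta>/2" by (rule dW(2)[OF hC])
      then have "max_osc (\<lambda>x. f x - h x) \<le> \<delta>/2" using \<delta>(1) by (intro max_osc_least) auto
      then have B_near: "\<bar>B f x - B h x\<bar> \<le> e2" for x using \<delta>(2)[OF hC] \<delta>(1) by simp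
      have "0 \<le> mid_defect (\<phi> h) f g" by (rule mid_defect_nonneg[OF conv\<phi>[OF h(1)] f g])
      moreover have "mid_defect (G k h) f g =
          mid_defect (\<phi> h) f g + inverse (real (Suc k)) * mid_defect (\<lambda>f. (\<epsilon> h f)\<^sup>2) f g"
        unfolding G_def[abs_def] mid_defect_add mid_defect_cmult ..
      ultimately have "inverse (real (Suc k)) * mid_defect (\<lambda>f. (\<epsilon> h f)\<^sup>2) f g < 2 * \<eta>"
        using h(3) by linarith
      then have "mid_defect (\<lambda>f. (\<epsilon> h f)\<^sup>2) f g < 2 * \<eta> * real (Suc k)"
        by (simp add: field_simps del: of_nat_Suc)
      then have def\<epsilon>: "mid_defect (\<lambda>f. (\<epsilon> h f)\<^sup>2) f g < d0 / 2" using \<eta>(3) by linarith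
      define m where "m = (\<lambda>x. (f x + g x) / 2)"
      have m: "m \<in> ?C" unfolding m_def by (rule Cspace_mid[OF f g])
      have m1: "supnorm X m \<le> 1"
        using convex_on_C_mid[OF convex_on_C_supnorm[OF X(1)] f g] f1 g1 by (simp add: m_def)
      have g0_13: "\<bar>g0 y\<bar> \<le> 13" if "y \<in> topspace Y" for y
        using v_bound[OF fH f, of y] f1 g0_eq[OF that] by (simp add: v_def)
      then have bg0: "\<exists>c. \<forall>y\<in>topspace Y. \<bar>g0 y\<bar> \<le> c" by blast
      have g0_v: "\<bar>g0 y - v h f y\<bar> \<le> e2" if "y \<in> topspace Y" for y
        using B_near[of "section_of y"] g0_eq[OF that] by (simp add: v_def)
      \<comment> \<open>The midpoint \<open>v h m\<close> contains \<open>v h f\<close> where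
        \<open>u\<close> has \<open>g0\<close>, so the two differ by half of an error that is at
        most \<open>e2\<close>.\<close>
      define u where "u = (\<lambda>y. (g0 y + v h g y) / 2)"
      have u_v: "\<bar>v h m y - u y\<bar> \<le> e2" if "y \<in> topspace Y" for y
      proof -
        have "v h m y - u y = (v h f y - g0 y) / 2" by (simp add: v_def m_def u_def field_simps)
        then show ?thesis using g0_v[OF that] e2(1) unfolding abs_le_iff by auto
      qed
      have u13: "\<bar>u y\<bar> \<le> 13" if "y \<in> topspace Y" for y
        using g0_13[OF that] v_bound[OF h(1) g, of y] g1 unfolding u_def by (simp add: abs_le_iff)
      then have bu: "\<exists>c. \<forall>y\<in>topspace Y. \<bar>u y\<bar> \<le> c" by blast
      have "ext_norm g0 \<le> M"
        using ext_norm_bound[of 13 g0] g0_13 by (simp add: M_def mult.commute)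
      moreover have "ext_norm u \<le> M"
        using ext_norm_bound[of 13 u] u13 by (simp add: M_def mult.commute)
      moreover have "ext_norm g0 \<le> \<epsilon> h f + b * e2"
        unfolding \<epsilon>_def using g0_v e2(1) by (intro ext_norm_lipschitz bdv h f) auto
      moreover have "\<epsilon> h m \<le> ext_norm u + b * e2"
        unfolding \<epsilon>_def using u_v e2(1) by (intro ext_norm_lipschitz bu) auto
      ultimately have 1: "(ext_norm g0)\<^sup>2 \<le> (\<epsilon> h f)\<^sup>2 + 2 * M * (b * e2)"
          and 2: "(\<epsilon> h m)\<^sup>2 \<le> (ext_norm u)\<^sup>2 + 2 * M * (b * e2)"
        using ab e2(1) by (auto intro!: square_le_perturbed ext_norm_nonneg bg0 bu \<epsilon>_nonneg \<epsilon>M h f f1 m m1)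
      have "mid_defect (\<lambda>h. (ext_norm h)\<^sup>2) g0 (v h g)
          = (ext_norm g0)\<^sup>2 + (\<epsilon> h g)\<^sup>2 - 2 * (ext_norm u)\<^sup>2"
        by (simp add: mid_defect_def \<epsilon>_def u_def)
      moreover have "mid_defect (\<lambda>f. (\<epsilon> h f)\<^sup>2) f g = (\<epsilon> h f)\<^sup>2 + (\<epsilon> h g)\<^sup>2 - 2 * (\<epsilon> h m)\<^sup>2"
        by (simp add: mid_defect_def m_def)
      ultimately have "mid_defect (\<lambda>h. (ext_norm h)\<^sup>2) g0 (v h g) < d0"
        using 1 2 def\<epsilon> e2_d0 by linarith
      then have near: "\<bar>g0 y - v h g y\<bar> < e1" if "y \<in> topspace Y" for y
        using d0(2)[OF bdv[OF h(1) g]] that by blast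
      show ?thesis
      proof (rule supnorm_least)
        fix x assume x: "x \<in> topspace X"
        define y where "y = p x"
        have y: "y \<in> topspace Y" "x \<in> fibre y" using p_in[OF x] in_fibre[OF x] by (auto simp: y_def)
        \<comment> \<open>Closeness is known at the section point; the oscillation bound spreads it
          over the fibre. The total is at most \<open>e1 + e2 + e1\<close>, below
          \<open>e = 4 * e1\<close>.\<close>
        have "f (section_of y) - g (section_of y) = (g0 y - v h g y) + (B f (section_of y) - B h (section_of y))"
          using g0_eq[OF y(1)] by (simp add: v_def)
        then have "\<bar>f (section_of y) - g (section_of y)\<bar> \<le> e1 + e2"
          using near[OF y(1)] B_near[of "section_of y"] by linarith
        moreover have "osc y (\<lambda>x. f x - g x) \<le> e1"
          using dW'(2)[OF g] d2(2)[OF g] def y(1) by simp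
        moreover have "\<bar>(f x - g x) - (f (section_of y) - g (section_of y))\<bar> \<le> osc y (\<lambda>x. f x - g x)"
          using osc_upper[OF Cspace_diff[OF f g] y(2) section_of[OF y(1)]] by simp
        ultimately show "\<bar>f x - g x\<bar> \<le> e" using e2(2) by (simp add: e1_def)
      qed (use e in simp)
    qed
    then show "\<exists>d>0. \<forall>g\<in>?C. supnorm X g \<le> 1 \<longrightarrow> mid_defect \<Phi> f g < d \<longrightarrow> supnorm X (\<lambda>x. f x - g x) \<le> e"
      using d1(1) d2(1) by (intro exI[of _ "min d1 d2"]) auto
  qed
qed

end

theorem theorem1p2:
  fixes X :: "'a topology" and Y :: "'b topology" and p :: "'a \<Rightarrow> 'b"
  assumes "compact_space X" "Hausdorff_space X"
    and "compact_space Y" "Hausdorff_space Y"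
    and "fully_closed X Y p"
    and "has_LUR_lsc_norm Y"
    and "\<forall>y\<in>topspace Y. has_LUR_lsc_norm (subtopology X {x\<in>topspace X. p x = y})"
  shows "has_LUR_lsc_norm X"
proof -
  interpret fully_closed_map X Y p
    by unfold_locales (fact assms)+
  show ?thesis
    using total_space_has_LUR_lsc_norm assms(6,7) by (simp add: fibre_def)
qed

end
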